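(* Let $\mathscr{C}=\Theta\times S^1(\delta)\times W$ with neutral potential metric $g_0$, let $g_{\mathcal P}$ be one of the potential metrics in 1–3 below, and let $a=\varphi\beta$ ($\beta\in E_W(\mu)$, $\beta\ne0$, $\varphi_x(\cdot)\in E_{S^1(\delta)}(\lambda)$ for all $x\in\Theta$) define an elementary oscillating metric of order 1 in the potential $g_{\mathcal P}$, with mass frequency $M>0$ and with well-defined electric charge, of relative electric charge frequency $Q$. Let $\Psi:\Theta\to\mathbb{C}$ be its state function. Write $\Delta=-\sum_{k=1}^3\frac{\partial^2}{(\partial x^k)^2}$. 1. (Neutral potential.) If $g_{\mathcal P}=g_0$, then $2iM\frac{\partial\Psi}{\partial t}=\Delta\Psi+\frac{\partial^2\Psi}{\partial t^2}$. 2. (Potential without electromagnetism.) Suppose $\Theta=I\times\mathcal U\subset\mathbb{R}\times\mathbb{R}^3$ and $g_{\mathcal P}=g_0-2v\,X_1^\flat\otimes X_1^\flat$, with $g_0(X_1,\partial_t)=1$, $g_0(X_1,\partial_u)=0$, $g_0(X_1,X_1)=0$, where: $S_{g_{\mathcal P}}=S_{g_0}$; $v$ is a function on $\mathcal U$; $X_1$ is a vector field on $I\times W$ with $D_{g_0}X_1=0$ and $X_1(\beta')=0$ for all $\beta'\in E_W(\mu)$. Then $$2iM\frac{\partial\Psi}{\partial t}=\Delta\Psi+2vM^2\Psi+(1-2v)\frac{\partial^2\Psi}{\partial t^2}+4iMv\frac{\partial\Psi}{\partial t}.$$ 3. (Electromagnetic potential.) Suppose $g_{\mathcal P}=g_0+\Upsilon^\flat\otimes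 X_2^\flat+X_2^\flat\otimes\Upsilon^\flat$, with $g_0(X_2,\partial_u)=1$, $g_0(X_2,\Upsilon)=0$, $g_0(X_2,X_2)=0$, where: $S_{g_{\mathcal P}}=S_{g_0}$; $\Upsilon$ is a vector field on $\Theta$; $X_2$ is a vector field on $S^1(\delta)\times W$ with $D_{g_0}X_2=0$ and $X_2(\beta')=0$ for all $\beta'\in E_W(\mu)$. Then $$2iM\frac{\partial\Psi}{\partial t}=\sum_{j=0}^3\varepsilon_j\Big(i\frac{\partial}{\partial x^j}+Q\Upsilon^j\Big)^2\Psi-2MQ\Upsilon^0\Psi,$$ where $\varepsilon_j=(g_0)_{jj}$, i.e. $\varepsilon_0=-1$, $\varepsilon_1=\varepsilon_2=\varepsilon_3=1$, $x^0=t$, $\Upsilon=\sum_{j=0}^3\Upsilon^j\frac{\partial}{\partial x^j}$, and the square of an operator is its composition with itself.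
   Context: $\Theta\subset\mathbb{R}^4$ is open with coordinates $(t=x^0,x^1,x^2,x^3)$; $S^1(\delta)=\mathbb{R}/2\pi\delta\mathbb{Z}$ with coordinate $u$; $W$ is a compact manifold; $n=\dim\mathscr{C}$. A neutral potential metric is $g_0=g_\Theta\times(-g_{S^1(\delta)})\times g_W$ with $g_\Theta=-dt^2+\sum_k(dx^k)^2$, $g_{S^1(\delta)}=du^2$, and $g_W$ a Riemannian metric of constant scalar curvature on $W$. $\flat$ is taken with respect to $g_0$; $D_{g_0}$ is the Levi-Civita connection of $g_0$. A function or vector field "on" a factor of $\mathscr{C}$ is regarded as defined on $\mathscr{C}$, depending only on the variables of that factor (and, for a vector field, tangent to that factor). For a metric $g$: $\Box_g:=-\nabla^i\nabla_i$, and $S_g$ is its scalar curvature. $S:=\frac{n-2}{4(n-1)}S_{g_0}$. $E_W(\mu)$ and $E_{S^1(\delta)}(\lambda)$ denote the eigenspaces, for eigenvalues $\mu,\lambda\ge0$, of the Laplacians $-\nabla^i\nabla_i$ of the Riemannian manifolds $(W,g_W)$ and $(S^1(\delta),g_{S^1(\delta)})$. $a=\varphi\beta$ defines an elementary oscillating metric of order 1 in the potential $g_{\mathcal P}$ (the metric being $|a|^{4/(n-2)}g_{\mathcal P}$) if $\beta\in E_W(\mu)$, $\varphi:\Theta\times S^1(\delta)\to\mathbb{R}$ is smooth with $\varphi_x(\cdot):=\varphi(x,\cdot)\in E_{S^1(\delta)}(\lambda)$ for all $x\in\Theta$, $a$ satisfies $\Box_{g_{\mathcal P}}a+Sa=0$,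 and $g_{\mathcal P}$ is neutral on $E_W(\mu)$, i.e. $\Box_{g_{\mathcal P}}(\psi\beta')=(\Box_{g_{\mathcal P}}\psi+\mu\psi)\beta'$ for all smooth $\psi:\Theta\times S^1(\delta)\to\mathbb{R}$ and $\beta'\in E_W(\mu)$. The mass frequency $M$ is given by $M^2=S+\mu-\lambda$. Let $Q^+=\sqrt\lambda$ and write $\varphi(x,u)=\varphi_1(x)\cos(Q^+u)+\varphi_2(x)\sin(Q^+u)$; the canonical function is $a_c=\varphi_1+i\varphi_2$ if $Q^+\neq0$ and $a_c=\varphi_1$ if $Q^+=0$. The electric charge is well defined if $Q^+=0$ (then $Q=0$), or if the vector field on $\Theta$ given by $\int_{S^1(\delta)\times W}\frac{\partial a}{\partial u}\big((\partial_0a)\partial_0-\sum_{k=1}^3(\partial_ka)\partial_k\big)\,dv_{g_0}$ is timelike and either everywhere in the time orientation of $\Theta$ given by $\partial_t$ (then $Q=Q^+$) or everywhere opposite to it (then $Q=-Q^+$). When $M>0$ and the charge is well defined, the state function is $\Psi=e^{iMt}a_c$ if the charge is positive (or zero) and $\Psi=e^{iMt}\overline{a_c}$ if it is negative.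
   Formalization: In item 3 the components Υ^j (in the squared operators and the last term) are replaced by the lowered components Υ_j = ε_jΥ^j, i.e. the sign of Υ^0 is reversed; the printed formula fails for constant Υ = c∂_t with c>0, Q>0. *)

theory Defs
  imports "HOL-Analysis.Analysis" "Jordan_Normal_Form.Determinant"
begin

section \<open>Calculus on Euclidean n-space\<close>

text \<open>Points of n-space are functions \<open>x :: nat \<Rightarrow> real\<close> with \<open>x i = 0\<close> for \<open>i \<ge> n\<close>, that is, the points of
  the library topology \<^const>\<open>Euclidean_space\<close>. Hence dimensions are ordinary natural numbers (0 included), and
  coordinates of a product are obtained by concatenation.\<close>

definition pd :: "nat \<Rightarrow> ((nat \<Rightarrow> real) \<Rightarrow> 'b::real_normed_vector) \<Rightarrow> (nat \<Rightarrow> real) \<Rightarrow> 'b" where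
  "pd i f x = vector_derivative (\<lambda>s. f (x(i := s))) (at (x i))"

text \<open>Smoothness on an open set \<open>U\<close> of n-space: all iterated partial derivatives exist and are continuous.\<close>

definition smooth_fun :: "nat \<Rightarrow> (nat \<Rightarrow> real) set \<Rightarrow> ((nat \<Rightarrow> real) \<Rightarrow> real) \<Rightarrow> bool" where
  "smooth_fun n U f \<longleftrightarrow>
     (\<forall>is. set is \<subseteq> {..<n} \<longrightarrow>
        continuous_on U (foldr pd is f) \<and>
        (\<forall>x\<in>U. \<forall>i<n. (\<lambda>s. foldr pd is f (x(i := s))) differentiable (at (x i))))"

section \<open>Smooth manifolds\<close>

text \<open>An indexed atlas: \<open>chart M c\<close> maps \<open>chart_dom M c\<close> onto an open set of n-space. The charts carry labels \<open>c\<close>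
  so that a chart of a product manifold is a pair of charts of the factors.\<close>

record ('a, 'c) mfd =
  pts :: "'a set"
  mdim :: nat
  charts :: "'c set"
  chart_dom :: "'c \<Rightarrow> 'a set"
  chart :: "'c \<Rightarrow> 'a \<Rightarrow> nat \<Rightarrow> real"

definition param :: "('a, 'c) mfd \<Rightarrow> 'c \<Rightarrow> (nat \<Rightarrow> real) \<Rightarrow> 'a" where
  "param M c = inv_into (chart_dom M c) (chart M c)"

definition mfd_topology :: "('a, 'c) mfd \<Rightarrow> 'a topology" where
  "mfd_topology M = topology (\<lambda>S. S \<subseteq> pts M \<and>
     (\<forall>c\<in>charts M. openin (Euclidean_space (mdim M)) (chart M c ` (S \<inter> chart_dom M c))))"

definition smooth_manifold :: "('a, 'c) mfd \<Rightarrow> bool" where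
  "smooth_manifold M \<longleftrightarrow>
     (\<Union>c\<in>charts M. chart_dom M c) = pts M \<and>
     (\<forall>c\<in>charts M. inj_on (chart M c) (chart_dom M c)) \<and>
     (\<forall>c\<in>charts M. \<forall>d\<in>charts M.
        openin (Euclidean_space (mdim M)) (chart M c ` (chart_dom M c \<inter> chart_dom M d)) \<and>
        (\<forall>i<mdim M. smooth_fun (mdim M) (chart M c ` (chart_dom M c \<inter> chart_dom M d))
                       (\<lambda>x. chart M d (param M c x) i))) \<and>
     Hausdorff_space (mfd_topology M) \<and> second_countable (mfd_topology M)"

definition smooth_in_chart :: "('a, 'c) mfd \<Rightarrow> 'c \<Rightarrow> ('a \<Rightarrow> real) \<Rightarrow> bool" where
  "smooth_in_chart M c f \<longleftrightarrow>
     smooth_fun (mdim M) (chart M c ` chart_dom M c) (\<lambda>x. f (param M c x))"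

definition smooth_function :: "('a, 'c) mfd \<Rightarrow> ('a \<Rightarrow> real) \<Rightarrow> bool" where
  "smooth_function M f \<longleftrightarrow> (\<forall>c\<in>charts M. smooth_in_chart M c f)"

text \<open>The i-th coordinate derivative in the chart \<open>c\<close>, as an operator on functions on the domain of \<open>c\<close>.\<close>

definition cderiv :: "('a, 'c) mfd \<Rightarrow> 'c \<Rightarrow> nat \<Rightarrow> ('a \<Rightarrow> real) \<Rightarrow> 'a \<Rightarrow> real" where
  "cderiv M c i f p = pd i (\<lambda>x. f (param M c x)) (chart M c p)"

definition chart_at :: "('a, 'c) mfd \<Rightarrow> 'a \<Rightarrow> 'c" where
  "chart_at M p = (SOME c. c \<in> charts M \<and> p \<in> chart_dom M c)"

section \<open>Tensor fields\<close>

text \<open>Tensor fields are given by their components in every chart, subject to the transformation law.\<close>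

type_synonym ('a, 'c) vfield = "'c \<Rightarrow> 'a \<Rightarrow> nat \<Rightarrow> real"
type_synonym ('a, 'c) bilin_field = "'c \<Rightarrow> 'a \<Rightarrow> nat \<Rightarrow> nat \<Rightarrow> real"

definition jac :: "('a, 'c) mfd \<Rightarrow> 'c \<Rightarrow> 'c \<Rightarrow> 'a \<Rightarrow> nat \<Rightarrow> nat \<Rightarrow> real" where
  "jac M c d p i j = cderiv M c j (\<lambda>q. chart M d q i) p"

definition vector_field :: "('a, 'c) mfd \<Rightarrow> ('a, 'c) vfield \<Rightarrow> bool" where
  "vector_field M X \<longleftrightarrow>
     (\<forall>c\<in>charts M. \<forall>i<mdim M. smooth_in_chart M c (\<lambda>p. X c p i)) \<and>
     (\<forall>c\<in>charts M. \<forall>d\<in>charts M. \<forall>p\<in>chart_dom M c \<inter> chart_dom M d. \<forall>i<mdim M.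
        X d p i = (\<Sum>j<mdim M. jac M c d p i j * X c p j))"

definition riemannian_metric :: "('a, 'c) mfd \<Rightarrow> ('a, 'c) bilin_field \<Rightarrow> bool" where
  "riemannian_metric M g \<longleftrightarrow>
     (\<forall>c\<in>charts M. \<forall>i<mdim M. \<forall>j<mdim M. smooth_in_chart M c (\<lambda>p. g c p i j)) \<and>
     (\<forall>c\<in>charts M. \<forall>d\<in>charts M. \<forall>p\<in>chart_dom M c \<inter> chart_dom M d. \<forall>i<mdim M. \<forall>j<mdim M.
        g c p i j = (\<Sum>k<mdim M. \<Sum>l<mdim M. jac M c d p k i * jac M c d p l j * g d p k l)) \<and>
     (\<forall>c\<in>charts M. \<forall>p\<in>chart_dom M c.
        (\<forall>i<mdim M. \<forall>j<mdim M. g c p i j = g c p j i) \<and>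
        (\<forall>\<xi>. (\<exists>i<mdim M. \<xi> i \<noteq> 0) \<longrightarrow>
              (\<Sum>i<mdim M. \<Sum>j<mdim M. g c p i j * \<xi> i * \<xi> j) > 0))"

definition ginner :: "nat \<Rightarrow> (nat \<Rightarrow> nat \<Rightarrow> real) \<Rightarrow> (nat \<Rightarrow> real) \<Rightarrow> (nat \<Rightarrow> real) \<Rightarrow> real" where
  "ginner n G X Y = (\<Sum>i<n. \<Sum>j<n. G i j * X i * Y j)"

definition unit_vec_field :: "nat \<Rightarrow> nat \<Rightarrow> real" where
  "unit_vec_field k i = (if i = k then 1 else 0)"

definition flat :: "('a, 'c) mfd \<Rightarrow> ('a, 'c) bilin_field \<Rightarrow> ('a, 'c) vfield \<Rightarrow> 'c \<Rightarrow> 'a \<Rightarrow> nat \<Rightarrow> real" where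
  "flat M g X c p i = (\<Sum>j<mdim M. g c p i j * X c p j)"

text \<open>The derivative \<open>X(f)\<close>, computed in the chart \<open>c\<close>.\<close>

definition vf_apply :: "('a, 'c) mfd \<Rightarrow> ('a, 'c) vfield \<Rightarrow> 'c \<Rightarrow> ('a \<Rightarrow> real) \<Rightarrow> 'a \<Rightarrow> real" where
  "vf_apply M X c f p = (\<Sum>i<mdim M. X c p i * cderiv M c i f p)"

section \<open>Levi-Civita connection, Laplacian, scalar curvature, volume\<close>

definition gmat :: "('a, 'c) mfd \<Rightarrow> ('a, 'c) bilin_field \<Rightarrow> 'c \<Rightarrow> 'a \<Rightarrow> real mat" where
  "gmat M g c p = mat (mdim M) (mdim M) (\<lambda>(i, j). g c p i j)"

definition ginv :: "('a, 'c) mfd \<Rightarrow> ('a, 'c) bilin_field \<Rightarrow> ('a, 'c) bilin_field" where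
  "ginv M g c p i j =
     (THE B. B \<in> carrier_mat (mdim M) (mdim M) \<and>
             inverts_mat (gmat M g c p) B \<and> inverts_mat B (gmat M g c p)) $$ (i, j)"

definition christoffel :: "('a, 'c) mfd \<Rightarrow> ('a, 'c) bilin_field \<Rightarrow> 'c \<Rightarrow> nat \<Rightarrow> nat \<Rightarrow> nat \<Rightarrow> 'a \<Rightarrow> real" where
  "christoffel M g c k i j p =
     (1/2) * (\<Sum>l<mdim M. ginv M g c p k l *
        (cderiv M c i (\<lambda>q. g c q j l) p + cderiv M c j (\<lambda>q. g c q i l) p - cderiv M c l (\<lambda>q. g c q i j) p))"

definition parallel :: "('a, 'c) mfd \<Rightarrow> ('a, 'c) bilin_field \<Rightarrow> ('a, 'c) vfield \<Rightarrow> bool" where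
  "parallel M g X \<longleftrightarrow>
     (\<forall>c\<in>charts M. \<forall>p\<in>chart_dom M c. \<forall>i<mdim M. \<forall>k<mdim M.
        cderiv M c i (\<lambda>q. X c q k) p + (\<Sum>j<mdim M. christoffel M g c k i j p * X c p j) = 0)"

text \<open>\<open>box_op M g f = - \<nabla>\<^sup>i \<nabla>\<^sub>i f\<close>. This and the scalar curvature below do not depend on the chart around \<open>p\<close>.\<close>

definition box_op :: "('a, 'c) mfd \<Rightarrow> ('a, 'c) bilin_field \<Rightarrow> ('a \<Rightarrow> real) \<Rightarrow> 'a \<Rightarrow> real" where
  "box_op M g f p = (let c = chart_at M p in
     - (\<Sum>i<mdim M. \<Sum>j<mdim M. ginv M g c p i j *
          (cderiv M c i (cderiv M c j f) p - (\<Sum>k<mdim M. christoffel M g c k i j p * cderiv M c k f p))))"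

definition ricci :: "('a, 'c) mfd \<Rightarrow> ('a, 'c) bilin_field \<Rightarrow> 'c \<Rightarrow> nat \<Rightarrow> nat \<Rightarrow> 'a \<Rightarrow> real" where
  "ricci M g c j k p =
     (\<Sum>i<mdim M. cderiv M c i (christoffel M g c i j k) p - cderiv M c j (christoffel M g c i i k) p +
        (\<Sum>l<mdim M. christoffel M g c i i l p * christoffel M g c l j k p
                     - christoffel M g c i j l p * christoffel M g c l i k p))"

definition scal :: "('a, 'c) mfd \<Rightarrow> ('a, 'c) bilin_field \<Rightarrow> 'a \<Rightarrow> real" where
  "scal M g p = (let c = chart_at M p in
     (\<Sum>j<mdim M. \<Sum>k<mdim M. ginv M g c p j k * ricci M g c j k p))"

definition eigenspace :: "('a, 'c) mfd \<Rightarrow> ('a, 'c) bilin_field \<Rightarrow> real \<Rightarrow> ('a \<Rightarrow> real) set" where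
  "eigenspace M g \<mu> = {f. smooth_function M f \<and> (\<forall>p\<in>pts M. box_op M g f p = \<mu> * f p)}"

definition laplace_eigenvalue :: "('a, 'c) mfd \<Rightarrow> ('a, 'c) bilin_field \<Rightarrow> real \<Rightarrow> bool" where
  "laplace_eigenvalue M g \<mu> \<longleftrightarrow> (\<exists>f\<in>eigenspace M g \<mu>. \<exists>p\<in>pts M. f p \<noteq> 0)"

text \<open>The measure \<open>dv\<^sub>g\<close>: the Borel measure with density \<open>\<bar>det g\<bar>\<^sup>1\<^sup>/\<^sup>2\<close> in every chart. Elements of the product measure
  space over \<open>{..<n}\<close> are undefined outside \<open>{..<n}\<close>, whence \<open>zero_ext\<close>.\<close>

definition zero_ext :: "nat \<Rightarrow> (nat \<Rightarrow> real) \<Rightarrow> nat \<Rightarrow> real" where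
  "zero_ext n y i = (if i < n then y i else 0)"

definition is_volume_measure :: "('a, 'c) mfd \<Rightarrow> ('a, 'c) bilin_field \<Rightarrow> 'a measure \<Rightarrow> bool" where
  "is_volume_measure M g \<nu> \<longleftrightarrow>
     space \<nu> = pts M \<and>
     sets \<nu> = sigma_sets (pts M) {U. openin (mfd_topology M) U} \<and>
     (\<forall>c\<in>charts M. \<forall>A\<in>sets \<nu>. A \<subseteq> chart_dom M c \<longrightarrow>
        emeasure \<nu> A =
          (\<integral>\<^sup>+ y. indicator (chart M c ` A) (zero_ext (mdim M) y) *
                  ennreal (sqrt \<bar>Determinant.det (gmat M g c (param M c (zero_ext (mdim M) y)))\<bar>)
             \<partial>(\<Pi>\<^sub>M i\<in>{..<mdim M}. lborel)))"

definition volume_measure :: "('a, 'c) mfd \<Rightarrow> ('a, 'c) bilin_field \<Rightarrow> 'a measure" where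
  "volume_measure M g = (THE \<nu>. is_volume_measure M g \<nu>)"

section \<open>The factors and the product\<close>

definition euclid_mfd :: "nat \<Rightarrow> (nat \<Rightarrow> real) set \<Rightarrow> (nat \<Rightarrow> real, unit) mfd" where
  "euclid_mfd n U = \<lparr>pts = U, mdim = n, charts = {()}, chart_dom = (\<lambda>_. U), chart = (\<lambda>_ x. x)\<rparr>"

text \<open>\<open>S\<^sup>1(\<delta>) = \<real> / 2\<pi>\<delta>\<int>\<close>; the chart labelled \<open>r\<close> is the coordinate \<open>u\<close> with values in the interval \<open>(r, r + 2\<pi>\<delta>)\<close>.\<close>

definition circle_rel :: "real \<Rightarrow> (real \<times> real) set" where
  "circle_rel \<delta> = {(u, v). \<exists>k::int. v = u + 2 * pi * \<delta> * of_int k}"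

definition circle_pt :: "real \<Rightarrow> real \<Rightarrow> real set" where
  "circle_pt \<delta> u = circle_rel \<delta> `` {u}"

definition circle_mfd :: "real \<Rightarrow> (real set, real) mfd" where
  "circle_mfd \<delta> = \<lparr>pts = UNIV // circle_rel \<delta>, mdim = 1, charts = UNIV,
     chart_dom = (\<lambda>r. circle_pt \<delta> ` {r <..< r + 2 * pi * \<delta>}),
     chart = (\<lambda>r s i. if i = 0 then (THE v. v \<in> s \<and> r < v \<and> v < r + 2 * pi * \<delta>) else 0)\<rparr>"

definition product_mfd :: "('a, 'c) mfd \<Rightarrow> ('b, 'd) mfd \<Rightarrow> ('a \<times> 'b, 'c \<times> 'd) mfd" where
  "product_mfd M N = \<lparr>pts = pts M \<times> pts N, mdim = mdim M + mdim N, charts = charts M \<times> charts N,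
     chart_dom = (\<lambda>(c, d). chart_dom M c \<times> chart_dom N d),
     chart = (\<lambda>(c, d) (p, q) i. if i < mdim M then chart M c p i else chart N d q (i - mdim M))\<rparr>"

text \<open>The first argument is the dimension of the first factor.\<close>

definition product_metric ::
  "nat \<Rightarrow> ('a, 'c) bilin_field \<Rightarrow> ('b, 'd) bilin_field \<Rightarrow> ('a \<times> 'b, 'c \<times> 'd) bilin_field" where
  "product_metric m g h = (\<lambda>(c, d) (p, q) i j.
     if i < m \<and> j < m then g c p i j
     else if m \<le> i \<and> m \<le> j then h d q (i - m) (j - m) else 0)"

definition minkowski :: "(nat \<Rightarrow> real, unit) bilin_field" where
  "minkowski c x i j = (if i = j then (if i = 0 then - 1 else 1) else 0)"

definition circle_metric :: "(real set, real) bilin_field" where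
  "circle_metric c s i j = (if i = j then 1 else 0)"

definition fibre_mfd :: "real \<Rightarrow> ('w, 'c) mfd \<Rightarrow> (real set \<times> 'w, real \<times> 'c) mfd" where
  "fibre_mfd \<delta> W = product_mfd (circle_mfd \<delta>) W"

definition fibre_metric :: "('w, 'c) bilin_field \<Rightarrow> (real set \<times> 'w, real \<times> 'c) bilin_field" where
  "fibre_metric gW = product_metric 1 (\<lambda>c s i j. - circle_metric c s i j) gW"

text \<open>Points of \<open>\<Theta> \<times> S\<^sup>1(\<delta>) \<times> W\<close> are triples \<open>(x, s, w)\<close>. The coordinates with indices 0, ..., 3 are those of \<open>\<Theta>\<close>,
  the coordinate with index 4 is \<open>u\<close>, and the remaining ones come from a chart of \<open>W\<close>.\<close>

type_synonym 'w pt = "(nat \<Rightarrow> real) \<times> real set \<times> 'w"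
type_synonym 'c lab = "unit \<times> real \<times> 'c"

definition spacetime :: "(nat \<Rightarrow> real) set \<Rightarrow> real \<Rightarrow> ('w, 'c) mfd \<Rightarrow> ('w pt, 'c lab) mfd" where
  "spacetime \<Theta> \<delta> W = product_mfd (euclid_mfd 4 \<Theta>) (fibre_mfd \<delta> W)"

definition neutral_metric :: "('w, 'c) bilin_field \<Rightarrow> ('w pt, 'c lab) bilin_field" where
  "neutral_metric gW = product_metric 4 minkowski (fibre_metric gW)"

text \<open>Functions and vector fields on a factor, regarded as defined on the product.\<close>

definition on_base_circle :: "((nat \<Rightarrow> real) \<times> real set \<Rightarrow> real) \<Rightarrow> 'w pt \<Rightarrow> real" where
  "on_base_circle \<psi> = (\<lambda>(x, s, w). \<psi> (x, s))"

definition on_W :: "('w \<Rightarrow> real) \<Rightarrow> 'w pt \<Rightarrow> real" where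
  "on_W \<beta> = (\<lambda>(x, s, w). \<beta> w)"

definition on_space :: "((nat \<Rightarrow> real) \<Rightarrow> real) \<Rightarrow> 'w pt \<Rightarrow> real" where
  "on_space v = (\<lambda>(x, s, w). v (\<lambda>k. x (Suc k)))"

definition time_pt :: "real \<Rightarrow> nat \<Rightarrow> real" where
  "time_pt t i = (if i = 0 then t else 0)"

definition time_W_mfd :: "real set \<Rightarrow> ('w, 'c) mfd \<Rightarrow> ((nat \<Rightarrow> real) \<times> 'w, unit \<times> 'c) mfd" where
  "time_W_mfd I W = product_mfd (euclid_mfd 1 (time_pt ` I)) W"

definition lift_time_W :: "((nat \<Rightarrow> real) \<times> 'w, unit \<times> 'c) vfield \<Rightarrow> ('w pt, 'c lab) vfield" where
  "lift_time_W X = (\<lambda>(_, r, d) (x, s, w) i.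
     if i = 0 then X ((), d) (time_pt (x 0), w) 0
     else if i < 5 then 0 else X ((), d) (time_pt (x 0), w) (i - 4))"

definition lift_fibre :: "(real set \<times> 'w, real \<times> 'c) vfield \<Rightarrow> ('w pt, 'c lab) vfield" where
  "lift_fibre X = (\<lambda>(_, r, d) (x, s, w) i. if i < 4 then 0 else X (r, d) (s, w) (i - 4))"

definition lift_base :: "((nat \<Rightarrow> real) \<Rightarrow> nat \<Rightarrow> real) \<Rightarrow> ('w pt, 'c lab) vfield" where
  "lift_base Y = (\<lambda>c (x, s, w) i. if i < 4 then Y x i else 0)"

text \<open>\<open>g\<^sub>0(X, \<partial>\<^sub>k) = a\<close> everywhere; only used for the globally defined fields \<open>\<partial>\<^sub>t\<close> (index 0) and \<open>\<partial>\<^sub>u\<close> (index 4).\<close>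

definition inner_coord_eq :: "('a, 'c) mfd \<Rightarrow> ('a, 'c) bilin_field \<Rightarrow> ('a, 'c) vfield \<Rightarrow> nat \<Rightarrow> real \<Rightarrow> bool" where
  "inner_coord_eq M g X k a \<longleftrightarrow>
     (\<forall>c\<in>charts M. \<forall>p\<in>chart_dom M c. ginner (mdim M) (g c p) (X c p) (unit_vec_field k) = a)"

definition inner_eq :: "('a, 'c) mfd \<Rightarrow> ('a, 'c) bilin_field \<Rightarrow> ('a, 'c) vfield \<Rightarrow> ('a, 'c) vfield \<Rightarrow> real \<Rightarrow> bool" where
  "inner_eq M g X Y a \<longleftrightarrow>
     (\<forall>c\<in>charts M. \<forall>p\<in>chart_dom M c. ginner (mdim M) (g c p) (X c p) (Y c p) = a)"

definition annihilates_eigenspace ::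
  "(nat \<Rightarrow> real) set \<Rightarrow> real \<Rightarrow> ('w, 'c) mfd \<Rightarrow> ('w, 'c) bilin_field \<Rightarrow> real \<Rightarrow> ('w pt, 'c lab) vfield \<Rightarrow> bool" where
  "annihilates_eigenspace \<Theta> \<delta> W gW \<mu> X \<longleftrightarrow>
     (\<forall>\<beta>'\<in>eigenspace W gW \<mu>. \<forall>c\<in>charts (spacetime \<Theta> \<delta> W). \<forall>p\<in>chart_dom (spacetime \<Theta> \<delta> W) c.
        vf_apply (spacetime \<Theta> \<delta> W) X c (on_W \<beta>') p = 0)"

section \<open>Elementary oscillating metrics\<close>

definition S_term :: "('a, 'c) mfd \<Rightarrow> ('a, 'c) bilin_field \<Rightarrow> 'a \<Rightarrow> real" where
  "S_term M g0 p = (real (mdim M) - 2) / (4 * (real (mdim M) - 1)) * scal M g0 p"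

definition neutral_on_eigenspace ::
  "(nat \<Rightarrow> real) set \<Rightarrow> real \<Rightarrow> ('w, 'c) mfd \<Rightarrow> ('w, 'c) bilin_field \<Rightarrow> ('w pt, 'c lab) bilin_field \<Rightarrow> real \<Rightarrow> bool" where
  "neutral_on_eigenspace \<Theta> \<delta> W gW gP \<mu> \<longleftrightarrow>
     (\<forall>\<psi> \<beta>'. smooth_function (product_mfd (euclid_mfd 4 \<Theta>) (circle_mfd \<delta>)) \<psi> \<longrightarrow>
        \<beta>' \<in> eigenspace W gW \<mu> \<longrightarrow>
        (\<forall>p\<in>pts (spacetime \<Theta> \<delta> W).
           box_op (spacetime \<Theta> \<delta> W) gP (\<lambda>q. on_base_circle \<psi> q * on_W \<beta>' q) p =
           (box_op (spacetime \<Theta> \<delta> W) gP (on_base_circle \<psi>) p + \<mu> * on_base_circle \<psi> p) * on_W \<beta>' p))"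

definition elementary_oscillating ::
  "(nat \<Rightarrow> real) set \<Rightarrow> real \<Rightarrow> ('w, 'c) mfd \<Rightarrow> ('w, 'c) bilin_field \<Rightarrow> ('w pt, 'c lab) bilin_field \<Rightarrow> real \<Rightarrow> real \<Rightarrow>
     ((nat \<Rightarrow> real) \<times> real set \<Rightarrow> real) \<Rightarrow> ('w \<Rightarrow> real) \<Rightarrow> bool" where
  "elementary_oscillating \<Theta> \<delta> W gW gP \<mu> lam \<phi> \<beta> \<longleftrightarrow>
     0 \<le> \<mu> \<and> laplace_eigenvalue W gW \<mu> \<and>
     0 \<le> lam \<and> laplace_eigenvalue (circle_mfd \<delta>) circle_metric lam \<and>
     \<beta> \<in> eigenspace W gW \<mu> \<and>
     smooth_function (product_mfd (euclid_mfd 4 \<Theta>) (circle_mfd \<delta>)) \<phi> \<and>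
     (\<forall>x\<in>\<Theta>. (\<lambda>s. \<phi> (x, s)) \<in> eigenspace (circle_mfd \<delta>) circle_metric lam) \<and>
     (\<forall>p\<in>pts (spacetime \<Theta> \<delta> W).
        box_op (spacetime \<Theta> \<delta> W) gP (\<lambda>q. on_base_circle \<phi> q * on_W \<beta> q) p +
        S_term (spacetime \<Theta> \<delta> W) (neutral_metric gW) p * (on_base_circle \<phi> p * on_W \<beta> p) = 0) \<and>
     neutral_on_eigenspace \<Theta> \<delta> W gW gP \<mu>"

definition mass_frequency ::
  "(nat \<Rightarrow> real) set \<Rightarrow> real \<Rightarrow> ('w, 'c) mfd \<Rightarrow> ('w, 'c) bilin_field \<Rightarrow> real \<Rightarrow> real \<Rightarrow> real \<Rightarrow> bool" where
  "mass_frequency \<Theta> \<delta> W gW \<mu> lam M \<longleftrightarrow>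
     (\<forall>p\<in>pts (spacetime \<Theta> \<delta> W). M\<^sup>2 = S_term (spacetime \<Theta> \<delta> W) (neutral_metric gW) p + \<mu> - lam)"

text \<open>The components of the vector field on \<open>\<Theta>\<close> that determines the sign of the electric charge.\<close>

definition charge_field ::
  "(nat \<Rightarrow> real) set \<Rightarrow> real \<Rightarrow> ('w, 'c) mfd \<Rightarrow> ('w, 'c) bilin_field \<Rightarrow> ('w pt \<Rightarrow> real) \<Rightarrow>
     (nat \<Rightarrow> real) \<Rightarrow> nat \<Rightarrow> real" where
  "charge_field \<Theta> \<delta> W gW a x j =
     (let D = (\<lambda>i p. cderiv (spacetime \<Theta> \<delta> W) (chart_at (spacetime \<Theta> \<delta> W) p) i a p) in
      \<integral>q. D 4 (x, q) * (if j = 0 then D 0 (x, q) else - D j (x, q))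
        \<partial>(volume_measure (fibre_mfd \<delta> W) (fibre_metric gW)))"

definition electric_charge ::
  "(nat \<Rightarrow> real) set \<Rightarrow> real \<Rightarrow> ('w, 'c) mfd \<Rightarrow> ('w, 'c) bilin_field \<Rightarrow> real \<Rightarrow> ('w pt \<Rightarrow> real) \<Rightarrow> real \<Rightarrow> bool" where
  "electric_charge \<Theta> \<delta> W gW lam a Q \<longleftrightarrow>
     (let Qplus = sqrt lam; J = charge_field \<Theta> \<delta> W gW a in
      (Qplus = 0 \<and> Q = 0) \<or>
      ((\<forall>x\<in>\<Theta>. ginner 4 (minkowski () x) (J x) (J x) < 0 \<and>
              ginner 4 (minkowski () x) (J x) (unit_vec_field 0) < 0) \<and> Q = Qplus) \<or>
      ((\<forall>x\<in>\<Theta>. ginner 4 (minkowski () x) (J x) (J x) < 0 \<and>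
              ginner 4 (minkowski () x) (J x) (unit_vec_field 0) > 0) \<and> Q = - Qplus))"

definition fourier_parts ::
  "(nat \<Rightarrow> real) set \<Rightarrow> real \<Rightarrow> real \<Rightarrow> ((nat \<Rightarrow> real) \<times> real set \<Rightarrow> real) \<Rightarrow>
     ((nat \<Rightarrow> real) \<Rightarrow> real) \<times> ((nat \<Rightarrow> real) \<Rightarrow> real)" where
  "fourier_parts \<Theta> \<delta> lam \<phi> = (SOME (\<phi>1, \<phi>2). \<forall>x\<in>\<Theta>. \<forall>u.
     \<phi> (x, circle_pt \<delta> u) = \<phi>1 x * cos (sqrt lam * u) + \<phi>2 x * sin (sqrt lam * u))"

definition canonical_function ::
  "(nat \<Rightarrow> real) set \<Rightarrow> real \<Rightarrow> real \<Rightarrow> ((nat \<Rightarrow> real) \<times> real set \<Rightarrow> real) \<Rightarrow> (nat \<Rightarrow> real) \<Rightarrow> complex" where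
  "canonical_function \<Theta> \<delta> lam \<phi> x = (let (\<phi>1, \<phi>2) = fourier_parts \<Theta> \<delta> lam \<phi> in
     if sqrt lam \<noteq> 0 then of_real (\<phi>1 x) + \<i> * of_real (\<phi>2 x) else of_real (\<phi>1 x))"

definition state_function ::
  "(nat \<Rightarrow> real) set \<Rightarrow> real \<Rightarrow> real \<Rightarrow> ((nat \<Rightarrow> real) \<times> real set \<Rightarrow> real) \<Rightarrow> real \<Rightarrow> real \<Rightarrow>
     (nat \<Rightarrow> real) \<Rightarrow> complex" where
  "state_function \<Theta> \<delta> lam \<phi> M Q x = exp (\<i> * of_real (M * x 0)) *
     (if Q \<ge> 0 then canonical_function \<Theta> \<delta> lam \<phi> x else cnj (canonical_function \<Theta> \<delta> lam \<phi> x))"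

section \<open>Potentials and operators\<close>

definition gravity_potential ::
  "('a, 'c) mfd \<Rightarrow> ('a, 'c) bilin_field \<Rightarrow> ('a \<Rightarrow> real) \<Rightarrow> ('a, 'c) vfield \<Rightarrow> ('a, 'c) bilin_field" where
  "gravity_potential M g0 v X c p i j = g0 c p i j - 2 * v p * flat M g0 X c p i * flat M g0 X c p j"

definition em_potential ::
  "('a, 'c) mfd \<Rightarrow> ('a, 'c) bilin_field \<Rightarrow> ('a, 'c) vfield \<Rightarrow> ('a, 'c) vfield \<Rightarrow> ('a, 'c) bilin_field" where
  "em_potential M g0 Y X c p i j =
     g0 c p i j + flat M g0 Y c p i * flat M g0 X c p j + flat M g0 X c p i * flat M g0 Y c p j"

text \<open>The geometer's sign: \<open>\<Delta> = - (\<partial>\<^sub>1\<^sup>2 + \<partial>\<^sub>2\<^sup>2 + \<partial>\<^sub>3\<^sup>2)\<close>.\<close>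

definition space_laplacian :: "((nat \<Rightarrow> real) \<Rightarrow> complex) \<Rightarrow> (nat \<Rightarrow> real) \<Rightarrow> complex" where
  "space_laplacian F x = - (\<Sum>k=1..3. pd k (pd k F) x)"

definition eps :: "nat \<Rightarrow> real" where
  "eps j = minkowski () (\<lambda>_. 0) j j"

text \<open>The components \<open>\<Upsilon>\<^sub>j = \<epsilon>\<^sub>j \<Upsilon>\<^sup>j\<close> of \<open>\<Upsilon>\<^sup>\<flat>\<close>. These, and not the contravariant ones, enter the minimal coupling: the
  two differ in the sign of the time component, and with \<open>\<Upsilon>\<^sup>j\<close> the wave equation already fails for constant \<open>\<Upsilon> = c \<partial>\<^sub>t\<close>.\<close>

definition lowered :: "((nat \<Rightarrow> real) \<Rightarrow> nat \<Rightarrow> real) \<Rightarrow> (nat \<Rightarrow> real) \<Rightarrow> nat \<Rightarrow> real" where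
  "lowered Y x j = eps j * Y x j"

definition coupled_deriv ::
  "real \<Rightarrow> ((nat \<Rightarrow> real) \<Rightarrow> nat \<Rightarrow> real) \<Rightarrow> nat \<Rightarrow> ((nat \<Rightarrow> real) \<Rightarrow> complex) \<Rightarrow> (nat \<Rightarrow> real) \<Rightarrow> complex" where
  "coupled_deriv Q A j F x = \<i> * pd j F x + of_real (Q * A x j) * F x"

end

theory Submission
  imports Defs
begin

text \<open>All three potentials have the form \<open>g\<^sub>0 + Y\<^sup>\<flat> \<otimes> X\<^sup>\<flat> + X\<^sup>\<flat> \<otimes> Y\<^sup>\<flat>\<close> with a parallel null field \<open>X\<close> orthogonal to \<open>Y\<close> (in the
  first two cases \<open>X = Y = 0\<close> and \<open>Y = - v X\<close>). The inverse metric is then polynomial in \<open>X\<close> and \<open>Y\<close>, and in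
  the contracted Christoffel symbols everything cancels except a multiple of \<open>X(f)\<close>, which is 0 for the gravitational
  potential and \<open>X(f) div Y\<close> for the electromagnetic one. By neutrality on the eigenspace the factor \<open>\<beta>\<close> can be removed from
  the wave equation. On the circle \<open>\<phi>\<close> solves the harmonic oscillator equation, so \<open>\<phi> = A cos(Q\<^sup>+ u) + B sin(Q\<^sup>+ u)\<close>, and comparing
  coefficients gives two real equations for \<open>A\<close> and \<open>B\<close>. They are the real and imaginary parts of one equation for \<open>A \<plusminus> i B\<close>,
  where \<open>\<partial>\<^sub>u\<close> has become multiplication by \<open>- i Q\<close>; the factor \<open>e\<^sup>i\<^sup>M\<^sup>t\<close> turns it into the equation for \<open>\<Psi>\<close>.\<close>

section \<open>Partial derivatives and charts\<close>

text \<open>\<open>box_op\<close> is evaluated in the chart picked by \<open>chart_at\<close>, so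
  the computation is carried out at one point in that chart; it needs the metric, its first
  derivatives and its inverse at that point. The circle coordinate there may differ from a
  prescribed \<open>u\<close> by periods. This is harmless, because the existence of a nonzero
  eigenfunction makes \<open>cos (sqrt lam * u)\<close> and \<open>sin (sqrt lam * u)\<close>
  functions on the circle. The inverse metric is polynomial because raising an index of the
  perturbation gives a nilpotent endomorphism. The cancellation has two sources: the one-form dual
  to a parallel field is closed, and the exterior derivative of the one-form dual to
  \<open>Y\<close> vanishes on contraction with \<open>X\<close>. The metric of \<open>W\<close>
  drops out since \<phi> does not vary along \<open>W\<close> and no Christoffel symbol of
  \<open>g0\<close> mixes \<open>W\<close> with the other factors. The mass condition puts
  \<open>M\<^sup>2 + lam\<close> into the wave equation; the second derivative along the circle,
  which is timelike, removes \<open>lam\<close> again.\<close>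

definition has_pd :: "nat \<Rightarrow> ((nat \<Rightarrow> real) \<Rightarrow> 'b::real_normed_vector) \<Rightarrow> (nat \<Rightarrow> real) \<Rightarrow> 'b \<Rightarrow> bool" where
  "has_pd i f x D \<longleftrightarrow> ((\<lambda>s. f (x(i := s))) has_vector_derivative D) (at (x i))"

text \<open>A chart image lies in the subspace where all coordinates from \<open>n\<close> on
  vanish, so it is not open among all functions. A partial derivative looks at a single coordinate
  line, and openness along the first \<open>n\<close> lines is what it requires.\<close>

definition axis_open :: "nat \<Rightarrow> (nat \<Rightarrow> real) set \<Rightarrow> bool" where
  "axis_open n U \<longleftrightarrow> (\<forall>x\<in>U. \<forall>i<n. \<forall>\<^sub>F s in nhds (x i). x(i := s) \<in> U)"

lemma axis_openD: "axis_open n U \<Longrightarrow> x \<in> U \<Longrightarrow> i < n \<Longrightarrow> \<forall>\<^sub>F s in nhds (x i). x(i := s) \<in> U"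
  by (simp add: axis_open_def)

lemma has_pd_imp_pd: "has_pd i f x D \<Longrightarrow> pd i f x = D"
  unfolding has_pd_def pd_def by (rule vector_derivative_at)

lemma has_pd_pd:
  "(\<lambda>s. f (x(i := s))) differentiable (at (x i)) \<Longrightarrow> has_pd i f x (pd i f x)"
  unfolding has_pd_def pd_def by (simp add: vector_derivative_works)

text \<open>\<open>param\<close> has arbitrary values off the chart image, so a function read in a
  chart follows its intended formula only on \<open>U\<close>.\<close>

lemma has_pd_cong:
  assumes "has_pd i f x D" "axis_open n U" "x \<in> U" "i < n" "\<And>y. y \<in> U \<Longrightarrow> f y = g y"
  shows "has_pd i g x D"
proof -
  have ev: "\<forall>\<^sub>F s in nhds (x i). s \<in> UNIV \<longrightarrow> f (x(i := s)) = g (x(i := s))"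
    by (rule eventually_mono[OF axis_openD[OF assms(2-4)]]) (simp add: assms(5))
  have "f (x(i := x i)) = g (x(i := x i))" using assms(3,5) by simp
  then show ?thesis
    using assms(1) has_vector_derivative_cong_ev[OF ev, of D] by (simp add: has_pd_def)
qed

lemma has_pd_const: "has_pd i (\<lambda>x. c) x 0"
  by (simp add: has_pd_def)

lemma has_pd_add: "has_pd i f x D \<Longrightarrow> has_pd i g x E \<Longrightarrow> has_pd i (\<lambda>y. f y + g y) x (D + E)"
  unfolding has_pd_def by (rule has_vector_derivative_add)

lemma has_pd_sum: "(\<And>k. k \<in> K \<Longrightarrow> has_pd i (f k) x (D k)) \<Longrightarrow> has_pd i (\<lambda>y. \<Sum>k\<in>K. f k y) x (\<Sum>k\<in>K. D k)"
  unfolding has_pd_def by (rule has_vector_derivative_sum)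

lemma has_pd_mult:
  fixes f g :: "_ \<Rightarrow> 'b::real_normed_algebra"
  shows "has_pd i f x D \<Longrightarrow> has_pd i g x E \<Longrightarrow> has_pd i (\<lambda>y. f y * g y) x (f x * E + D * g x)"
  unfolding has_pd_def by (drule (1) has_vector_derivative_mult) simp

lemma has_pd_linear:
  "bounded_linear h \<Longrightarrow> has_pd i f x D \<Longrightarrow> has_pd i (\<lambda>y. h (f y)) x (h D)"
  unfolding has_pd_def by (rule bounded_linear.has_vector_derivative)

lemma has_pd_chain:
  fixes f :: "_ \<Rightarrow> real"
  assumes "has_pd i f x D" "(h has_vector_derivative h') (at (f x))"
  shows "has_pd i (\<lambda>y. h (f y)) x (D *\<^sub>R h')"
  using vector_diff_chain_at[of "\<lambda>s. f (x(i := s))" D "x i" h h'] assms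
  by (simp add: has_pd_def o_def)

lemma has_pd_coordinate: "has_pd i (\<lambda>y. y j) x (if i = j then 1 else 0)"
  unfolding has_pd_def by (cases "i = j") (simp_all add: has_vector_derivative_id)

text \<open>Since \<open>i < n\<close>, moving coordinate \<open>i\<close> keeps the tail of
  \<open>x\<close> at 0. The coordinate line is thus a continuous curve in
  \<open>Euclidean_space n\<close> and meets \<open>U\<close> in an open set of parameters.\<close>

lemma openin_Euclidean_imp_axis_open:
  assumes "openin (Euclidean_space n) U"
  shows "axis_open n U"
  unfolding axis_open_def
proof (intro ballI allI impI)
  fix x i assume x: "x \<in> U" "i < n"
  have xt: "x \<in> topspace (Euclidean_space n)" using openin_subset[OF assms] x(1) by (rule subsetD)
  have "continuous_map euclidean (powertop_real UNIV) (\<lambda>s. x(i := s))"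
    unfolding continuous_map_componentwise_UNIV
  proof
    show "continuous_map euclidean euclideanreal (\<lambda>s. (x(i := s)) k)" for k
      by (cases "k = i") simp_all
  qed
  moreover have "(\<lambda>s. x(i := s)) ` topspace euclidean \<subseteq> {y. \<forall>k\<ge>n. y k = 0}"
    using xt x(2) by (auto simp: topspace_Euclidean_space image_subset_iff)
  ultimately have "continuous_map euclidean (Euclidean_space n) (\<lambda>s. x(i := s))"
    by (simp add: Euclidean_space_def continuous_map_in_subtopology image_subset_iff_funcset)
  from openin_continuous_map_preimage[OF this assms]
  have "open {s. x(i := s) \<in> U}" by simp
  then have "\<forall>\<^sub>F s in nhds (x i). s \<in> {s. x(i := s) \<in> U}"
    by (rule eventually_nhds_in_open) (simp add: x(1))
  then show "\<forall>\<^sub>F s in nhds (x i). x(i := s) \<in> U" by simp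
qed

definition has_cderiv :: "('a, 'c) mfd \<Rightarrow> 'c \<Rightarrow> nat \<Rightarrow> ('a \<Rightarrow> real) \<Rightarrow> 'a \<Rightarrow> real \<Rightarrow> bool" where
  "has_cderiv M c i f p D \<longleftrightarrow> has_pd i (\<lambda>x. f (param M c x)) (chart M c p) D"

text \<open>The facts about one chart on which all differentiation rests. They pass from the factors
  to a product chart by chart, without going through \<open>smooth_manifold\<close> for the
  product.\<close>

definition chart_ok :: "('a, 'c) mfd \<Rightarrow> 'c \<Rightarrow> bool" where
  "chart_ok M c \<longleftrightarrow> inj_on (chart M c) (chart_dom M c) \<and> axis_open (mdim M) (chart M c ` chart_dom M c) \<and>
     (\<forall>p\<in>chart_dom M c. \<forall>i\<ge>mdim M. chart M c p i = 0)"

lemma param_chart: "chart_ok M c \<Longrightarrow> p \<in> chart_dom M c \<Longrightarrow> param M c (chart M c p) = p"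
  by (simp add: chart_ok_def param_def)

lemma param_in_dom: "y \<in> chart M c ` chart_dom M c \<Longrightarrow> param M c y \<in> chart_dom M c"
  by (simp add: param_def inv_into_into)

lemma chart_param: "y \<in> chart M c ` chart_dom M c \<Longrightarrow> chart M c (param M c y) = y"
  by (simp add: param_def f_inv_into_f)

lemma has_cderiv_imp_cderiv: "has_cderiv M c i f p D \<Longrightarrow> cderiv M c i f p = D"
  unfolding has_cderiv_def cderiv_def by (rule has_pd_imp_pd)

lemma has_cderiv_cong:
  assumes "has_cderiv M c i f p D" "chart_ok M c" "p \<in> chart_dom M c" "i < mdim M"
    and "\<And>q. q \<in> chart_dom M c \<Longrightarrow> f q = g q"
  shows "has_cderiv M c i g p D"
  unfolding has_cderiv_def
proof (rule has_pd_cong[OF assms(1)[unfolded has_cderiv_def] _ _ assms(4)])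
  show "axis_open (mdim M) (chart M c ` chart_dom M c)" using assms(2) by (simp add: chart_ok_def)
  show "chart M c p \<in> chart M c ` chart_dom M c" using assms(3) by simp
  show "f (param M c y) = g (param M c y)" if "y \<in> chart M c ` chart_dom M c" for y
    using assms(5) param_in_dom[OF that] .
qed

lemma has_cderiv_const: "has_cderiv M c i (\<lambda>p. k) p 0"
  by (simp add: has_cderiv_def has_pd_const)

lemma has_cderiv_add:
  "has_cderiv M c i f p D \<Longrightarrow> has_cderiv M c i g p E \<Longrightarrow> has_cderiv M c i (\<lambda>q. f q + g q) p (D + E)"
  unfolding has_cderiv_def by (rule has_pd_add)

lemma has_cderiv_mult:
  assumes "has_cderiv M c i f p D" "has_cderiv M c i g p E" "chart_ok M c" "p \<in> chart_dom M c"
  shows "has_cderiv M c i (\<lambda>q. f q * g q) p (f p * E + D * g p)"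
  using has_pd_mult[OF assms(1,2)[unfolded has_cderiv_def]] by (simp add: has_cderiv_def param_chart assms)

lemma has_cderiv_sum:
  "(\<And>k. k \<in> K \<Longrightarrow> has_cderiv M c i (f k) p (D k)) \<Longrightarrow> has_cderiv M c i (\<lambda>q. \<Sum>k\<in>K. f k q) p (\<Sum>k\<in>K. D k)"
  unfolding has_cderiv_def by (rule has_pd_sum)

lemma has_cderiv_chain:
  assumes "has_cderiv M c i f p D" "(h has_vector_derivative h') (at (f p))" "chart_ok M c" "p \<in> chart_dom M c"
  shows "has_cderiv M c i (\<lambda>q. h (f q)) p (D * h')"
  using has_pd_chain[OF assms(1)[unfolded has_cderiv_def], of h h'] assms(2)
  by (simp add: has_cderiv_def param_chart assms(3,4))

lemma has_cderiv_coordinate: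
  assumes "chart_ok M c" "p \<in> chart_dom M c" "i < mdim M"
  shows "has_cderiv M c i (\<lambda>q. chart M c q j) p (if i = j then 1 else 0)"
  unfolding has_cderiv_def
  by (rule has_pd_cong[OF has_pd_coordinate _ _ assms(3)]) (use assms in \<open>auto simp: chart_ok_def chart_param\<close>)

lemma smooth_in_chart_has_cderiv:
  assumes "smooth_in_chart M c f" "p \<in> chart_dom M c" "i < mdim M"
  shows "has_cderiv M c i f p (cderiv M c i f p)"
proof -
  \<comment> \<open>Smoothness speaks of iterated derivatives along an index list. The empty list
    gives differentiability of the function itself, a list \<open>[j]\<close> that of its
    derivative.\<close>
  have "set [] \<subseteq> {..<mdim M} \<Longrightarrow>
    (\<lambda>s. foldr pd [] (\<lambda>x. f (param M c x)) ((chart M c p)(i := s))) differentiable (at (chart M c p i))"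
    using assms unfolding smooth_in_chart_def smooth_fun_def by blast
  then show ?thesis
    unfolding has_cderiv_def cderiv_def by (intro has_pd_pd) simp
qed

lemma smooth_in_chart_has_cderiv2:
  assumes "smooth_in_chart M c f" "p \<in> chart_dom M c" "i < mdim M" "j < mdim M" "chart_ok M c"
  shows "has_cderiv M c i (cderiv M c j f) p (cderiv M c i (cderiv M c j f) p)"
proof -
  let ?F = "\<lambda>x. f (param M c x)" and ?y = "chart M c p"
  have "set [j] \<subseteq> {..<mdim M} \<Longrightarrow>
    (\<lambda>s. foldr pd [j] ?F (?y(i := s))) differentiable (at (?y i))"
    using assms unfolding smooth_in_chart_def smooth_fun_def by blast
  then have "has_pd i (pd j ?F) ?y (pd i (pd j ?F) ?y)"
    using assms(4) by (intro has_pd_pd) simp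
  \<comment> \<open>Read through \<open>param\<close>, the function \<open>cderiv M c j f\<close> is
    \<open>pd j ?F\<close> only on the chart image, where \<open>chart\<close> undoes
    \<open>param\<close>.\<close>
  then have "has_pd i (\<lambda>x. cderiv M c j f (param M c x)) ?y (pd i (pd j ?F) ?y)"
    by (rule has_pd_cong[OF _ _ _ assms(3)]) (use assms in \<open>auto simp: chart_ok_def cderiv_def chart_param\<close>)
  then show ?thesis
    using has_cderiv_def has_cderiv_imp_cderiv by metis
qed

text \<open>In coordinates the map \<open>h\<close> is \<open>L\<close>, which turns a variation of the i-th coordinate into one of the
  \<open>i'\<close>-th coordinate, or has no effect on it.\<close>

lemma has_cderiv_pullback:
  assumes M: "chart_ok M c" "p \<in> chart_dom M c" "i < mdim M" and N: "chart_ok N d"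
    and h: "\<And>q. q \<in> chart_dom M c \<Longrightarrow> h q \<in> chart_dom N d"
    and L: "\<And>q. q \<in> chart_dom M c \<Longrightarrow> chart N d (h q) = L (chart M c q)"
    and upd: "\<And>s. L ((chart M c p)(i := s)) = (L (chart M c p))(i' := s)" and i': "L (chart M c p) i' = chart M c p i"
    and f: "has_cderiv N d i' f (h p) D"
  shows "has_cderiv M c i (\<lambda>q. f (h q)) p D"
proof -
  have "has_pd i (\<lambda>y. f (param N d (L y))) (chart M c p) D"
    using f M(2) i' by (simp add: has_cderiv_def has_pd_def L upd)
  then show ?thesis
    unfolding has_cderiv_def
    by (rule has_pd_cong[OF _ _ _ M(3)])
      (use M N h L in \<open>auto simp: chart_ok_def param_chart[OF N] param_chart[OF M(1)] simp flip: L\<close>)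
qed

lemma has_cderiv_pullback_0:
  assumes M: "chart_ok M c" "p \<in> chart_dom M c" "i < mdim M" and N: "chart_ok N d"
    and h: "\<And>q. q \<in> chart_dom M c \<Longrightarrow> h q \<in> chart_dom N d"
    and L: "\<And>q. q \<in> chart_dom M c \<Longrightarrow> chart N d (h q) = L (chart M c q)"
    and upd: "\<And>s. L ((chart M c p)(i := s)) = L (chart M c p)"
  shows "has_cderiv M c i (\<lambda>q. f (h q)) p 0"
proof -
  have "has_pd i (\<lambda>y. f (param N d (L y))) (chart M c p) 0"
    by (simp add: has_pd_def upd)
  then show ?thesis
    unfolding has_cderiv_def
    by (rule has_pd_cong[OF _ _ _ M(3)])
      (use M N h L in \<open>auto simp: chart_ok_def param_chart[OF N] param_chart[OF M(1)] simp flip: L\<close>)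
qed

section \<open>Charts of products, of Euclidean space and of the circle\<close>

lemma product_mfd_simps [simp]:
  "mdim (product_mfd M N) = mdim M + mdim N"
  "charts (product_mfd M N) = charts M \<times> charts N"
  "pts (product_mfd M N) = pts M \<times> pts N"
  "chart_dom (product_mfd M N) (c, d) = chart_dom M c \<times> chart_dom N d"
  "chart (product_mfd M N) (c, d) (p, q) = (\<lambda>i. if i < mdim M then chart M c p i else chart N d q (i - mdim M))"
  by (simp_all add: product_mfd_def)

lemma chart_ok_product:
  assumes M: "chart_ok M c" and N: "chart_ok N d"
  shows "chart_ok (product_mfd M N) (c, d)"
  unfolding chart_ok_def
proof (intro conjI ballI allI impI)
  let ?P = "product_mfd M N" and ?m = "mdim M"
  show "inj_on (chart ?P (c, d)) (chart_dom ?P (c, d))"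
  proof (rule inj_onI)
    fix a b assume a: "a \<in> chart_dom ?P (c, d)" and b: "b \<in> chart_dom ?P (c, d)"
      and e: "chart ?P (c, d) a = chart ?P (c, d) b"
    obtain p q p' q' where ab: "a = (p, q)" "b = (p', q')" by (metis surj_pair)
    \<comment> \<open>From index \<open>?m\<close> on the product chart shows the second factor;
      there both first-factor coordinates are 0.\<close>
    have "chart M c p i = chart M c p' i" for i
      using fun_cong[OF e, of i] M a b by (cases "i < ?m") (auto simp: ab chart_ok_def)
    then have "chart M c p = chart M c p'" by (rule ext)
    moreover have "inj_on (chart M c) (chart_dom M c)" using M by (simp add: chart_ok_def)
    ultimately have "p = p'" using a b by (simp add: ab inj_on_eq_iff)
    have "chart N d q i = chart N d q' i" for i
      using fun_cong[OF e, of "i + ?m"] by (auto simp: ab)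
    then have "chart N d q = chart N d q'" by (rule ext)
    moreover have "inj_on (chart N d) (chart_dom N d)" using N by (simp add: chart_ok_def)
    ultimately have "q = q'" using a b by (simp add: ab inj_on_eq_iff)
    then show "a = b" by (simp add: ab \<open>p = p'\<close>)
  qed
  show "chart ?P (c, d) a i = 0" if "a \<in> chart_dom ?P (c, d)" "mdim ?P \<le> i" for a i
    using that M N by (cases a) (auto simp: chart_ok_def)
  show "axis_open (mdim ?P) (chart ?P (c, d) ` chart_dom ?P (c, d))"
    unfolding axis_open_def
  proof (intro ballI allI impI)
    fix y i assume "y \<in> chart ?P (c, d) ` chart_dom ?P (c, d)" and i: "i < mdim ?P"
    then obtain p q where pq: "p \<in> chart_dom M c" "q \<in> chart_dom N d" and y: "y = chart ?P (c, d) (p, q)" by auto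
    show "\<forall>\<^sub>F s in nhds (y i). y(i := s) \<in> chart ?P (c, d) ` chart_dom ?P (c, d)"
    proof (cases "i < ?m")
      case True
      have "\<forall>\<^sub>F s in nhds (chart M c p i). (chart M c p)(i := s) \<in> chart M c ` chart_dom M c"
        by (rule axis_openD) (use M pq True in \<open>auto simp: chart_ok_def\<close>)
      moreover have "y(i := s) \<in> chart ?P (c, d) ` chart_dom ?P (c, d)"
        if h: "(chart M c p)(i := s) \<in> chart M c ` chart_dom M c" for s
      proof -
        obtain p' where p': "p' \<in> chart_dom M c" "chart M c p' = (chart M c p)(i := s)"
          using h by (auto elim!: imageE)
        then have "y(i := s) = chart ?P (c, d) (p', q)" using True by (auto simp: y fun_eq_iff)
        then show ?thesis by (rule image_eqI) (use p'(1) pq(2) in simp)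
      qed
      ultimately show ?thesis using True by (simp add: y eventually_mono)
    next
      case False
      have "\<forall>\<^sub>F s in nhds (chart N d q (i - ?m)). (chart N d q)(i - ?m := s) \<in> chart N d ` chart_dom N d"
        by (rule axis_openD) (use N pq i False in \<open>auto simp: chart_ok_def\<close>)
      moreover have "y(i := s) \<in> chart ?P (c, d) ` chart_dom ?P (c, d)"
        if h: "(chart N d q)(i - ?m := s) \<in> chart N d ` chart_dom N d" for s
      proof -
        obtain q' where q': "q' \<in> chart_dom N d" "chart N d q' = (chart N d q)(i - ?m := s)"
          using h by (auto elim!: imageE)
        then have "y(i := s) = chart ?P (c, d) (p, q')" using False by (auto simp: y fun_eq_iff)
        then show ?thesis by (rule image_eqI) (use q'(1) pq(1) in simp)
      qed
      ultimately show ?thesis using False by (simp add: y eventually_mono)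
    qed
  qed
qed

text \<open>The premise on \<open>f\<close> is conditional: in a direction of the second factor the
  derivative is 0 whether or not \<open>f\<close> is differentiable.\<close>

lemma has_cderiv_product_fst:
  assumes ok: "chart_ok M c" "chart_ok N d" and pq: "p \<in> chart_dom M c" "q \<in> chart_dom N d"
    and i: "i < mdim M + mdim N" and f: "i < mdim M \<Longrightarrow> has_cderiv M c i f p D"
  shows "has_cderiv (product_mfd M N) (c, d) i (\<lambda>z. f (fst z)) (p, q) (if i < mdim M then D else 0)"
proof -
  \<comment> \<open>\<open>?L\<close> recovers the coordinates of the first factor. It must cut off
    at \<open>mdim M\<close>, where the product chart goes on with the second factor.\<close>
  let ?L = "\<lambda>y k. if k < mdim M then y k else 0 :: real"
  have L: "chart M c (fst z) = ?L (chart (product_mfd M N) (c, d) z)" if "z \<in> chart_dom (product_mfd M N) (c, d)" for z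
    using ok(1) that by (auto simp: fun_eq_iff chart_ok_def split: prod.splits)
  show ?thesis
  proof (cases "i < mdim M")
    case True
    have "has_cderiv (product_mfd M N) (c, d) i (\<lambda>z. f (fst z)) (p, q) D"
      by (rule has_cderiv_pullback[where i' = i and L = ?L and h = fst, OF chart_ok_product[OF ok] _ _ ok(1) _ L])
        (use True pq f i in \<open>auto simp: fun_eq_iff\<close>)
    then show ?thesis using True by simp
  next
    case False
    have "has_cderiv (product_mfd M N) (c, d) i (\<lambda>z. f (fst z)) (p, q) 0"
      by (rule has_cderiv_pullback_0[where L = ?L and h = fst, OF chart_ok_product[OF ok] _ _ ok(1) _ L])
        (use False pq i in \<open>auto simp: fun_eq_iff\<close>)
    then show ?thesis using False by simp
  qed
qed

lemma has_cderiv_product_snd: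
  assumes ok: "chart_ok M c" "chart_ok N d" and pq: "p \<in> chart_dom M c" "q \<in> chart_dom N d"
    and i: "i < mdim M + mdim N" and f: "mdim M \<le> i \<Longrightarrow> has_cderiv N d (i - mdim M) f q D"
  shows "has_cderiv (product_mfd M N) (c, d) i (\<lambda>z. f (snd z)) (p, q) (if i < mdim M then 0 else D)"
proof -
  let ?L = "\<lambda>(y :: nat \<Rightarrow> real) k. y (k + mdim M)"
  have L: "chart N d (snd z) = ?L (chart (product_mfd M N) (c, d) z)" if "z \<in> chart_dom (product_mfd M N) (c, d)" for z
    using that by (auto simp: fun_eq_iff chart_ok_def split: prod.splits)
  show ?thesis
  proof (cases "i < mdim M")
    case False
    have "has_cderiv (product_mfd M N) (c, d) i (\<lambda>z. f (snd z)) (p, q) D"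
      by (rule has_cderiv_pullback[where i' = "i - mdim M" and L = ?L and h = snd, OF chart_ok_product[OF ok] _ _ ok(2) _ L])
        (use False pq f i in \<open>auto simp: fun_eq_iff\<close>)
    then show ?thesis using False by simp
  next
    case True
    have "has_cderiv (product_mfd M N) (c, d) i (\<lambda>z. f (snd z)) (p, q) 0"
      by (rule has_cderiv_pullback_0[where L = ?L and h = snd, OF chart_ok_product[OF ok] _ _ ok(2) _ L])
        (use True pq i in \<open>auto simp: fun_eq_iff\<close>)
    then show ?thesis using True by simp
  qed
qed

lemma euclid_mfd_simps [simp]:
  "mdim (euclid_mfd n U) = n" "charts (euclid_mfd n U) = {()}" "pts (euclid_mfd n U) = U"
  "chart_dom (euclid_mfd n U) c = U" "chart (euclid_mfd n U) c x = x"
  by (simp_all add: euclid_mfd_def)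

lemma param_euclid [simp]: "x \<in> U \<Longrightarrow> param (euclid_mfd n U) c x = x"
  using inv_into_f_f[of "\<lambda>x. x" U x] by (simp add: param_def euclid_mfd_def)

lemma chart_ok_euclid:
  assumes "axis_open n U" "U \<subseteq> topspace (Euclidean_space n)"
  shows "chart_ok (euclid_mfd n U) c"
  using assms by (auto simp: chart_ok_def inj_on_def topspace_Euclidean_space)

lemma has_cderiv_euclid:
  assumes "axis_open n U" "x \<in> U" "i < n" "has_pd i f x D"
  shows "has_cderiv (euclid_mfd n U) c i f x D"
  unfolding has_cderiv_def
  by (rule has_pd_cong[OF _ assms(1) _ assms(3)]) (use assms in auto)

lemma circle_pt_eq: "circle_pt \<delta> u = {u + 2 * pi * \<delta> * of_int k | k. True}"
  by (auto simp: circle_pt_def circle_rel_def)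

lemma circle_mfd_simps [simp]:
  "mdim (circle_mfd \<delta>) = 1" "charts (circle_mfd \<delta>) = UNIV"
  "chart_dom (circle_mfd \<delta>) r = circle_pt \<delta> ` {r <..< r + 2 * pi * \<delta>}"
  by (simp_all add: circle_mfd_def)

lemma pts_circle: "pts (circle_mfd \<delta>) = range (circle_pt \<delta>)"
  by (auto simp: circle_mfd_def quotient_def circle_pt_def)

lemma chart_circle:
  assumes "\<delta> > 0" "r < u" "u < r + 2 * pi * \<delta>"
  shows "chart (circle_mfd \<delta>) r (circle_pt \<delta> u) = (\<lambda>i. if i = 0 then u else 0)"
proof -
  have "(THE v. v \<in> circle_pt \<delta> u \<and> r < v \<and> v < r + 2 * pi * \<delta>) = u"
  proof (rule the_equality)
    show "u \<in> circle_pt \<delta> u \<and> r < u \<and> u < r + 2 * pi * \<delta>"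
      using assms by (auto simp: circle_pt_eq intro: exI[of _ 0])
    fix v assume v: "v \<in> circle_pt \<delta> u \<and> r < v \<and> v < r + 2 * pi * \<delta>"
    then obtain k :: int where k: "v = u + 2 * pi * \<delta> * of_int k" by (auto simp: circle_pt_eq)
    \<comment> \<open>Both points lie in an open interval of length
      \<open>2 * pi * \<delta>\<close>, so they differ by less than one period and the integer
      \<open>k\<close> is 0.\<close>
    have P: "0 < 2 * pi * \<delta>" using assms(1) by simp
    have "2 * pi * \<delta> * of_int k < 2 * pi * \<delta> * 1" "2 * pi * \<delta> * (-1) < 2 * pi * \<delta> * of_int k"
      unfolding mult_1_right mult_minus_right using v assms k by linarith+
    then have "of_int k < (1::real)" "(-1::real) < of_int k"
      unfolding mult_less_cancel_left_pos[OF P] .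
    then have "k = 0" by linarith
    then show "v = u" using k by simp
  qed
  then show ?thesis by (simp add: circle_mfd_def fun_eq_iff)
qed

lemma chart_ok_circle:
  assumes "\<delta> > 0"
  shows "chart_ok (circle_mfd \<delta>) r"
  unfolding chart_ok_def
proof (intro conjI ballI allI impI)
  show "inj_on (chart (circle_mfd \<delta>) r) (chart_dom (circle_mfd \<delta>) r)"
    using assms by (auto simp: inj_on_def chart_circle fun_eq_iff)
  show "chart (circle_mfd \<delta>) r p i = 0" if "p \<in> chart_dom (circle_mfd \<delta>) r" "mdim (circle_mfd \<delta>) \<le> i" for p i
    using that assms by (auto simp: chart_circle)
  show "axis_open (mdim (circle_mfd \<delta>)) (chart (circle_mfd \<delta>) r ` chart_dom (circle_mfd \<delta>) r)"
    unfolding axis_open_def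
  proof (intro ballI allI impI)
    fix x i assume "x \<in> chart (circle_mfd \<delta>) r ` chart_dom (circle_mfd \<delta>) r" and i: "i < mdim (circle_mfd \<delta>)"
    then obtain u where u: "r < u" "u < r + 2 * pi * \<delta>" and x: "x = (\<lambda>i. if i = 0 then u else 0)"
      using assms by (auto simp: chart_circle)
    have "\<forall>\<^sub>F s in nhds u. s \<in> {r<..<r + 2 * pi * \<delta>}"
      by (rule eventually_nhds_in_open) (use u in auto)
    moreover have "x(0 := s) \<in> chart (circle_mfd \<delta>) r ` chart_dom (circle_mfd \<delta>) r"
      if "s \<in> {r<..<r + 2 * pi * \<delta>}" for s
    proof -
      have "x(0 := s) = chart (circle_mfd \<delta>) r (circle_pt \<delta> s)"
        using that assms by (auto simp: chart_circle x)
      then show ?thesis using that by auto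
    qed
    ultimately show "\<forall>\<^sub>F s in nhds (x i). x(i := s) \<in> chart (circle_mfd \<delta>) r ` chart_dom (circle_mfd \<delta>) r"
      using i by (simp add: x eventually_mono)
  qed
qed

lemma chart_ok_smooth_manifold:
  assumes "smooth_manifold M" "c \<in> charts M"
  shows "chart_ok M c"
proof -
  \<comment> \<open>The transition condition for the chart paired with itself.\<close>
  have op: "openin (Euclidean_space (mdim M)) (chart M c ` chart_dom M c)"
    using assms unfolding smooth_manifold_def by (metis Int_absorb)
  have "chart M c ` chart_dom M c \<subseteq> topspace (Euclidean_space (mdim M))"
    by (rule openin_subset[OF op])
  then have "\<forall>p\<in>chart_dom M c. \<forall>i\<ge>mdim M. chart M c p i = 0"
    by (auto simp: topspace_Euclidean_space)
  moreover have "inj_on (chart M c) (chart_dom M c)"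
    using assms by (simp add: smooth_manifold_def)
  ultimately show ?thesis
    using openin_Euclidean_imp_axis_open[OF op] by (simp add: chart_ok_def)
qed

lemma circle_pt_shift: "circle_pt \<delta> (u + 2 * pi * \<delta> * of_int k) = circle_pt \<delta> u"
proof -
  have "\<exists>l. u + 2 * pi * \<delta> * of_int k + 2 * pi * \<delta> * of_int j = u + 2 * pi * \<delta> * of_int l"
    "\<exists>l. u + 2 * pi * \<delta> * of_int j = u + 2 * pi * \<delta> * of_int k + 2 * pi * \<delta> * of_int l" for j
    by (rule exI[of _ "k + j"], simp add: algebra_simps) (rule exI[of _ "j - k"], simp add: algebra_simps)
  then show ?thesis unfolding circle_pt_eq by auto
qed

lemma chart_at_in:
  assumes "\<exists>c\<in>charts M. p \<in> chart_dom M c"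
  shows "chart_at M p \<in> charts M" "p \<in> chart_dom M (chart_at M p)"
  using someI_ex[of "\<lambda>c. c \<in> charts M \<and> p \<in> chart_dom M c"] assms by (auto simp: chart_at_def)

section \<open>Null perturbations of a metric\<close>

lemma sum_delta_mult:
  fixes j n :: nat
  shows "j < n \<Longrightarrow> (\<Sum>k<n. f k * (if k = j then 1 else 0 :: real)) = f j"
  "j < n \<Longrightarrow> (\<Sum>k<n. (if k = j then 1 else 0 :: real) * f k) = f j"
  "j < n \<Longrightarrow> (\<Sum>k<n. f k * (if j = k then 1 else 0 :: real)) = f j"
  "j < n \<Longrightarrow> (\<Sum>k<n. (if j = k then 1 else 0 :: real) * f k) = f j"
  by (simp_all add: mult_delta_left mult_delta_right)

text \<open>For square matrices a right inverse is two-sided, and a two-sided inverse is unique; so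
  one product settles the description in \<open>ginv\<close>.\<close>

lemma ginv_eqI:
  assumes B: "\<And>i j. i < mdim M \<Longrightarrow> j < mdim M \<Longrightarrow> (\<Sum>k<mdim M. g c p i k * B k j) = (if i = j then 1 else 0)"
    and ij: "i < mdim M" "j < mdim M"
  shows "ginv M g c p i j = B i j"
proof -
  let ?n = "mdim M" and ?A = "gmat M g c p"
  let ?B = "mat ?n ?n (\<lambda>(i, j). B i j)"
  have A: "?A \<in> carrier_mat ?n ?n" by (simp add: gmat_def)
  have Bc: "?B \<in> carrier_mat ?n ?n" by simp
  have AB: "?A * ?B = 1\<^sub>m ?n"
  proof (rule eq_matI)
    fix i j assume "i < dim_row (1\<^sub>m ?n :: real mat)" "j < dim_col (1\<^sub>m ?n :: real mat)"
    then have ij: "i < ?n" "j < ?n" by simp_all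
    have "(?A * ?B) $$ (i, j) = (\<Sum>k\<in>{0..<?n}. g c p i k * B k j)"
      using ij by (simp add: gmat_def scalar_prod_def)
    then show "(?A * ?B) $$ (i, j) = 1\<^sub>m ?n $$ (i, j)"
      using B[OF ij] ij by (simp add: atLeast0LessThan)
  qed (simp_all add: gmat_def)
  have BA: "?B * ?A = 1\<^sub>m ?n" by (rule mat_mult_left_right_inverse[OF A Bc AB])
  have "(THE X. X \<in> carrier_mat ?n ?n \<and> inverts_mat ?A X \<and> inverts_mat X ?A) = ?B"
  proof (rule the_equality)
    show "?B \<in> carrier_mat ?n ?n \<and> inverts_mat ?A ?B \<and> inverts_mat ?B ?A"
      using A Bc AB BA by (simp add: inverts_mat_def gmat_def)
    fix X assume X: "X \<in> carrier_mat ?n ?n \<and> inverts_mat ?A X \<and> inverts_mat X ?A"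
    then have Xc: "X \<in> carrier_mat ?n ?n" and XA: "X * ?A = 1\<^sub>m ?n" by (auto simp: inverts_mat_def)
    have "X = X * (?A * ?B)" using Xc by (simp add: AB)
    also have "\<dots> = X * ?A * ?B" by (rule assoc_mult_mat[OF Xc A Bc, symmetric])
    also have "\<dots> = ?B" unfolding XA using Bc by (rule left_mult_one_mat)
    finally show "X = ?B" .
  qed
  then show ?thesis using ij by (simp add: ginv_def)
qed

text \<open>A trivial kernel makes the determinant nonzero. This criterion suits an indefinite
  metric whose blocks are treated separately.\<close>

lemma nondegenerate_inverse_exists:
  fixes g :: "nat \<Rightarrow> nat \<Rightarrow> real"
  assumes nd: "\<And>v. (\<And>i. i < n \<Longrightarrow> (\<Sum>j<n. g i j * v j) = 0) \<Longrightarrow> (\<And>i. i < n \<Longrightarrow> v i = 0)"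
    and sym: "\<And>i j. i < n \<Longrightarrow> j < n \<Longrightarrow> g i j = g j i"
  obtains H where "\<And>i j. i < n \<Longrightarrow> j < n \<Longrightarrow> (\<Sum>k<n. g i k * H k j) = (if i = j then 1 else 0)"
    and "\<And>i j. i < n \<Longrightarrow> j < n \<Longrightarrow> H i j = H j i"
proof -
  let ?A = "mat n n (\<lambda>(i, j). g i j)"
  have A: "?A \<in> carrier_mat n n" by simp
  have "Determinant.det ?A \<noteq> 0"
  proof
    assume "Determinant.det ?A = 0"
    then obtain v where v: "v \<in> carrier_vec n" "v \<noteq> 0\<^sub>v n" "?A *\<^sub>v v = 0\<^sub>v n"
      using det_0_iff_vec_prod_zero[OF A] by auto
    have "(\<Sum>j<n. g i j * v $ j) = 0" if "i < n" for i
      using arg_cong[OF v(3), of "\<lambda>w. w $ i"] that v(1) by (simp add: scalar_prod_def atLeast0LessThan)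
    from nd[of "\<lambda>j. v $ j", OF this] have "v = 0\<^sub>v n" using v(1) by (intro eq_vecI) auto
    then show False using v(2) by simp
  qed
  then obtain B where B: "B \<in> carrier_mat n n" "?A * B = 1\<^sub>m n" "B * ?A = 1\<^sub>m n"
    using det_non_zero_imp_unit[OF A] unfolding Units_def ring_mat_def by auto
  define H where "H i j = B $$ (i, j)" for i j
  have AB: "(\<Sum>k<n. g i k * H k j) = (if i = j then 1 else 0)" if "i < n" "j < n" for i j
    using arg_cong[OF B(2), of "\<lambda>X. X $$ (i, j)"] that B(1)
    by (simp add: scalar_prod_def atLeast0LessThan H_def)
  have BA: "(\<Sum>k<n. H i k * g k j) = (if i = j then 1 else 0)" if "i < n" "j < n" for i j
    using arg_cong[OF B(3), of "\<lambda>X. X $$ (i, j)"] that B(1)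
    by (simp add: scalar_prod_def atLeast0LessThan H_def)
  have "H i j = H j i" if ij: "i < n" "j < n" for i j
  proof -
    have "H i j = (\<Sum>k<n. H i k * (\<Sum>l<n. g k l * H l j))"
      using ij by (simp add: AB sum_delta_mult)
    \<comment> \<open>The product of \<open>H\<close>, \<open>g\<close> and the transpose of
      \<open>H\<close> is evaluated in two ways, using that \<open>H\<close> is a left inverse and
      \<open>g\<close> is symmetric.\<close>
    have "H j i = (\<Sum>k<n. (if i = k then 1 else 0) * H j k)" using ij by (simp add: sum_delta_mult)
    also have "\<dots> = (\<Sum>k<n. (\<Sum>l<n. H i l * g l k) * H j k)" using ij by (simp add: BA)
    also have "\<dots> = (\<Sum>l<n. H i l * (\<Sum>k<n. H j k * g k l))"
      unfolding sum_distrib_left sum_distrib_right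
      by (subst sum.swap) (intro sum.cong refl, simp add: sym)
    also have "\<dots> = H i j" using ij by (simp add: BA sum_delta_mult)
    finally show ?thesis by simp
  qed
  with AB show ?thesis by (rule that)
qed

text \<open>A null vector \<open>X\<close> orthogonal to \<open>Y\<close>: the metric \<open>g\<close> is perturbed by \<open>x \<otimes> y + y \<otimes> x\<close>, where \<open>x\<close>, \<open>y\<close> are
  \<open>X\<close>, \<open>Y\<close> with lowered indices, and \<open>P\<close> is the inverse of the perturbed metric.\<close>

locale null_perturbation =
  fixes n :: nat and g H :: "nat \<Rightarrow> nat \<Rightarrow> real" and X Y x y :: "nat \<Rightarrow> real" and s :: real and P :: "nat \<Rightarrow> nat \<Rightarrow> real"
  assumes g_sym: "i < n \<Longrightarrow> j < n \<Longrightarrow> g i j = g j i"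
    and H_sym: "i < n \<Longrightarrow> j < n \<Longrightarrow> H i j = H j i"
    and gH: "i < n \<Longrightarrow> j < n \<Longrightarrow> (\<Sum>k<n. g i k * H k j) = (if i = j then 1 else 0)"
    and x: "i < n \<Longrightarrow> x i = (\<Sum>k<n. g i k * X k)"
    and y: "i < n \<Longrightarrow> y i = (\<Sum>k<n. g i k * Y k)"
    and xX: "(\<Sum>k<n. x k * X k) = 0" and xY: "(\<Sum>k<n. x k * Y k) = 0"
    and s: "s = (\<Sum>k<n. y k * Y k)"
    and P: "P = (\<lambda>i j. H i j - Y i * X j - X i * Y j + s * X i * X j)"
begin

lemma raise:
  assumes z: "\<And>i. i < n \<Longrightarrow> z i = (\<Sum>k<n. g i k * Z k)" and j: "j < n"
  shows "(\<Sum>k<n. z k * H k j) = Z j"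
proof -
  have "(\<Sum>k<n. z k * H k j) = (\<Sum>k<n. \<Sum>l<n. Z l * (g l k * H k j))"
    by (intro sum.cong refl) (simp add: z sum_distrib_left sum_distrib_right g_sym mult_ac)
  also have "\<dots> = (\<Sum>l<n. Z l * (\<Sum>k<n. g l k * H k j))"
    by (subst sum.swap) (simp add: sum_distrib_left)
  also have "\<dots> = Z j" using j by (simp add: gH sum_delta_mult)
  finally show ?thesis .
qed

lemmas xH = raise[OF x] and yH = raise[OF y]

lemma yX: "(\<Sum>k<n. y k * X k) = 0"
proof -
  have "(\<Sum>k<n. y k * X k) = (\<Sum>k<n. \<Sum>l<n. g k l * Y l * X k)"
    by (simp add: y sum_distrib_right)
  also have "\<dots> = (\<Sum>l<n. \<Sum>k<n. g l k * X k * Y l)"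
    by (subst sum.swap) (intro sum.cong refl, simp add: g_sym)
  also have "\<dots> = 0" using xY by (simp add: x sum_distrib_right)
  finally show ?thesis .
qed

lemma P_sym: "i < n \<Longrightarrow> j < n \<Longrightarrow> P i j = P j i"
  by (simp add: P H_sym)

text \<open>\<open>P\<close> is a Neumann series that stops. Let N send a vector V to
  \<open>x(V) Y + y(V) X\<close>; this is the perturbation with an index raised. Then N kills
  \<open>X\<close> and maps \<open>Y\<close> to \<open>s X\<close>, so its cube is 0 and 1 - N + N^2
  inverts 1 + N. Applied to \<open>H\<close> it gives \<open>P\<close>.\<close>

lemma P_inverse:
  assumes ij: "i < n" "j < n"
  shows "(\<Sum>k<n. (g i k + y i * x k + x i * y k) * P k j) = (if i = j then 1 else 0)"
proof -
  have "(\<Sum>k<n. (g i k + y i * x k + x i * y k) * P k j) =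
      (\<Sum>k<n. g i k * H k j) - X j * (\<Sum>k<n. g i k * Y k) + (s * X j - Y j) * (\<Sum>k<n. g i k * X k)
      + y i * ((\<Sum>k<n. x k * H k j) - X j * (\<Sum>k<n. x k * Y k) + (s * X j - Y j) * (\<Sum>k<n. x k * X k))
      + x i * ((\<Sum>k<n. y k * H k j) - X j * (\<Sum>k<n. y k * Y k) + (s * X j - Y j) * (\<Sum>k<n. y k * X k))"
    unfolding P by (simp add: sum_distrib_left sum.distrib sum_subtractf algebra_simps)
  then show ?thesis
    using ij by (simp add: gH xH yH xX xY yX flip: x y s) (simp add: algebra_simps)
qed

text \<open>All correction terms contain \<open>x(X)\<close> or \<open>x(Y)\<close>, so raising the
  index of \<open>x\<close> with the perturbed metric still gives \<open>X\<close>. This brings the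
  hypothesis on \<open>T\<close> into play in the contraction below.\<close>

lemma P_x: "i < n \<Longrightarrow> (\<Sum>k<n. P i k * x k) = X i"
proof -
  assume i: "i < n"
  have "(\<Sum>k<n. P i k * x k) = (\<Sum>k<n. x k * H k i) + (s * X i - Y i) * (\<Sum>k<n. x k * X k) - X i * (\<Sum>k<n. x k * Y k)"
    using i unfolding P by (simp add: sum_distrib_left sum.distrib sum_subtractf algebra_simps H_sym)
  then show ?thesis using i by (simp add: xH xX xY)
qed

text \<open>Here \<open>dg\<close>, \<open>S\<close>, \<open>T\<close> stand for the coordinate derivatives of \<open>g\<close>, \<open>x\<close>, \<open>y\<close> and \<open>K\<close> for the Christoffel symbols of
  the first kind of \<open>g\<close>; the formula for \<open>S\<close> says that \<open>X\<close> is parallel.\<close>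

lemma christoffel_contraction:
  fixes dg K :: "nat \<Rightarrow> nat \<Rightarrow> nat \<Rightarrow> real" and S T :: "nat \<Rightarrow> nat \<Rightarrow> real" and f :: "nat \<Rightarrow> real"
  defines "D \<equiv> \<lambda>i j l. dg i j l + T i j * x l + y j * S i l + S i j * y l + x j * T i l"
  assumes K: "K = (\<lambda>l i j. (dg i j l + dg j i l - dg l i j) / 2)"
    and dg: "\<And>i j l. i < n \<Longrightarrow> j < n \<Longrightarrow> l < n \<Longrightarrow> dg i j l = dg i l j"
    and S: "\<And>i j. i < n \<Longrightarrow> j < n \<Longrightarrow> S i j = (\<Sum>l<n. X l * K l i j)"
    and T: "\<And>l. l < n \<Longrightarrow> (\<Sum>i<n. X i * (T i l - T l i)) = 0"
  shows "(\<Sum>i<n. \<Sum>j<n. P i j * (\<Sum>k<n. (1/2) * (\<Sum>l<n. P k l * (D i j l + D j i l - D l i j)) * f k)) =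
    (\<Sum>l<n. (\<Sum>k<n. H l k * f k) * (\<Sum>i<n. \<Sum>j<n. P i j * K l i j)) +
    (\<Sum>k<n. X k * f k) * (\<Sum>i<n. \<Sum>j<n. P i j * (T i j - (\<Sum>l<n. Y l * K l i j)))"
proof -
  define a where "a l = (\<Sum>k<n. P k l * f k)" for l
  define \<kappa> where "\<kappa> l = (\<Sum>i<n. \<Sum>j<n. P i j * K l i j)" for l
  define \<tau> where "\<tau> = (\<Sum>i<n. \<Sum>j<n. P i j * T i j)"
  define Xf where "Xf = (\<Sum>k<n. X k * f k)"
  define Yf where "Yf = (\<Sum>k<n. Y k * f k)"
  define h where "h l = (\<Sum>k<n. H l k * f k)" for l
  have Kc: "(\<Sum>i<n. \<Sum>j<n. P i j * (\<Sum>l<n. Z l * K l i j)) = (\<Sum>l<n. Z l * \<kappa> l)" for Z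
  proof -
    have "(\<Sum>i<n. \<Sum>j<n. P i j * (\<Sum>l<n. Z l * K l i j)) = (\<Sum>i<n. \<Sum>j<n. \<Sum>l<n. Z l * (P i j * K l i j))"
      by (simp add: sum_distrib_left mult_ac)
    also have "\<dots> = (\<Sum>i<n. \<Sum>l<n. \<Sum>j<n. Z l * (P i j * K l i j))"
      by (intro sum.cong refl sum.swap)
    also have "\<dots> = (\<Sum>l<n. \<Sum>i<n. \<Sum>j<n. Z l * (P i j * K l i j))"
      by (rule sum.swap)
    finally show ?thesis by (simp add: \<kappa>_def sum_distrib_left)
  qed
  \<comment> \<open>Symmetric because the Christoffel symbols are: the one-form dual to a parallel
    field is closed.\<close>
  have Ssym: "S i j = S j i" if "i < n" "j < n" for i j
  proof -
    have "X l * K l i j = X l * K l j i" if "l < n" for l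
      using \<open>i < n\<close> \<open>j < n\<close> that by (simp add: K dg[of l i j] add.commute)
    then have "(\<Sum>l<n. X l * K l i j) = (\<Sum>l<n. X l * K l j i)" by (intro sum.cong) auto
    then show ?thesis using that by (simp add: S)
  qed
  have \<sigma>: "(\<Sum>i<n. \<Sum>j<n. P i j * S i j) = (\<Sum>l<n. X l * \<kappa> l)"
    using Kc[of X] by (simp add: S)
  \<comment> \<open>\<open>P\<close> turns \<open>x j\<close> into \<open>X i\<close>, and the
    exterior derivative of the one-form \<open>y\<close> vanishes on contraction with
    \<open>X\<close>.\<close>
  have T1: "(\<Sum>i<n. \<Sum>j<n. P i j * (x j * (T i l - T l i))) = 0" if l: "l < n" for l
  proof -
    have "(\<Sum>i<n. \<Sum>j<n. P i j * (x j * (T i l - T l i))) = (\<Sum>i<n. (\<Sum>j<n. P i j * x j) * (T i l - T l i))"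
      by (simp only: sum_distrib_right mult.assoc)
    then show ?thesis using T[OF l] by (simp add: P_x)
  qed
  have T2: "(\<Sum>i<n. \<Sum>j<n. P i j * (x i * (T j l - T l j))) = 0" if l: "l < n" for l
    using T1[OF l] by (subst sum.swap) (simp add: P_sym)
  have T3: "(\<Sum>i<n. \<Sum>j<n. P i j * T j i) = \<tau>"
    unfolding \<tau>_def by (subst sum.swap) (simp add: P_sym)
  have E: "(\<Sum>i<n. \<Sum>j<n. P i j * (D i j l + D j i l - D l i j)) = 2 * (\<kappa> l + \<tau> * x l + (\<Sum>l<n. X l * \<kappa> l) * y l)"
    if l: "l < n" for l
  proof -
    \<comment> \<open>The terms with \<open>y j\<close> and \<open>y i\<close> come with the
      differences \<open>S i l - S l i\<close> and \<open>S j l - S l j\<close>, which are 0. Those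
      with \<open>x j\<close> and \<open>x i\<close> keep the antisymmetric part of
      \<open>T\<close>, which \<open>T1\<close> and \<open>T2\<close> remove after
      summation.\<close>
    have "P i j * (D i j l + D j i l - D l i j) = 2 * (P i j * K l i j) + (P i j * T i j) * x l + (P i j * T j i) * x l +
        2 * (P i j * S i j) * y l + P i j * (x j * (T i l - T l i)) + P i j * (x i * (T j l - T l j))"
      if "i < n" "j < n" for i j
      using that l by (simp add: D_def K Ssym[of i l] Ssym[of j l] Ssym[of j i] algebra_simps add_divide_distrib diff_divide_distrib)
    then have "(\<Sum>i<n. \<Sum>j<n. P i j * (D i j l + D j i l - D l i j)) =
      2 * \<kappa> l + \<tau> * x l + (\<Sum>i<n. \<Sum>j<n. P i j * T j i) * x l + 2 * (\<Sum>i<n. \<Sum>j<n. P i j * S i j) * y l +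
      (\<Sum>i<n. \<Sum>j<n. P i j * (x j * (T i l - T l i))) + (\<Sum>i<n. \<Sum>j<n. P i j * (x i * (T j l - T l j)))"
      by (simp add: \<kappa>_def \<tau>_def sum.distrib sum_distrib_left sum_distrib_right mult_ac)
    then show ?thesis by (simp add: T1 T2 T3 \<sigma> l)
  qed
  have "(\<Sum>i<n. \<Sum>j<n. P i j * (\<Sum>k<n. (1/2) * (\<Sum>l<n. P k l * (D i j l + D j i l - D l i j)) * f k)) =
      (\<Sum>i<n. \<Sum>j<n. \<Sum>k<n. \<Sum>l<n. (1/2) * (P k l * f k) * (P i j * (D i j l + D j i l - D l i j)))"
    by (simp add: sum_distrib_left sum_distrib_right mult_ac)
  also have "\<dots> = (\<Sum>i<n. \<Sum>j<n. \<Sum>l<n. (1/2) * a l * (P i j * (D i j l + D j i l - D l i j)))"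
  proof (rule sum.cong[OF refl], rule sum.cong[OF refl])
    fix i j
    show "(\<Sum>k<n. \<Sum>l<n. (1/2) * (P k l * f k) * (P i j * (D i j l + D j i l - D l i j))) =
        (\<Sum>l<n. (1/2) * a l * (P i j * (D i j l + D j i l - D l i j)))"
      unfolding a_def by (subst sum.swap) (simp add: sum_distrib_left sum_distrib_right)
  qed
  also have "\<dots> = (\<Sum>i<n. \<Sum>l<n. \<Sum>j<n. (1/2) * a l * (P i j * (D i j l + D j i l - D l i j)))"
    by (intro sum.cong refl sum.swap)
  also have "\<dots> = (\<Sum>l<n. \<Sum>i<n. \<Sum>j<n. (1/2) * a l * (P i j * (D i j l + D j i l - D l i j)))"
    by (rule sum.swap)
  also have "\<dots> = (\<Sum>l<n. (1/2) * a l * (\<Sum>i<n. \<Sum>j<n. P i j * (D i j l + D j i l - D l i j)))"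
    by (simp add: sum_distrib_left)
  also have "\<dots> = (\<Sum>l<n. a l * \<kappa> l) + \<tau> * (\<Sum>l<n. a l * x l) + (\<Sum>l<n. X l * \<kappa> l) * (\<Sum>l<n. a l * y l)"
  proof -
    have "(1/2) * a l * (\<Sum>i<n. \<Sum>j<n. P i j * (D i j l + D j i l - D l i j)) =
        a l * \<kappa> l + \<tau> * (a l * x l) + (\<Sum>l<n. X l * \<kappa> l) * (a l * y l)" if "l < n" for l
      unfolding E[OF that] by (simp add: algebra_simps)
    then show ?thesis by (simp add: sum.distrib sum_distrib_left)
  qed
  finally have 1: "(\<Sum>i<n. \<Sum>j<n. P i j * (\<Sum>k<n. (1/2) * (\<Sum>l<n. P k l * (D i j l + D j i l - D l i j)) * f k)) =
    (\<Sum>l<n. a l * \<kappa> l) + \<tau> * (\<Sum>l<n. a l * x l) + (\<Sum>l<n. X l * \<kappa> l) * (\<Sum>l<n. a l * y l)" .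
  \<comment> \<open>\<open>a\<close> and \<open>h\<close> are the covector \<open>f\<close> raised
    with \<open>P\<close> and with \<open>H\<close>.\<close>
  have a: "a l = h l - Y l * Xf - X l * Yf + s * X l * Xf" if "l < n" for l
    using that unfolding a_def h_def Xf_def Yf_def P
    by (simp add: sum.distrib sum_subtractf sum_distrib_left sum_distrib_right algebra_simps H_sym)
  have hz: "(\<Sum>l<n. h l * z l) = (\<Sum>k<n. Z k * f k)" if z: "\<And>i. i < n \<Longrightarrow> z i = (\<Sum>k<n. g i k * Z k)" for z Z
  proof -
    have "(\<Sum>l<n. h l * z l) = (\<Sum>l<n. \<Sum>k<n. H l k * f k * z l)"
      unfolding h_def sum_distrib_right by (simp add: mult_ac)
    also have "\<dots> = (\<Sum>k<n. (\<Sum>l<n. z l * H l k) * f k)"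
      unfolding sum_distrib_right by (subst sum.swap) (simp add: mult_ac)
    finally show ?thesis using raise[OF z] by simp
  qed
  have ax: "(\<Sum>l<n. a l * x l) = Xf"
  proof -
    have "(\<Sum>l<n. a l * x l) = (\<Sum>l<n. h l * x l) - Xf * (\<Sum>l<n. x l * Y l) + (s * Xf - Yf) * (\<Sum>l<n. x l * X l)"
      by (simp add: a sum.distrib sum_subtractf sum_distrib_left algebra_simps)
    then show ?thesis using hz[OF x] by (simp add: xX xY Xf_def)
  qed
  have ay: "(\<Sum>l<n. a l * y l) = Yf - s * Xf"
  proof -
    have "(\<Sum>l<n. a l * y l) = (\<Sum>l<n. h l * y l) - Xf * (\<Sum>l<n. y l * Y l) + (s * Xf - Yf) * (\<Sum>l<n. y l * X l)"
      by (simp add: a sum.distrib sum_subtractf sum_distrib_left algebra_simps)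
    then show ?thesis using hz[OF y] by (simp add: yX Yf_def flip: s)
  qed
  have ak: "(\<Sum>l<n. a l * \<kappa> l) = (\<Sum>l<n. h l * \<kappa> l) - Xf * (\<Sum>l<n. Y l * \<kappa> l) + (s * Xf - Yf) * (\<Sum>l<n. X l * \<kappa> l)"
    by (simp add: a sum.distrib sum_subtractf sum_distrib_left algebra_simps)
  have 2: "(\<Sum>i<n. \<Sum>j<n. P i j * (T i j - (\<Sum>l<n. Y l * K l i j))) = \<tau> - (\<Sum>l<n. Y l * \<kappa> l)"
    using Kc[of Y] by (simp add: right_diff_distrib sum_subtractf \<tau>_def)
  \<comment> \<open>The contraction of \<open>X\<close> with \<kappa> carries the factor
    \<open>s * Xf - Yf\<close> in \<open>ak\<close> and its negative through \<open>ay\<close>, so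
    it cancels. Besides the term with \<open>h\<close>, only a multiple of \<open>Xf\<close> is
    left.\<close>
  show ?thesis
    unfolding 1 2 ax ay ak h_def[symmetric] \<kappa>_def[symmetric] Xf_def[symmetric] by (simp add: algebra_simps)
qed

end

section \<open>The wave operator in a chart\<close>

definition first_kind :: "(nat \<Rightarrow> nat \<Rightarrow> nat \<Rightarrow> real) \<Rightarrow> nat \<Rightarrow> nat \<Rightarrow> nat \<Rightarrow> real" where
  "first_kind dg l i j = (dg i j l + dg j i l - dg l i j) / 2"

text \<open>The product rule for \<open>\<partial>\<^sub>i (g\<^sub>j\<^sub>k X\<^sup>k)\<close>.\<close>

definition dflat :: "nat \<Rightarrow> (nat \<Rightarrow> nat \<Rightarrow> real) \<Rightarrow> (nat \<Rightarrow> nat \<Rightarrow> nat \<Rightarrow> real) \<Rightarrow> (nat \<Rightarrow> real) \<Rightarrow> (nat \<Rightarrow> nat \<Rightarrow> real) \<Rightarrow>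
    nat \<Rightarrow> nat \<Rightarrow> real" where
  "dflat n g dg X dX i j = (\<Sum>k<n. g j k * dX i k + dg i j k * X k)"

text \<open>Everything is taken at the single point \<open>p\<close>. The wave operator contains
  first derivatives of the metric, but its inverse only undifferentiated, so \<open>H\<close> is an
  array given at \<open>p\<close> and not a field.\<close>

locale metric_chart =
  fixes M :: "('a, 'c) mfd" and g0 :: "('a, 'c) bilin_field" and c :: 'c and p :: 'a
    and dg :: "nat \<Rightarrow> nat \<Rightarrow> nat \<Rightarrow> real" and H :: "nat \<Rightarrow> nat \<Rightarrow> real"
  assumes ok: "chart_ok M c" and p: "p \<in> chart_dom M c" and c: "c \<in> charts M"
    and g0_sym: "q \<in> chart_dom M c \<Longrightarrow> i < mdim M \<Longrightarrow> j < mdim M \<Longrightarrow> g0 c q i j = g0 c q j i"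
    and dg: "i < mdim M \<Longrightarrow> j < mdim M \<Longrightarrow> l < mdim M \<Longrightarrow> has_cderiv M c i (\<lambda>q. g0 c q j l) p (dg i j l)"
    and inv: "i < mdim M \<Longrightarrow> j < mdim M \<Longrightarrow> (\<Sum>k<mdim M. g0 c p i k * H k j) = (if i = j then 1 else 0)"
    and inv_sym: "i < mdim M \<Longrightarrow> j < mdim M \<Longrightarrow> H i j = H j i"
begin

abbreviation n where "n \<equiv> mdim M"
abbreviation "K \<equiv> first_kind dg"

lemma dg_sym: "i < n \<Longrightarrow> j < n \<Longrightarrow> l < n \<Longrightarrow> dg i j l = dg i l j"
  using has_cderiv_cong[OF dg ok p, of i j l "\<lambda>q. g0 c q l j"] dg[of i l j] g0_sym has_cderiv_imp_cderiv by metis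

lemma has_cderiv_flat:
  assumes "\<And>k. k < n \<Longrightarrow> has_cderiv M c i (\<lambda>q. X c q k) p (dX i k)" "i < n" "j < n"
  shows "has_cderiv M c i (\<lambda>q. flat M g0 X c q j) p (dflat n (g0 c p) dg (X c p) dX i j)"
  unfolding flat_def dflat_def
  by (intro has_cderiv_sum has_cderiv_mult dg ok p) (use assms in auto)

text \<open>Parallelism replaces the derivative of \<open>X\<close> by a Christoffel term. The rest
  is the compatibility of metric and connection: \<open>dg i j m\<close> equals
  \<open>K j i m + K m i j\<close>.\<close>

lemma dflat_parallel:
  assumes X: "\<And>i k. i < n \<Longrightarrow> k < n \<Longrightarrow> has_cderiv M c i (\<lambda>q. X c q k) p (dX i k)"
    and par: "parallel M g0 X" and ij: "i < n" "j < n"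
  shows "dflat n (g0 c p) dg (X c p) dX i j = (\<Sum>m<n. X c p m * K m i j)"
proof -
  have chr: "christoffel M g0 c k i m p = (\<Sum>l<n. H k l * K l i m)" if "k < n" "m < n" for k m
    unfolding christoffel_def using that ij
    by (simp add: ginv_eqI[where B = H and M = M and g = g0 and c = c and p = p, OF inv] has_cderiv_imp_cderiv[OF dg] first_kind_def sum_distrib_left)
  have "dX i k = - (\<Sum>m<n. (\<Sum>l<n. H k l * K l i m) * X c p m)" if k: "k < n" for k
  proof -
    have "cderiv M c i (\<lambda>q. X c q k) p + (\<Sum>m<n. christoffel M g0 c k i m p * X c p m) = 0"
      using par c p ij k unfolding parallel_def by blast
    then show ?thesis
      using k by (simp add: chr has_cderiv_imp_cderiv[OF X[OF ij(1) k]] eq_neg_iff_add_eq_0)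
  qed
  then have "(\<Sum>k<n. g0 c p j k * dX i k) = - (\<Sum>k<n. \<Sum>m<n. \<Sum>l<n. g0 c p j k * H k l * (K l i m * X c p m))"
    by (simp add: sum_distrib_left sum_distrib_right sum_negf mult_ac)
  also have "(\<Sum>k<n. \<Sum>m<n. \<Sum>l<n. g0 c p j k * H k l * (K l i m * X c p m)) =
      (\<Sum>m<n. \<Sum>k<n. \<Sum>l<n. g0 c p j k * H k l * (K l i m * X c p m))"
    by (rule sum.swap)
  also have "\<dots> = (\<Sum>m<n. \<Sum>l<n. \<Sum>k<n. g0 c p j k * H k l * (K l i m * X c p m))"
    by (intro sum.cong refl sum.swap)
  also have "\<dots> = (\<Sum>m<n. \<Sum>l<n. (\<Sum>k<n. g0 c p j k * H k l) * (K l i m * X c p m))"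
    by (simp add: sum_distrib_right)
  also have "\<dots> = (\<Sum>m<n. K j i m * X c p m)"
    using ij by (simp add: inv sum_delta_mult)
  finally have 1: "(\<Sum>k<n. g0 c p j k * dX i k) = - (\<Sum>m<n. K j i m * X c p m)" .
  have "dg i j m * X c p m - K j i m * X c p m = X c p m * K m i j" if "m < n" for m
    using that ij by (simp add: first_kind_def dg_sym[of i m j] algebra_simps add_divide_distrib diff_divide_distrib)
  then show ?thesis
    by (simp add: dflat_def sum.distrib 1 flip: sum_subtractf)
qed

text \<open>In the last factor, \<open>T i j\<close> minus the Christoffel sum is the covariant
  derivative, for \<open>g0\<close>, of the one-form dual to \<open>Y\<close>; its trace is taken
  with \<open>P\<close>. The premise \<open>T_X\<close> says that the exterior derivative of this
  one-form is killed by \<open>X\<close>, and \<open>cp\<close> names the chart in which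
  \<open>box_op\<close> is evaluated.\<close>

lemma box_em_potential:
  assumes cp: "c = chart_at M p"
    and X: "\<And>i k. i < n \<Longrightarrow> k < n \<Longrightarrow> has_cderiv M c i (\<lambda>q. X c q k) p (dX i k)"
    and Y: "\<And>i k. i < n \<Longrightarrow> k < n \<Longrightarrow> has_cderiv M c i (\<lambda>q. Y c q k) p (dY i k)"
    and par: "parallel M g0 X"
    and XX: "ginner n (g0 c p) (X c p) (X c p) = 0" and XY: "ginner n (g0 c p) (X c p) (Y c p) = 0"
    and T: "T = dflat n (g0 c p) dg (Y c p) dY"
    and T_X: "\<And>l. l < n \<Longrightarrow> (\<Sum>i<n. X c p i * (T i l - T l i)) = 0"
    and P: "P = (\<lambda>i j. H i j - Y c p i * X c p j - X c p i * Y c p j + ginner n (g0 c p) (Y c p) (Y c p) * X c p i * X c p j)"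
  shows "box_op M (em_potential M g0 Y X) f p =
    - (\<Sum>i<n. \<Sum>j<n. P i j * cderiv M c i (cderiv M c j f) p)
    + (\<Sum>l<n. (\<Sum>k<n. H l k * cderiv M c k f p) * (\<Sum>i<n. \<Sum>j<n. P i j * K l i j))
    + (\<Sum>k<n. X c p k * cderiv M c k f p) * (\<Sum>i<n. \<Sum>j<n. P i j * (T i j - (\<Sum>l<n. Y c p l * K l i j)))"
proof -
  let ?x = "flat M g0 X c p" and ?y = "flat M g0 Y c p" and ?gP = "em_potential M g0 Y X"
  let ?S = "dflat n (g0 c p) dg (X c p) dX"
  have fl: "(\<Sum>k<n. flat M g0 Z c p k * V k) = ginner n (g0 c p) (Z c p) V" for Z V
  proof -
    have "(\<Sum>k<n. flat M g0 Z c p k * V k) = (\<Sum>k<n. \<Sum>l<n. g0 c p l k * Z c p l * V k)"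
      using p by (simp add: flat_def sum_distrib_right g0_sym)
    also have "\<dots> = ginner n (g0 c p) (Z c p) V"
      unfolding ginner_def by (rule sum.swap)
    finally show ?thesis .
  qed
  interpret np: null_perturbation n "g0 c p" H "X c p" "Y c p" ?x ?y "ginner n (g0 c p) (Y c p) (Y c p)" P
  proof
    show "P = (\<lambda>i j. H i j - Y c p i * X c p j - X c p i * Y c p j + ginner n (g0 c p) (Y c p) (Y c p) * X c p i * X c p j)"
      by (rule P)
    show "flat M g0 X c p i = (\<Sum>k<n. g0 c p i k * X c p k)" for i by (rule flat_def)
    show "flat M g0 Y c p i = (\<Sum>k<n. g0 c p i k * Y c p k)" for i by (rule flat_def)
  qed (use p in \<open>simp_all only: inv g0_sym fl XX XY inv_sym\<close>)
  define D where "D i j l = dg i j l + T i j * ?x l + ?y j * ?S i l + ?S i j * ?y l + ?x j * T i l" for i j l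
  have gi: "ginv M ?gP c p i j = P i j" if "i < n" "j < n" for i j
    by (rule ginv_eqI) (use that np.P_inverse in \<open>simp_all add: em_potential_def\<close>)
  have "has_cderiv M c i (\<lambda>q. ?gP c q j l) p
      ((dg i j l + (?y j * ?S i l + T i j * ?x l)) + (?x j * T i l + ?S i j * ?y l))"
    if "i < n" "j < n" "l < n" for i j l
    unfolding em_potential_def T
    by (intro has_cderiv_add has_cderiv_mult dg has_cderiv_flat X Y ok p that)
  then have D: "cderiv M c i (\<lambda>q. ?gP c q j l) p = D i j l" if "i < n" "j < n" "l < n" for i j l
    using that by (simp add: has_cderiv_imp_cderiv D_def algebra_simps)
  have chr: "christoffel M ?gP c k i j p = (1/2) * (\<Sum>l<n. P k l * (D i j l + D j i l - D l i j))"
    if "k < n" "i < n" "j < n" for k i j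
    using that by (simp add: christoffel_def gi D)
  have "box_op M ?gP f p = - (\<Sum>i<n. \<Sum>j<n. P i j * (cderiv M c i (cderiv M c j f) p
      - (\<Sum>k<n. (1/2) * (\<Sum>l<n. P k l * (D i j l + D j i l - D l i j)) * cderiv M c k f p)))"
    by (simp add: box_op_def cp[symmetric] gi chr)
  also have "\<dots> = - (\<Sum>i<n. \<Sum>j<n. P i j * cderiv M c i (cderiv M c j f) p)
      + (\<Sum>i<n. \<Sum>j<n. P i j * (\<Sum>k<n. (1/2) * (\<Sum>l<n. P k l * (D i j l + D j i l - D l i j)) * cderiv M c k f p))"
    by (simp add: right_diff_distrib sum_subtractf)
  also have "(\<Sum>i<n. \<Sum>j<n. P i j * (\<Sum>k<n. (1/2) * (\<Sum>l<n. P k l * (D i j l + D j i l - D l i j)) * cderiv M c k f p)) =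
      (\<Sum>l<n. (\<Sum>k<n. H l k * cderiv M c k f p) * (\<Sum>i<n. \<Sum>j<n. P i j * K l i j))
    + (\<Sum>k<n. X c p k * cderiv M c k f p) * (\<Sum>i<n. \<Sum>j<n. P i j * (T i j - (\<Sum>l<n. Y c p l * K l i j)))"
    unfolding D_def
  proof (rule np.christoffel_contraction)
    show "dg i j l = dg i l j" if "i < n" "j < n" "l < n" for i j l
      by (rule dg_sym[OF that])
    show "K = (\<lambda>l i j. (dg i j l + dg j i l - dg l i j) / 2)" by (simp add: first_kind_def fun_eq_iff)
    show "?S i j = (\<Sum>l<n. X c p l * K l i j)" if "i < n" "j < n" for i j
      by (rule dflat_parallel[OF X par that])
  qed (rule T_X)
  finally show ?thesis by simp
qed

end

section \<open>Eigenfunctions of the Laplacian on the circle\<close>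

text \<open>\<open>P\<close> and \<open>R\<close> are the components of the pair
  \<open>(f, f' / q)\<close> rotated back by the angle \<open>q * u\<close>, hence constants of
  motion; undoing the rotation recovers \<open>f\<close>.\<close>

lemma harmonic_oscillator:
  fixes f f' :: "real \<Rightarrow> real"
  assumes "\<And>u. (f has_real_derivative f' u) (at u)" "\<And>u. (f' has_real_derivative - (q\<^sup>2) * f u) (at u)" "q \<noteq> 0"
  obtains a b where "\<And>u. f u = a * cos (q * u) + b * sin (q * u)"
proof -
  define P where "P u = f u * cos (q * u) - f' u / q * sin (q * u)" for u
  define R where "R u = f u * sin (q * u) + f' u / q * cos (q * u)" for u
  have "(P has_real_derivative 0) (at u)" for u
    unfolding P_def
    by (rule derivative_eq_intros assms(1,2) refl | simp add: assms(3) power2_eq_square field_simps)+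
  then have "P u = P 0" for u using DERIV_isconst_all by blast
  have "(R has_real_derivative 0) (at u)" for u
    unfolding R_def
    by (rule derivative_eq_intros assms(1,2) refl | simp add: assms(3) power2_eq_square field_simps)+
  then have "R u = R 0" for u using DERIV_isconst_all by blast
  have "f u = P 0 * cos (q * u) + R 0 * sin (q * u)" for u
  proof -
    have alg: "(F * c - G * s) * c + (F * s + G * c) * s = F * (c * c + s * s)" for F G c s :: real
      by (simp add: algebra_simps)
    have "P u * cos (q * u) + R u * sin (q * u) = f u * (cos (q * u) * cos (q * u) + sin (q * u) * sin (q * u))"
      unfolding P_def R_def by (rule alg)
    then show ?thesis using \<open>P u = P 0\<close> \<open>R u = R 0\<close> by simp
  qed
  then show ?thesis by (rule that)
qed

text \<open>A chart sees only one period. The derivative on the whole line is glued from the charts,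
  which agree on overlaps because derivatives on the line are unique.\<close>

lemma eigenspace_circle_imp_ode:
  assumes \<delta>: "\<delta> > 0" and f: "f \<in> eigenspace (circle_mfd \<delta>) circle_metric lam"
  obtains f' where "\<And>u. ((\<lambda>u. f (circle_pt \<delta> u)) has_real_derivative f' u) (at u)"
    "\<And>u. (f' has_real_derivative - lam * f (circle_pt \<delta> u)) (at u)"
proof -
  let ?M = "circle_mfd \<delta>" and ?F = "\<lambda>u. f (circle_pt \<delta> u)"
  have ok: "chart_ok ?M r" for r by (rule chart_ok_circle[OF \<delta>])
  have sm: "smooth_in_chart ?M r f" for r using f by (simp add: eigenspace_def smooth_function_def)
  have real_deriv: "((\<lambda>u. h (circle_pt \<delta> u)) has_real_derivative D) (at u)"
    if h: "has_cderiv ?M r 0 h (circle_pt \<delta> u) D" and u: "r < u" "u < r + 2 * pi * \<delta>" for h D r u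
  proof -
    let ?y = "\<lambda>v i. if i = (0::nat) then v else (0::real)"
    have P: "param ?M r (?y v) = circle_pt \<delta> v" if "r < v" "v < r + 2 * pi * \<delta>" for v
      using param_chart[OF ok, of "circle_pt \<delta> v" r] that \<delta> by (simp add: chart_circle)
    have "((\<lambda>v. h (param ?M r (?y v))) has_vector_derivative D) (at u)"
      using h u \<delta> by (simp add: has_cderiv_def has_pd_def chart_circle fun_upd_def cong: if_cong)
    moreover have ev: "\<forall>\<^sub>F v in nhds u. v \<in> UNIV \<longrightarrow> h (param ?M r (?y v)) = h (circle_pt \<delta> v)"
      by (rule eventually_mono[OF eventually_nhds_in_open[of "{r<..<r + 2 * pi * \<delta>}"]]) (use u P in auto)
    ultimately show ?thesis
      using has_vector_derivative_cong_ev[OF ev] P[OF u] by (simp add: has_real_derivative_iff_has_vector_derivative)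
  qed
  \<comment> \<open>The chart that starts half a period before \<open>u\<close> has \<open>u\<close>
    in its middle.\<close>
  define f' where "f' u = cderiv ?M (u - pi * \<delta>) 0 f (circle_pt \<delta> u)" for u
  have pd: "0 < pi * \<delta>" using \<delta> by simp
  have d1: "(?F has_real_derivative cderiv ?M r 0 f (circle_pt \<delta> u)) (at u)" if u: "r < u" "u < r + 2 * pi * \<delta>" for r u
    by (rule real_deriv[OF smooth_in_chart_has_cderiv[OF sm]]) (use u in auto)
  have F: "(?F has_real_derivative f' u) (at u)" for u
    unfolding f'_def by (rule d1) (use pd in auto)
  have f'_eq: "f' u = cderiv ?M r 0 f (circle_pt \<delta> u)" if u: "r < u" "u < r + 2 * pi * \<delta>" for r u
    using DERIV_unique[OF F d1[OF u]] .
  have d2: "(f' has_real_derivative cderiv ?M r 0 (cderiv ?M r 0 f) (circle_pt \<delta> u)) (at u)"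
    if u: "r < u" "u < r + 2 * pi * \<delta>" for r u
  proof -
    have "((\<lambda>v. cderiv ?M r 0 f (circle_pt \<delta> v)) has_real_derivative cderiv ?M r 0 (cderiv ?M r 0 f) (circle_pt \<delta> u)) (at u)"
      by (rule real_deriv[OF smooth_in_chart_has_cderiv2[OF sm]]) (use u ok in auto)
    moreover have ev: "\<forall>\<^sub>F v in nhds u. cderiv ?M r 0 f (circle_pt \<delta> v) = f' v"
      by (rule eventually_mono[OF eventually_nhds_in_open[of "{r<..<r + 2 * pi * \<delta>}"]]) (use u f'_eq in auto)
    ultimately show ?thesis by (simp only: DERIV_cong_ev[OF refl ev refl])
  qed
  \<comment> \<open>In the chart chosen by \<open>chart_at\<close> the point has a coordinate
    \<open>v\<close> that may differ from \<open>u\<close> by periods; periodicity carries the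
    second derivative from \<open>v\<close> back to \<open>u\<close>.\<close>
  have f'_per: "f' (u + 2 * pi * \<delta> * of_int k) = f' u" for u k
  proof -
    have "((\<lambda>v. ?F (v + 2 * pi * \<delta> * of_int k)) has_real_derivative f' (u + 2 * pi * \<delta> * of_int k)) (at u)"
      using F by (rule DERIV_shift[THEN iffD1])
    then have "(?F has_real_derivative f' (u + 2 * pi * \<delta> * of_int k)) (at u)" by (simp only: circle_pt_shift)
    then show ?thesis by (rule DERIV_unique) (rule F)
  qed
  have "(f' has_real_derivative - lam * ?F u) (at u)" for u
  proof -
    define r where "r = chart_at ?M (circle_pt \<delta> u)"
    have "\<exists>c\<in>charts ?M. circle_pt \<delta> u \<in> chart_dom ?M c"
      using pd by (intro bexI[of _ "u - pi * \<delta>"]) auto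
    then have "circle_pt \<delta> u \<in> chart_dom ?M r" unfolding r_def by (rule chart_at_in)
    then obtain v where v: "r < v" "v < r + 2 * pi * \<delta>" "circle_pt \<delta> u = circle_pt \<delta> v" by auto
    have "v \<in> circle_pt \<delta> v" by (auto simp: circle_pt_eq intro: exI[of _ 0])
    then have "v \<in> circle_pt \<delta> u" by (simp only: v(3))
    then obtain k :: int where k: "v = u + 2 * pi * \<delta> * of_int k" by (auto simp: circle_pt_eq)
    have gi: "ginv ?M circle_metric r (circle_pt \<delta> u) 0 0 = 1"
      by (subst ginv_eqI[where B = "\<lambda>i j. 1"]) (auto simp: circle_metric_def)
    have "christoffel ?M circle_metric r 0 0 0 (circle_pt \<delta> u) = 0"
      by (simp add: christoffel_def circle_metric_def has_cderiv_imp_cderiv[OF has_cderiv_const])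
    then have "box_op ?M circle_metric f (circle_pt \<delta> u) = - cderiv ?M r 0 (cderiv ?M r 0 f) (circle_pt \<delta> u)"
      by (simp add: box_op_def r_def[symmetric] gi)
    moreover have "box_op ?M circle_metric f (circle_pt \<delta> u) = lam * f (circle_pt \<delta> u)"
      using f by (auto simp: eigenspace_def pts_circle)
    ultimately have "cderiv ?M r 0 (cderiv ?M r 0 f) (circle_pt \<delta> u) = - lam * ?F u" by simp
    then have "(f' has_real_derivative - lam * ?F u) (at v)"
      using d2[OF v(1,2)] by (simp only: v(3))
    then have "((\<lambda>z. f' (z + 2 * pi * \<delta> * of_int k)) has_real_derivative - lam * ?F u) (at u)"
      unfolding k by (rule DERIV_shift[THEN iffD1])
    then show ?thesis by (simp add: f'_per)
  qed
  with F show ?thesis by (rule that)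
qed

text \<open>For \<open>lam = 0\<close> the equation leaves an affine function, whose slope must
  vanish by periodicity; the sine coefficient is then arbitrary and taken as 0.\<close>

lemma eigenspace_circle_fourier:
  assumes \<delta>: "\<delta> > 0" and lam: "lam \<ge> 0" and f: "f \<in> eigenspace (circle_mfd \<delta>) circle_metric lam"
  obtains a b where "\<And>u. f (circle_pt \<delta> u) = a * cos (sqrt lam * u) + b * sin (sqrt lam * u)"
proof -
  obtain f' where f': "\<And>u. ((\<lambda>u. f (circle_pt \<delta> u)) has_real_derivative f' u) (at u)"
    "\<And>u. (f' has_real_derivative - lam * f (circle_pt \<delta> u)) (at u)"
    using eigenspace_circle_imp_ode[OF \<delta> f] by blast
  show ?thesis
  proof (cases "lam = 0")
    case False
    then show ?thesis
      using harmonic_oscillator[of "\<lambda>u. f (circle_pt \<delta> u)" f' "sqrt lam"] f' lam that by auto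
  next
    case True
    define a where "a = f' 0"
    have "f' u = a" for u
      using f'(2) DERIV_isconst_all[of f'] unfolding a_def True by simp
    then have "((\<lambda>u. f (circle_pt \<delta> u) - a * u) has_real_derivative 0) (at u)" for u
      using f'(1) by (auto intro!: derivative_eq_intros)
    then have lin: "f (circle_pt \<delta> u) - a * u = f (circle_pt \<delta> 0)" for u
      using DERIV_isconst_all[of "\<lambda>u. f (circle_pt \<delta> u) - a * u" u 0] by simp
    have "circle_pt \<delta> (0 + 2 * pi * \<delta> * of_int 1) = circle_pt \<delta> 0" by (rule circle_pt_shift)
    then have "a = 0" using lin[of "2 * pi * \<delta>"] \<delta> by simp
    then show ?thesis using lin True that[of "f (circle_pt \<delta> 0)" 0] by simp
  qed
qed

section \<open>The product space-time\<close>

text \<open>The diagonal of \<open>g0\<close> in the coordinates 0 to 4. Both \<open>t\<close>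
  (index 0) and the circle coordinate \<open>u\<close> (index 4) are timelike.\<close>

definition eps5 :: "nat \<Rightarrow> real" where
  "eps5 k = (if k = 0 \<or> k = 4 then - 1 else 1)"

locale spacetime_factors =
  fixes \<Theta> :: "(nat \<Rightarrow> real) set" and \<delta> :: real and W :: "('w, 'c) mfd" and gW :: "('w, 'c) bilin_field"
  assumes \<Theta>: "axis_open 4 \<Theta>" "\<Theta> \<subseteq> topspace (Euclidean_space 4)" and \<delta>: "\<delta> > 0"
    and W: "smooth_manifold W" and gW: "riemannian_metric W gW"
begin

abbreviation "C \<equiv> spacetime \<Theta> \<delta> W"
abbreviation "g0 \<equiv> neutral_metric gW"

lemma mdim_fibre: "mdim (fibre_mfd \<delta> W) = 1 + mdim W"
  by (simp add: fibre_mfd_def)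

lemma mdim_C: "mdim C = 5 + mdim W"
  by (simp add: spacetime_def mdim_fibre)

lemma charts_C: "charts C = {()} \<times> UNIV \<times> charts W"
  by (simp add: spacetime_def fibre_mfd_def)

lemma pts_C: "pts C = \<Theta> \<times> range (circle_pt \<delta>) \<times> pts W"
  by (simp add: spacetime_def fibre_mfd_def pts_circle)

lemma chart_dom_C: "chart_dom C (l, r, d) = \<Theta> \<times> chart_dom (circle_mfd \<delta>) r \<times> chart_dom W d"
  by (simp add: spacetime_def fibre_mfd_def)

lemma chart_ok_fibre: "d \<in> charts W \<Longrightarrow> chart_ok (fibre_mfd \<delta> W) (r, d)"
  unfolding fibre_mfd_def by (intro chart_ok_product chart_ok_circle chart_ok_smooth_manifold \<delta> W)

lemma chart_ok_C: "d \<in> charts W \<Longrightarrow> chart_ok C (l, r, d)"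
  unfolding spacetime_def by (intro chart_ok_product chart_ok_euclid chart_ok_fibre \<Theta>)

lemma g0_low:
  "j < 5 \<or> k < 5 \<Longrightarrow> g0 (l, r, d) (x, s, w) j k = (if j = k then eps5 j else 0)"
  by (auto simp: neutral_metric_def fibre_metric_def product_metric_def minkowski_def circle_metric_def eps5_def)

lemma g0_high:
  "5 \<le> j \<Longrightarrow> 5 \<le> k \<Longrightarrow> g0 (l, r, d) (x, s, w) j k = gW d w (j - 5) (k - 5)"
  by (auto simp: neutral_metric_def fibre_metric_def product_metric_def numeral_eq_Suc)

lemma gW_sym: "d \<in> charts W \<Longrightarrow> w \<in> chart_dom W d \<Longrightarrow> i < mdim W \<Longrightarrow> j < mdim W \<Longrightarrow> gW d w i j = gW d w j i"
  using gW unfolding riemannian_metric_def by blast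

lemma g0_symmetric:
  assumes "d \<in> charts W" "q \<in> chart_dom C (l, r, d)" "i < mdim C" "j < mdim C"
  shows "g0 (l, r, d) q i j = g0 (l, r, d) q j i"
proof -
  obtain x s w where q: "q = (x, s, w)" by (metis surj_pair)
  show ?thesis
    using assms gW_sym[of d w "i - 5" "j - 5"]
    by (cases "i < 5 \<or> j < 5") (auto simp: q g0_low g0_high chart_dom_C mdim_C)
qed

text \<open>The metric is indefinite, so positivity alone does not exclude a kernel. The first five
  rows are diagonal and kill the first five components; what remains lies in the kernel of the
  positive definite \<open>gW\<close>.\<close>

lemma g0_inverse_exists:
  assumes d: "d \<in> charts W" and p: "p \<in> chart_dom C (l, r, d)"
  obtains H where "\<And>i j. i < mdim C \<Longrightarrow> j < mdim C \<Longrightarrow> (\<Sum>k<mdim C. g0 (l, r, d) p i k * H k j) = (if i = j then 1 else 0)"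
    and "\<And>i j. i < mdim C \<Longrightarrow> j < mdim C \<Longrightarrow> H i j = H j i"
proof (rule nondegenerate_inverse_exists)
  obtain x s w where q: "p = (x, s, w)" by (metis surj_pair)
  let ?n = "mdim C" and ?m = "mdim W"
  have w: "w \<in> chart_dom W d" using p by (simp add: q chart_dom_C)
  fix v i assume v: "\<And>i. i < ?n \<Longrightarrow> (\<Sum>j<?n. g0 (l, r, d) p i j * v j) = 0" and i: "i < ?n"
  have low: "v k = 0" if "k < 5" for k
  proof -
    have "(\<Sum>j<?n. g0 (l, r, d) p k j * v j) = (\<Sum>j<?n. (if k = j then 1 else 0) * (eps5 k * v j))"
      by (intro sum.cong refl) (use that in \<open>auto simp: q g0_low\<close>)
    then show ?thesis using v[of k] that by (simp add: sum_delta_mult mdim_C eps5_def split: if_splits)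
  qed
  have "(\<Sum>j<?m. gW d w k j * v (j + 5)) = 0" if k: "k < ?m" for k
  proof -
    have "(\<Sum>j<?n. g0 (l, r, d) p (k + 5) j * v j) =
      (\<Sum>j<5. g0 (l, r, d) p (k + 5) j * v j) + (\<Sum>j=5..<5+?m. g0 (l, r, d) p (k + 5) j * v j)"
      unfolding mdim_C atLeast0LessThan[symmetric] by (rule sum.atLeastLessThan_concat[symmetric]) auto
    also have "(\<Sum>j<5. g0 (l, r, d) p (k + 5) j * v j) = 0" by (simp add: low)
    also have "(\<Sum>j=5..<5+?m. g0 (l, r, d) p (k + 5) j * v j) = (\<Sum>j<?m. gW d w k j * v (j + 5))"
      using sum.shift_bounds_nat_ivl[of "\<lambda>j. g0 (l, r, d) p (k + 5) j * v j" 0 5 ?m]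
      by (simp add: add.commute atLeast0LessThan q g0_high)
    finally show ?thesis using v[of "k + 5"] k by (simp add: mdim_C)
  qed
  then have "(\<Sum>k<?m. v (k + 5) * (\<Sum>j<?m. gW d w k j * v (j + 5))) = 0" by simp
  then have "(\<Sum>k<?m. \<Sum>j<?m. gW d w k j * v (k + 5) * v (j + 5)) = 0"
    by (simp add: sum_distrib_left mult_ac)
  moreover have "(\<exists>i<?m. \<xi> i \<noteq> 0) \<longrightarrow> (\<Sum>i<?m. \<Sum>j<?m. gW d w i j * \<xi> i * \<xi> j) > 0" for \<xi>
    using gW d w unfolding riemannian_metric_def by blast
  from this[of "\<lambda>k. v (k + 5)"] have "(\<exists>i<?m. v (i + 5) \<noteq> 0) \<longrightarrow> (\<Sum>k<?m. \<Sum>j<?m. gW d w k j * v (k + 5) * v (j + 5)) > 0" .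
  ultimately have high: "v (k + 5) = 0" if "k < ?m" for k using that by fastforce
  show "v i = 0"
    using low[of i] high[of "i - 5"] i by (cases "i < 5") (auto simp: mdim_C)
qed (use g0_symmetric[OF d p] in auto)

lemma has_cderiv_base:
  assumes d: "d \<in> charts W" and p: "(x, s, w) \<in> chart_dom C (l, r, d)" and i: "i < mdim C"
    and f: "i < 4 \<Longrightarrow> has_pd i f x D"
  shows "has_cderiv C (l, r, d) i (\<lambda>q. f (fst q)) (x, s, w) (if i < 4 then D else 0)"
proof -
  have "has_cderiv C (l, r, d) i (\<lambda>q. f (fst q)) (x, s, w) (if i < mdim (euclid_mfd 4 \<Theta>) then D else 0)"
    unfolding spacetime_def
    by (rule has_cderiv_product_fst)
      (use d p i f in \<open>auto simp: chart_ok_fibre chart_ok_euclid[OF \<Theta>] chart_dom_C mdim_C mdim_fibre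
        intro!: has_cderiv_euclid \<Theta>, auto simp: fibre_mfd_def\<close>)
  then show ?thesis by simp
qed

lemma has_cderiv_fibre:
  assumes d: "d \<in> charts W" and p: "(x, s, w) \<in> chart_dom C (l, r, d)" and i: "i < mdim C"
    and f: "4 \<le> i \<Longrightarrow> has_cderiv (fibre_mfd \<delta> W) (r, d) (i - 4) f (s, w) D"
  shows "has_cderiv C (l, r, d) i (\<lambda>q. f (snd q)) (x, s, w) (if i < 4 then 0 else D)"
proof -
  have "has_cderiv C (l, r, d) i (\<lambda>q. f (snd q)) (x, s, w) (if i < mdim (euclid_mfd 4 \<Theta>) then 0 else D)"
    unfolding spacetime_def
    by (rule has_cderiv_product_snd)
      (use d p i f in \<open>auto simp: chart_ok_fibre chart_ok_euclid[OF \<Theta>] chart_dom_C mdim_C mdim_fibre, auto simp: fibre_mfd_def\<close>)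
  then show ?thesis by simp
qed

lemma has_cderiv_W:
  assumes d: "d \<in> charts W" and p: "(x, s, w) \<in> chart_dom C (l, r, d)" and i: "i < mdim C"
    and f: "5 \<le> i \<Longrightarrow> has_cderiv W d (i - 5) f w D"
  shows "has_cderiv C (l, r, d) i (\<lambda>q. f (snd (snd q))) (x, s, w) (if i < 5 then 0 else D)"
proof -
  have "has_cderiv (fibre_mfd \<delta> W) (r, d) (i - 4) (\<lambda>q. f (snd q)) (s, w)
      (if i - 4 < mdim (circle_mfd \<delta>) then 0 else D)" if "4 \<le> i"
    unfolding fibre_mfd_def
    by (rule has_cderiv_product_snd)
      (use d p i f that in \<open>auto simp: chart_ok_circle[OF \<delta>] chart_ok_smooth_manifold[OF W] chart_dom_C mdim_C Suc_le_eq\<close>)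
  from has_cderiv_fibre[OF d p i this]
  have "has_cderiv C (l, r, d) i (\<lambda>q. f (snd (snd q))) (x, s, w)
     (if i < 4 then 0 else if i - 4 < mdim (circle_mfd \<delta>) then 0 else D)" .
  moreover have "(if i < 4 then 0 else if i - 4 < mdim (circle_mfd \<delta>) then 0 else D) = (if i < 5 then 0 else D)"
    by auto
  ultimately show ?thesis by simp
qed

lemma chart_C_4:
  assumes "(x, circle_pt \<delta> u, w) \<in> chart_dom C (l, r, d)" "r < u" "u < r + 2 * pi * \<delta>"
  shows "chart C (l, r, d) (x, circle_pt \<delta> u, w) 4 = u"
  using chart_circle[OF \<delta> assms(2,3)] by (simp add: spacetime_def fibre_mfd_def)

end

locale spacetime_point = spacetime_factors +
  fixes x s w r d H
  assumes d: "d \<in> charts W" and p: "(x, s, w) \<in> chart_dom C ((), r, d)"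
    and H: "\<And>i j. i < mdim C \<Longrightarrow> j < mdim C \<Longrightarrow> (\<Sum>k<mdim C. g0 ((), r, d) (x, s, w) i k * H k j) = (if i = j then 1 else 0)"
    and H_sym: "\<And>i j. i < mdim C \<Longrightarrow> j < mdim C \<Longrightarrow> H i j = H j i"
begin

abbreviation "c \<equiv> ((), r, d)"

text \<open>The components of \<open>g0\<close> are constant except those of \<open>gW\<close>,
  which vary only along \<open>W\<close>.\<close>

definition dg where
  "dg i j k = (if i < 5 \<or> j < 5 \<or> k < 5 then 0 else cderiv W d (i - 5) (\<lambda>w. gW d w (j - 5) (k - 5)) w)"

lemma has_cderiv_g0:
  assumes i: "i < mdim C" and jk: "j < mdim C" "k < mdim C"
  shows "has_cderiv C c i (\<lambda>q. g0 c q j k) (x, s, w) (dg i j k)"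
proof (cases "j < 5 \<or> k < 5")
  case True
  then have "(\<lambda>q. g0 c q j k) = (\<lambda>q. if j = k then eps5 j else 0)" by (auto simp: fun_eq_iff g0_low)
  then show ?thesis using True by (simp add: dg_def has_cderiv_const)
next
  case False
  have "smooth_in_chart W d (\<lambda>w. gW d w (j - 5) (k - 5))"
    using gW d jk False unfolding riemannian_metric_def by (auto simp: mdim_C)
  then have "has_cderiv C c i (\<lambda>q. gW d (snd (snd q)) (j - 5) (k - 5)) (x, s, w)
    (if i < 5 then 0 else cderiv W d (i - 5) (\<lambda>w. gW d w (j - 5) (k - 5)) w)"
    by (intro has_cderiv_W[OF d p i, where f = "\<lambda>w. gW d w (j - 5) (k - 5)"] smooth_in_chart_has_cderiv)
      (use p i in \<open>auto simp: chart_dom_C mdim_C\<close>)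
  moreover have "(\<lambda>q. gW d (snd (snd q)) (j - 5) (k - 5)) = (\<lambda>q. g0 c q j k)"
    using False by (auto simp: fun_eq_iff g0_high)
  ultimately show ?thesis using False by (simp add: dg_def cong: if_cong)
qed

sublocale metric_chart C g0 c "(x, s, w)" dg H
proof
  show "chart_ok C c" by (rule chart_ok_C[OF d])
  show "c \<in> charts C" using d by (simp add: charts_C)
qed (use p g0_symmetric[OF d] has_cderiv_g0 H H_sym in auto)

lemma H_low: "k < 5 \<Longrightarrow> j < mdim C \<Longrightarrow> H k j = (if k = j then eps5 k else 0)"
proof -
  assume k: "k < 5" and j: "j < mdim C"
  have "(\<Sum>l<mdim C. g0 c (x, s, w) k l * H l j) = (\<Sum>l<mdim C. (if k = l then 1 else 0) * (eps5 k * H l j))"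
    by (intro sum.cong refl) (use k in \<open>auto simp: g0_low\<close>)
  then have "eps5 k * H k j = (if k = j then 1 else 0)"
    using H[of k j] k j by (simp add: sum_delta_mult mdim_C)
  then show ?thesis by (auto simp: eps5_def split: if_splits)
qed

lemma K_low: "l < 5 \<or> i < 5 \<or> j < 5 \<Longrightarrow> first_kind dg l i j = 0"
  by (auto simp: first_kind_def dg_def)

lemma flat_low: "k < 5 \<Longrightarrow> flat C g0 Z c (x, s, w) k = eps5 k * Z c (x, s, w) k"
proof -
  assume k: "k < 5"
  have "flat C g0 Z c (x, s, w) k = (\<Sum>l<mdim C. (if k = l then 1 else 0) * (eps5 k * Z c (x, s, w) l))"
    unfolding flat_def by (intro sum.cong refl) (use k in \<open>auto simp: g0_low\<close>)
  then show ?thesis using k by (simp add: sum_delta_mult mdim_C)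
qed

lemma sum_low: "(\<And>k. 5 \<le> k \<Longrightarrow> k < mdim C \<Longrightarrow> h k = 0) \<Longrightarrow> (\<Sum>k<mdim C. h k) = (\<Sum>k<5. h k)"
  by (rule sum.mono_neutral_right) (auto simp: mdim_C)

text \<open>In the Christoffel term with \<open>H\<close> the symbols vanish for
  \<open>l < 5\<close>, and for \<open>l \<ge> 5\<close> the row of \<open>H\<close> meets only
  directions in which \<open>f\<close> has derivative 0. Components of \<open>X\<close> and
  \<open>P\<close> along \<open>W\<close> therefore enter only through the trace in the last
  factor.\<close>

lemma box_base_function:
  fixes X Y
  assumes cp: "c = chart_at C (x, s, w)"
    and X: "\<And>i k. i < mdim C \<Longrightarrow> k < mdim C \<Longrightarrow> has_cderiv C c i (\<lambda>q. X c q k) (x, s, w) (dX i k)"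
    and Y: "\<And>i k. i < mdim C \<Longrightarrow> k < mdim C \<Longrightarrow> has_cderiv C c i (\<lambda>q. Y c q k) (x, s, w) (dY i k)"
    and par: "parallel C g0 X"
    and XX: "ginner (mdim C) (g0 c (x, s, w)) (X c (x, s, w)) (X c (x, s, w)) = 0"
    and XY: "ginner (mdim C) (g0 c (x, s, w)) (X c (x, s, w)) (Y c (x, s, w)) = 0"
    and T: "T = dflat (mdim C) (g0 c (x, s, w)) dg (Y c (x, s, w)) dY"
    and T_X: "\<And>l. l < mdim C \<Longrightarrow> (\<Sum>i<mdim C. X c (x, s, w) i * (T i l - T l i)) = 0"
    and P: "P = (\<lambda>i j. H i j - Y c (x, s, w) i * X c (x, s, w) j - X c (x, s, w) i * Y c (x, s, w) j
      + ginner (mdim C) (g0 c (x, s, w)) (Y c (x, s, w)) (Y c (x, s, w)) * X c (x, s, w) i * X c (x, s, w) j)"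
    and f: "\<And>k. 5 \<le> k \<Longrightarrow> k < mdim C \<Longrightarrow> cderiv C c k f (x, s, w) = 0"
    and f2: "\<And>i j. i < mdim C \<Longrightarrow> j < mdim C \<Longrightarrow> 5 \<le> i \<or> 5 \<le> j \<Longrightarrow> cderiv C c i (cderiv C c j f) (x, s, w) = 0"
  shows "box_op C (em_potential C g0 Y X) f (x, s, w) =
    - (\<Sum>i<5. \<Sum>j<5. P i j * cderiv C c i (cderiv C c j f) (x, s, w))
    + (\<Sum>k<5. X c (x, s, w) k * cderiv C c k f (x, s, w)) *
      (\<Sum>i<mdim C. \<Sum>j<mdim C. P i j * (T i j - (\<Sum>l<mdim C. Y c (x, s, w) l * first_kind dg l i j)))"
proof -
  let ?p = "(x, s, w)"
  have "(\<Sum>k<mdim C. H l k * cderiv C c k f ?p) * (\<Sum>i<mdim C. \<Sum>j<mdim C. P i j * first_kind dg l i j) = 0"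
    if l: "l < mdim C" for l
  proof (cases "l < 5")
    case True
    then show ?thesis by (simp add: K_low)
  next
    case False
    have "H l k * cderiv C c k f ?p = 0" if k: "k < mdim C" for k
      using f[of k] H_low[of k l] H_sym[OF l k] k l False by (cases "k < 5") auto
    then have "(\<Sum>k<mdim C. H l k * cderiv C c k f ?p) = 0" by (intro sum.neutral) auto
    then show ?thesis by simp
  qed
  then have 1: "(\<Sum>l<mdim C. (\<Sum>k<mdim C. H l k * cderiv C c k f ?p) * (\<Sum>i<mdim C. \<Sum>j<mdim C. P i j * first_kind dg l i j)) = 0"
    by (intro sum.neutral) auto
  have 2: "(\<Sum>i<mdim C. \<Sum>j<mdim C. P i j * cderiv C c i (cderiv C c j f) ?p) =
      (\<Sum>i<5. \<Sum>j<5. P i j * cderiv C c i (cderiv C c j f) ?p)"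
    by (subst sum_low) (auto simp: f2 mdim_C intro!: sum.cong sum_low[unfolded mdim_C])
  have 3: "(\<Sum>k<mdim C. X c ?p k * cderiv C c k f ?p) = (\<Sum>k<5. X c ?p k * cderiv C c k f ?p)"
    by (rule sum_low) (simp add: f)
  show ?thesis
    using box_em_potential[where X = X and Y = Y and dX = dX and dY = dY and T = T and P = P and f = f, OF cp X Y par XX XY T T_X P] unfolding 1 2 3 by simp
qed

end

lemma sum_lessThan_5: "(\<Sum>k<5. h k) = h 0 + h 1 + h 2 + h 3 + h (4::nat)"
  by (simp add: eval_nat_numeral)

lemma sum_lessThan_4: "(\<Sum>k<4. h k) = h 0 + h 1 + h 2 + h (3::nat)"
  by (simp add: eval_nat_numeral)

section \<open>The wave operators on a single Fourier mode\<close>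

context spacetime_factors
begin

text \<open>Bound to a chart because the circle coordinate is not a global function.\<close>

definition mode :: "real \<Rightarrow> ((nat \<Rightarrow> real) \<Rightarrow> real) \<Rightarrow> ((nat \<Rightarrow> real) \<Rightarrow> real) \<Rightarrow> 'c lab \<Rightarrow> 'w pt \<Rightarrow> real" where
  "mode \<kappa> a b c q = a (fst q) * cos (\<kappa> * chart C c q 4) + b (fst q) * sin (\<kappa> * chart C c q 4)"

lemma has_cderiv_mode:
  assumes d: "d \<in> charts W" and p: "(x, s, w) \<in> chart_dom C (l, r, d)" and i: "i < mdim C"
    and a: "i < 4 \<Longrightarrow> has_pd i a x a'" and b: "i < 4 \<Longrightarrow> has_pd i b x b'"
  defines "u \<equiv> chart C (l, r, d) (x, s, w) 4"
  shows "has_cderiv C (l, r, d) i (mode \<kappa> a b (l, r, d)) (x, s, w)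
    (if i < 4 then a' * cos (\<kappa> * u) + b' * sin (\<kappa> * u)
     else if i = 4 then \<kappa> * b x * cos (\<kappa> * u) - \<kappa> * a x * sin (\<kappa> * u) else 0)"
proof -
  note ok = chart_ok_C[OF d, of l r]
  have cs: "((\<lambda>v. cos (\<kappa> * v)) has_vector_derivative - \<kappa> * sin (\<kappa> * v)) (at v)"
    "((\<lambda>v. sin (\<kappa> * v)) has_vector_derivative \<kappa> * cos (\<kappa> * v)) (at v)" for v
    unfolding has_real_derivative_iff_has_vector_derivative[symmetric]
    by (auto intro!: derivative_eq_intros)
  have "has_cderiv C (l, r, d) i (mode \<kappa> a b (l, r, d)) (x, s, w)
     ((a (fst (x, s, w)) * ((if i = 4 then 1 else 0) * (- \<kappa> * sin (\<kappa> * u))) + (if i < 4 then a' else 0) * cos (\<kappa> * u)) +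
      (b (fst (x, s, w)) * ((if i = 4 then 1 else 0) * (\<kappa> * cos (\<kappa> * u))) + (if i < 4 then b' else 0) * sin (\<kappa> * u)))"
    unfolding mode_def[abs_def] u_def
    by (intro has_cderiv_add has_cderiv_mult has_cderiv_base has_cderiv_chain has_cderiv_coordinate cs d p i a b ok)
  then show ?thesis by (rule back_subst[where P = "has_cderiv C (l, r, d) i (mode \<kappa> a b (l, r, d)) (x, s, w)"]) auto
qed

end

locale mode_point = spacetime_point +
  fixes \<phi> :: "(nat \<Rightarrow> real) \<times> real set \<Rightarrow> real" and \<kappa> :: real and A B :: "(nat \<Rightarrow> real) \<Rightarrow> real"
    and A1 B1 :: "nat \<Rightarrow> (nat \<Rightarrow> real) \<Rightarrow> real" and A2 B2 :: "nat \<Rightarrow> nat \<Rightarrow> (nat \<Rightarrow> real) \<Rightarrow> real"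
  assumes \<phi>: "\<And>y u. y \<in> \<Theta> \<Longrightarrow> \<phi> (y, circle_pt \<delta> u) = A y * cos (\<kappa> * u) + B y * sin (\<kappa> * u)"
    and A1: "\<And>y i. y \<in> \<Theta> \<Longrightarrow> i < 4 \<Longrightarrow> has_pd i A y (A1 i y)"
    and B1: "\<And>y i. y \<in> \<Theta> \<Longrightarrow> i < 4 \<Longrightarrow> has_pd i B y (B1 i y)"
    and A2: "\<And>y i j. y \<in> \<Theta> \<Longrightarrow> i < 4 \<Longrightarrow> j < 4 \<Longrightarrow> has_pd i (A1 j) y (A2 i j y)"
    and B2: "\<And>y i j. y \<in> \<Theta> \<Longrightarrow> i < 4 \<Longrightarrow> j < 4 \<Longrightarrow> has_pd i (B1 j) y (B2 i j y)"
    and chart_at: "((), r, d) = chart_at (spacetime \<Theta> \<delta> W) (x, s, w)"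
begin

abbreviation "cs \<equiv> cos (\<kappa> * chart C c (x, s, w) 4)"
abbreviation "sn \<equiv> sin (\<kappa> * chart C c (x, s, w) 4)"
abbreviation "f \<equiv> on_base_circle \<phi> :: _ pt \<Rightarrow> real"

lemma xin: "x \<in> \<Theta>"
  using p by (simp add: chart_dom_C)

lemma f_mode: "q \<in> chart_dom C c \<Longrightarrow> mode \<kappa> A B c q = f q"
proof -
  assume q: "q \<in> chart_dom C c"
  then obtain y u w' where "q = (y, circle_pt \<delta> u, w')" "y \<in> \<Theta>" "r < u" "u < r + 2 * pi * \<delta>"
    by (auto simp: chart_dom_C)
  then show ?thesis using q by (simp add: mode_def on_base_circle_def \<phi> chart_C_4)
qed

text \<open>Differentiation maps modes to modes: along \<open>u\<close> the coefficients
  \<open>(A, B)\<close> become \<open>(\<kappa> * B, - \<kappa> * A)\<close>. The same rule can thus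
  be applied again for the second derivatives.\<close>

lemma cderiv_f:
  assumes q: "q \<in> chart_dom C c" and j: "j < mdim C"
  shows "cderiv C c j f q = (if j < 4 then mode \<kappa> (A1 j) (B1 j) c q
    else if j = 4 then mode \<kappa> (\<lambda>y. \<kappa> * B y) (\<lambda>y. - \<kappa> * A y) c q else 0)"
proof -
  obtain y t w' where q': "q = (y, t, w')" by (metis surj_pair)
  have y: "y \<in> \<Theta>" using q by (simp add: q' chart_dom_C)
  have "has_cderiv C c j f q (if j < 4 then A1 j y * cos (\<kappa> * chart C c q 4) + B1 j y * sin (\<kappa> * chart C c q 4)
     else if j = 4 then \<kappa> * B y * cos (\<kappa> * chart C c q 4) - \<kappa> * A y * sin (\<kappa> * chart C c q 4) else 0)"
    unfolding q' by (rule has_cderiv_cong[OF has_cderiv_mode[OF d _ j A1 B1]])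
      (use y q q' j f_mode ok in auto)
  then show ?thesis by (auto dest!: has_cderiv_imp_cderiv simp: mode_def q')
qed

lemma cderiv2_f:
  assumes i: "i < mdim C" and j: "j < mdim C"
  shows "cderiv C c i (cderiv C c j f) (x, s, w) =
    (if 5 \<le> i \<or> 5 \<le> j then 0
     else if i < 4 \<and> j < 4 then A2 i j x * cs + B2 i j x * sn
     else if i < 4 then \<kappa> * B1 i x * cs - \<kappa> * A1 i x * sn
     else if j < 4 then \<kappa> * B1 j x * cs - \<kappa> * A1 j x * sn
     else - (\<kappa>\<^sup>2) * (A x * cs + B x * sn))"
proof -
  have "has_cderiv C c i (cderiv C c j f) (x, s, w) D"
    if "has_cderiv C c i (\<lambda>q. if j < 4 then mode \<kappa> (A1 j) (B1 j) c q
      else if j = 4 then mode \<kappa> (\<lambda>y. \<kappa> * B y) (\<lambda>y. - \<kappa> * A y) c q else 0) (x, s, w) D" for D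
    by (rule has_cderiv_cong[OF that ok p i]) (simp add: cderiv_f[OF _ j])
  note e = has_cderiv_imp_cderiv[OF this]
  consider "j < 4" | "j = 4" | "5 \<le> j" by linarith
  then show ?thesis
  proof cases
    case 1
    then show ?thesis
      by (subst e[OF has_cderiv_cong[OF has_cderiv_mode[OF d p i A2 B2, where \<kappa> = \<kappa>] ok p i]])
        (use xin in \<open>auto split: if_splits\<close>)
  next
    case 2
    have "has_pd i (\<lambda>y. \<kappa> * B y) x (\<kappa> * B1 i x)" "has_pd i (\<lambda>y. - \<kappa> * A y) x (- \<kappa> * A1 i x)" if "i < 4"
      using has_pd_mult[OF has_pd_const B1[OF xin that], of \<kappa>] has_pd_mult[OF has_pd_const A1[OF xin that], of "- \<kappa>"]
      by simp_all
    then show ?thesis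
      using 2 by (subst e[OF has_cderiv_cong[OF has_cderiv_mode[OF d p i, where \<kappa> = \<kappa> and
          a = "\<lambda>y. \<kappa> * B y" and a' = "\<kappa> * B1 i x" and b = "\<lambda>y. - \<kappa> * A y" and b' = "- \<kappa> * A1 i x"] ok p i]])
        (auto simp: power2_eq_square algebra_simps split: if_splits)
  next
    case 3
    then show ?thesis
      by (subst e[OF has_cderiv_cong[OF has_cderiv_const[of _ _ _ 0] ok p i]]) auto
  qed
qed

lemma cderiv_f_point: "cderiv C c 4 f (x, s, w) = \<kappa> * B x * cs - \<kappa> * A x * sn"
  using cderiv_f[OF p, of 4] by (simp add: mode_def mdim_C)

lemma cderiv_f_high: "5 \<le> k \<Longrightarrow> k < mdim C \<Longrightarrow> cderiv C c k f (x, s, w) = 0"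
  using cderiv_f[OF p, of k] by simp

lemma cderiv2_f_high:
  "i < mdim C \<Longrightarrow> j < mdim C \<Longrightarrow> 5 \<le> i \<or> 5 \<le> j \<Longrightarrow> cderiv C c i (cderiv C c j f) (x, s, w) = 0"
  by (simp add: cderiv2_f)

lemma H_diag: "k < 5 \<Longrightarrow> j < 5 \<Longrightarrow> H k j = (if k = j then eps5 k else 0)"
  by (rule H_low) (simp_all add: mdim_C)

lemmas cd2 = cderiv2_f[unfolded mdim_C]

text \<open>The circle is timelike, so \<open>box_op\<close> contains plus the second derivative in
  \<open>u\<close>; hence the minus sign of \<open>\<kappa>\<^sup>2\<close>.\<close>

lemma box_neutral:
  "box_op C g0 f (x, s, w) =
    (A2 0 0 x - A2 1 1 x - A2 2 2 x - A2 3 3 x - \<kappa>\<^sup>2 * A x) * cs +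
    (B2 0 0 x - B2 1 1 x - B2 2 2 x - B2 3 3 x - \<kappa>\<^sup>2 * B x) * sn"
proof -
  have em: "g0 = em_potential C g0 (\<lambda>_ _ _. 0) (\<lambda>_ _ _. 0)"
    by (simp add: fun_eq_iff em_potential_def flat_def)
  have "box_op C (em_potential C g0 (\<lambda>_ _ _. 0) (\<lambda>_ _ _. 0)) f (x, s, w) =
    - (\<Sum>i<5. \<Sum>j<5. H i j * cderiv C c i (cderiv C c j f) (x, s, w))"
    by (subst box_base_function[where P = H and T = "\<lambda>_ _. 0" and dX = "\<lambda>_ _. 0" and dY = "\<lambda>_ _. 0", OF chart_at])
      (auto simp: has_cderiv_const parallel_def has_cderiv_imp_cderiv[OF has_cderiv_const] ginner_def
        dflat_def fun_eq_iff cderiv_f_high cderiv2_f)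
  then show ?thesis
    unfolding em[symmetric] by (simp add: sum_lessThan_5 H_diag eps5_def cd2 algebra_simps)
qed

text \<open>Among the coordinates 0 to 4 the field \<open>X\<close> has only a time component, while
  \<open>v\<close> varies only along 1 to 3, so \<open>X(v) = 0\<close> and the trace term vanishes.
  For \<open>Y = - v X\<close> the norm of \<open>Y\<close> is 0 and the inverse metric is
  \<open>H + 2 v X \<otimes> X\<close>; the coefficient \<open>1 - 2 * V\<close> is minus its
  time-time entry.\<close>

lemma box_gravity:
  assumes X: "\<And>i k. i < mdim C \<Longrightarrow> k < mdim C \<Longrightarrow> has_cderiv C c i (\<lambda>q. X c q k) (x, s, w) (dX i k)"
    and par: "parallel C g0 X"
    and XX: "ginner (mdim C) (g0 c (x, s, w)) (X c (x, s, w)) (X c (x, s, w)) = 0"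
    and X0: "X c (x, s, w) 0 = - 1" and Xk: "\<And>k. 1 \<le> k \<Longrightarrow> k < 5 \<Longrightarrow> X c (x, s, w) k = 0"
    and v: "\<And>i. i < mdim C \<Longrightarrow> has_cderiv C c i v (x, s, w) (dv i)"
    and dv: "\<And>i. i = 0 \<or> 4 \<le> i \<Longrightarrow> dv i = 0"
  defines "V \<equiv> v (x, s, w)"
  shows "box_op C (gravity_potential C g0 v X) f (x, s, w) =
    ((1 - 2 * V) * A2 0 0 x - A2 1 1 x - A2 2 2 x - A2 3 3 x - \<kappa>\<^sup>2 * A x) * cs +
    ((1 - 2 * V) * B2 0 0 x - B2 1 1 x - B2 2 2 x - B2 3 3 x - \<kappa>\<^sup>2 * B x) * sn"
proof -
  let ?p = "(x, s, w)" and ?n = "mdim C"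
  let ?Y = "\<lambda>c q k. - v q * X c q k"
  let ?dY = "\<lambda>i k. - V * dX i k + - dv i * X c ?p k"
  let ?x = "flat C g0 X c ?p"
  define T where "T = dflat ?n (g0 c ?p) dg (?Y c ?p) ?dY"
  define P where "P = (\<lambda>i j. H i j - ?Y c ?p i * X c ?p j - X c ?p i * ?Y c ?p j
      + ginner ?n (g0 c ?p) (?Y c ?p) (?Y c ?p) * X c ?p i * X c ?p j)"
  have em: "gravity_potential C g0 v X = em_potential C g0 ?Y X"
    by (simp add: fun_eq_iff em_potential_def gravity_potential_def flat_def sum_distrib_left sum_negf mult_ac
        flip: sum_distrib_left)
  have Y: "has_cderiv C c i (\<lambda>q. ?Y c q k) ?p (?dY i k)" if "i < ?n" "k < ?n" for i k
  proof -
    have "has_cderiv C c i (\<lambda>q. - v q) ?p (dv i * - 1)"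
      by (rule has_cderiv_chain[OF v _ ok p]) (use that in \<open>auto intro!: derivative_eq_intros\<close>)
    from has_cderiv_mult[OF this X[OF that] ok p] show ?thesis by (simp add: V_def)
  qed
  have XY: "ginner ?n (g0 c ?p) (X c ?p) (?Y c ?p) = 0" and YY: "ginner ?n (g0 c ?p) (?Y c ?p) (?Y c ?p) = 0"
  proof -
    have "ginner ?n (g0 c ?p) (X c ?p) (?Y c ?p) = - V * ginner ?n (g0 c ?p) (X c ?p) (X c ?p)"
      "ginner ?n (g0 c ?p) (?Y c ?p) (?Y c ?p) = V\<^sup>2 * ginner ?n (g0 c ?p) (X c ?p) (X c ?p)"
      unfolding ginner_def sum_distrib_left V_def by (intro sum.cong refl, simp add: power2_eq_square)+
    then show "ginner ?n (g0 c ?p) (X c ?p) (?Y c ?p) = 0" "ginner ?n (g0 c ?p) (?Y c ?p) (?Y c ?p) = 0"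
      by (simp_all add: XX)
  qed
  have Tij: "T i j = - V * (\<Sum>l<?n. X c ?p l * first_kind dg l i j) - dv i * ?x j" if "i < ?n" "j < ?n" for i j
  proof -
    have "T i j = - V * dflat ?n (g0 c ?p) dg (X c ?p) dX i j - dv i * ?x j"
      unfolding T_def dflat_def flat_def V_def
      by (simp add: sum_distrib_left sum.distrib sum_subtractf sum_negf algebra_simps)
    then show ?thesis using dflat_parallel[OF X par that] by simp
  qed
  have Ksym: "first_kind dg l i j = first_kind dg l j i" if "i < ?n" "j < ?n" "l < ?n" for i j l
    using dg_sym[of l i j] that by (simp add: first_kind_def)
  have Xdv: "X c ?p i * dv i = 0" for i
    using Xk[of i] dv[of i] by (cases "1 \<le> i \<and> i < 5") auto
  have xX: "(\<Sum>i<?n. X c ?p i * ?x i) = 0"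
    using XX by (simp add: ginner_def flat_def sum_distrib_left mult_ac)
  have TX: "(\<Sum>i<?n. X c ?p i * (T i l - T l i)) = 0" if l: "l < ?n" for l
  proof -
    have "X c ?p i * (T i l - T l i) = dv l * (X c ?p i * ?x i)" if i: "i < ?n" for i
    proof -
      have "(\<Sum>m<?n. X c ?p m * first_kind dg m i l) = (\<Sum>m<?n. X c ?p m * first_kind dg m l i)"
        using i l by (intro sum.cong refl) (simp add: Ksym[of i l])
      then have "X c ?p i * (T i l - T l i) = dv l * (X c ?p i * ?x i) - (X c ?p i * dv i) * ?x l"
        using i l by (simp add: Tij algebra_simps)
      then show ?thesis by (simp add: Xdv)
    qed
    then have "(\<Sum>i<?n. X c ?p i * (T i l - T l i)) = (\<Sum>i<?n. dv l * (X c ?p i * ?x i))"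
      by (intro sum.cong) auto
    then show ?thesis by (simp add: xX flip: sum_distrib_left)
  qed
  have Pij: "P i j = H i j + 2 * V * X c ?p i * X c ?p j" for i j
    unfolding P_def YY by (simp add: V_def)
  have "P i j * (T i j - (\<Sum>l<?n. ?Y c ?p l * first_kind dg l i j)) = 0" if ij: "i < ?n" "j < ?n" for i j
  proof -
    have "T i j - (\<Sum>l<?n. ?Y c ?p l * first_kind dg l i j) = - dv i * ?x j"
      using ij by (simp add: Tij V_def sum_distrib_left sum_negf mult.assoc)
    \<comment> \<open>For \<open>i\<close> from 1 to 3 the row of \<open>P\<close> is diagonal and
      \<open>?x\<close> vanishes at \<open>i\<close>; for every other \<open>i\<close> the
      derivative \<open>dv i\<close> is 0.\<close>
    moreover have "P i j * (dv i * ?x j) = 0"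
    proof (cases "1 \<le> i \<and> i < 4")
      case True
      then have "P i j = (if i = j then eps5 i else 0)" using ij by (simp add: Pij Xk H_low)
      then show ?thesis using True by (simp add: flat_low Xk)
    qed (use dv[of i] in auto)
    ultimately show ?thesis by simp
  qed
  then have tr: "(\<Sum>i<?n. \<Sum>j<?n. P i j * (T i j - (\<Sum>l<?n. ?Y c ?p l * first_kind dg l i j))) = 0"
    by (intro sum.neutral ballI) auto
  have "box_op C (em_potential C g0 ?Y X) f ?p = - (\<Sum>i<5. \<Sum>j<5. P i j * cderiv C c i (cderiv C c j f) ?p)"
    using box_base_function[where X = X and Y = ?Y and dX = dX and dY = ?dY and T = T and P = P and f = f,
        OF chart_at X Y par XX XY T_def TX P_def cderiv_f_high cderiv2_f_high]
    unfolding tr by simp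
  then show ?thesis
    unfolding em by (simp add: sum_lessThan_5 Pij H_diag eps5_def X0 Xk cd2 algebra_simps)
qed

text \<open>The field \<open>lift_base Y\<close> lives on the coordinates 0 to 3 and
  \<open>X\<close> on the others, so contractions of \<open>X\<close> with \<open>T\<close> are
  empty and the trace is the divergence of \<open>Y\<close>. In the inverse metric the new entries
  \<open>Y x j\<close> at \<open>(j, 4)\<close> and \<open>(4, j)\<close> couple \<open>A\<close> to
  \<open>B\<close>, and \<open>N\<close> at \<open>(4, 4)\<close> adds the quadratic term.\<close>

lemma box_electromagnetic:
  assumes X: "\<And>i k. i < mdim C \<Longrightarrow> k < mdim C \<Longrightarrow> has_cderiv C c i (\<lambda>q. X c q k) (x, s, w) (dX i k)"
    and par: "parallel C g0 X"
    and XX: "ginner (mdim C) (g0 c (x, s, w)) (X c (x, s, w)) (X c (x, s, w)) = 0"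
    and XY: "ginner (mdim C) (g0 c (x, s, w)) (X c (x, s, w)) (lift_base Y c (x, s, w)) = 0"
    and X4: "X c (x, s, w) 4 = - 1" and Xk: "\<And>k. k < 4 \<Longrightarrow> X c (x, s, w) k = 0"
    and Y: "\<And>i k. i < 4 \<Longrightarrow> k < 4 \<Longrightarrow> has_pd i (\<lambda>y. Y y k) x (Y1 i k)"
  defines "N \<equiv> - (Y x 0)\<^sup>2 + (Y x 1)\<^sup>2 + (Y x 2)\<^sup>2 + (Y x 3)\<^sup>2" and "dvg \<equiv> (\<Sum>i<4. Y1 i i)"
  shows "box_op C (em_potential C g0 (lift_base Y) X) f (x, s, w) =
    (A2 0 0 x - A2 1 1 x - A2 2 2 x - A2 3 3 x - 2 * \<kappa> * (\<Sum>j<4. Y x j * B1 j x) + \<kappa>\<^sup>2 * (N - 1) * A x - \<kappa> * dvg * B x) * cs +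
    (B2 0 0 x - B2 1 1 x - B2 2 2 x - B2 3 3 x + 2 * \<kappa> * (\<Sum>j<4. Y x j * A1 j x) + \<kappa>\<^sup>2 * (N - 1) * B x + \<kappa> * dvg * A x) * sn"
    (is "box_op _ (em_potential _ _ ?Y _) _ _ = _")
proof -
  let ?p = "(x, s, w)" and ?n = "mdim C"
  let ?dY = "\<lambda>i k. if i < 4 \<and> k < 4 then Y1 i k else 0"
  define T where "T = dflat ?n (g0 c ?p) dg (?Y c ?p) ?dY"
  define P where "P = (\<lambda>i j. H i j - ?Y c ?p i * X c ?p j - X c ?p i * ?Y c ?p j
      + ginner ?n (g0 c ?p) (?Y c ?p) (?Y c ?p) * X c ?p i * X c ?p j)"
  have Yp: "?Y c ?p k = (if k < 4 then Y x k else 0)" for k by (simp add: lift_base_def)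
  have dY: "has_cderiv C c i (\<lambda>q. ?Y c q k) ?p (?dY i k)" if "i < ?n" "k < ?n" for i k
  proof (cases "k < 4")
    case True
    have "has_cderiv C c i (\<lambda>q. Y (fst q) k) ?p (if i < 4 then Y1 i k else 0)"
      by (rule has_cderiv_base[OF d p that(1), where f = "\<lambda>y. Y y k"]) (use Y True in auto)
    moreover have "(\<lambda>q. Y (fst q) k) = (\<lambda>q. ?Y c q k)" using True by (auto simp: lift_base_def fun_eq_iff)
    ultimately show ?thesis using True by simp
  next
    case False
    then have "(\<lambda>q. ?Y c q k) = (\<lambda>_. 0)" by (auto simp: lift_base_def fun_eq_iff)
    then show ?thesis using False has_cderiv_const[of C c i 0 ?p] by simp
  qed
  have Tij: "T i j = (if i < 4 \<and> j < 4 then eps5 j * Y1 i j else 0)" if "i < ?n" "j < ?n" for i j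
  proof -
    have "g0 c ?p j k * ?dY i k + dg i j k * ?Y c ?p k = (if j = k then 1 else 0) * (if i < 4 \<and> j < 4 then eps5 j * Y1 i j else 0)" for k
      by (cases "k < 4") (auto simp: g0_low Yp dg_def)
    then show ?thesis using that(2) by (simp add: T_def dflat_def sum_delta_mult cong: if_cong)
  qed
  have TX: "(\<Sum>i<?n. X c ?p i * (T i l - T l i)) = 0" if l: "l < ?n" for l
    by (rule sum.neutral) (use l Xk in \<open>auto simp: Tij\<close>)
  have YK: "(\<Sum>l<?n. ?Y c ?p l * first_kind dg l i j) = 0" for i j
    by (rule sum.neutral) (auto simp: Yp K_low)
  have N: "ginner ?n (g0 c ?p) (?Y c ?p) (?Y c ?p) = N"
  proof -
    have "(\<Sum>j<?n. g0 c ?p i j * ?Y c ?p i * ?Y c ?p j) = (if i < 4 then eps5 i * (Y x i)\<^sup>2 else 0)" if i: "i < ?n" for i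
    proof -
      have "g0 c ?p i j * ?Y c ?p i * ?Y c ?p j = (if i = j then 1 else 0) * (if i < 4 then eps5 i * (Y x i)\<^sup>2 else 0)" for j
        by (cases "i < 4") (auto simp: g0_low Yp power2_eq_square)
      then show ?thesis using i by (simp add: sum_delta_mult cong: if_cong)
    qed
    then have "ginner ?n (g0 c ?p) (?Y c ?p) (?Y c ?p) = (\<Sum>i<?n. if i < 4 then eps5 i * (Y x i)\<^sup>2 else 0)"
      by (simp add: ginner_def)
    also have "\<dots> = (\<Sum>i<5. if i < 4 then eps5 i * (Y x i)\<^sup>2 else 0)" by (rule sum_low) simp
    finally show ?thesis by (simp add: N_def sum_lessThan_5 eps5_def)
  qed
  have Pij: "P i j = H i j - ?Y c ?p i * X c ?p j - X c ?p i * ?Y c ?p j + N * X c ?p i * X c ?p j" for i j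
    unfolding P_def N ..
  \<comment> \<open>The two factors \<open>eps5 i\<close>, one from lowering \<open>Y\<close> and
    one from \<open>H\<close>, multiply to 1.\<close>
  have "P i j * T i j = (if i = j then 1 else 0) * (if i < 4 then Y1 i i else 0)" if "i < ?n" "j < ?n" for i j
    using that by (auto simp: Tij Pij Xk H_low eps5_def)
  then have "(\<Sum>i<?n. \<Sum>j<?n. P i j * T i j) = (\<Sum>i<?n. if i < 4 then Y1 i i else 0)"
    by (intro sum.cong refl) (simp add: sum_delta_mult cong: if_cong)
  also have "\<dots> = (\<Sum>i<5. if i < 4 then Y1 i i else 0)" by (rule sum_low) simp
  finally have tr: "(\<Sum>i<?n. \<Sum>j<?n. P i j * (T i j - (\<Sum>l<?n. ?Y c ?p l * first_kind dg l i j))) = dvg"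
    by (simp add: YK dvg_def sum_lessThan_5 sum_lessThan_4)
  have "box_op C (em_potential C g0 ?Y X) f ?p = - (\<Sum>i<5. \<Sum>j<5. P i j * cderiv C c i (cderiv C c j f) ?p)
     + (\<Sum>k<5. X c ?p k * cderiv C c k f ?p) * dvg"
    using box_base_function[where X = X and Y = ?Y and dX = dX and dY = ?dY and T = T and P = P and f = f,
        OF chart_at X dY par XX XY T_def TX P_def cderiv_f_high cderiv2_f_high]
    unfolding tr by simp
  then show ?thesis
    by (simp add: sum_lessThan_5 sum_lessThan_4 Pij Yp H_diag eps5_def X4 Xk cd2 cderiv_f_point algebra_simps)
qed

end

section \<open>The wave equation of an oscillating metric\<close>

lemma circle_pt_cases:
  assumes "circle_pt \<delta> u = circle_pt \<delta> v"
  obtains k :: int where "v = u + 2 * pi * \<delta> * of_int k"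
proof -
  have "v \<in> circle_pt \<delta> v" by (auto simp: circle_pt_eq intro: exI[of _ 0])
  then have "v \<in> circle_pt \<delta> u" by (simp only: assms)
  then show ?thesis using that by (auto simp: circle_pt_eq)
qed

text \<open>A nonzero eigenfunction has period \<open>2 * pi * \<delta>\<close>, which forces
  \<open>sqrt lam * \<delta>\<close> to be an integer. This allows points of the circle to be read
  in any chart.\<close>

lemma laplace_eigenvalue_circle_periodic:
  assumes \<delta>: "\<delta> > 0" and lam: "lam \<ge> 0" "laplace_eigenvalue (circle_mfd \<delta>) circle_metric lam"
    and uv: "circle_pt \<delta> u = circle_pt \<delta> v"
  shows "cos (sqrt lam * u) = cos (sqrt lam * v) \<and> sin (sqrt lam * u) = sin (sqrt lam * v)"
proof -
  let ?\<kappa> = "sqrt lam" and ?T = "2 * pi * \<delta>"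
  obtain f s where f: "f \<in> eigenspace (circle_mfd \<delta>) circle_metric lam" "s \<in> pts (circle_mfd \<delta>)" "f s \<noteq> 0"
    using lam(2) unfolding laplace_eigenvalue_def by blast
  obtain a b where ab: "\<And>u. f (circle_pt \<delta> u) = a * cos (?\<kappa> * u) + b * sin (?\<kappa> * u)"
    using eigenspace_circle_fourier[OF \<delta> lam(1) f(1)] by blast
  have nz: "a \<noteq> 0 \<or> b \<noteq> 0" using f(2,3) ab by (auto simp: pts_circle)
  have per: "f (circle_pt \<delta> (u + ?T)) = f (circle_pt \<delta> u)" for u
    using circle_pt_shift[of \<delta> u 1] by simp
  have cT: "cos (?\<kappa> * ?T) = 1"
  proof (cases "?\<kappa> = 0")
    case False
    let ?c = "cos (?\<kappa> * ?T)" and ?s = "sin (?\<kappa> * ?T)"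
    have 1: "a * (?c - 1) + b * ?s = 0" using per[of 0] by (simp add: ab algebra_simps)
    \<comment> \<open>A quarter turn exchanges the roles of cosine and sine; together with the
      equation at 0 it eliminates \<open>?s\<close>.\<close>
    obtain u0 where u0: "?\<kappa> * u0 = pi / 2" using False by (metis nonzero_mult_div_cancel_left times_divide_eq_right)
    have 2: "b * (?c - 1) - a * ?s = 0"
      using per[of u0] unfolding ab distrib_left[of ?\<kappa>] u0 by (simp add: cos_add sin_add algebra_simps)
    have "(a\<^sup>2 + b\<^sup>2) * (?c - 1) = a * (a * (?c - 1) + b * ?s) + b * (b * (?c - 1) - a * ?s)"
      by (simp add: algebra_simps power2_eq_square)
    then have "(a\<^sup>2 + b\<^sup>2) * (?c - 1) = 0" unfolding 1 2 by simp
    then show ?thesis using nz by (auto simp: sum_power2_eq_zero_iff)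
  qed simp
  then obtain m :: int where m: "?\<kappa> * ?T = of_int m * (2 * pi)" using cos_one_2pi_int by (auto simp: mult_ac)
  obtain k :: int where k: "v = u + ?T * of_int k" using circle_pt_cases[OF uv] by blast
  have "?\<kappa> * v = ?\<kappa> * u + 2 * pi * of_int (m * k)"
    using arg_cong[OF m, of "\<lambda>z. z * of_int k"] by (simp add: k algebra_simps)
  then show ?thesis
    using sin_cos_eq_iff[of "?\<kappa> * v" "?\<kappa> * u"] by metis
qed

lemma has_pd_slice:
  assumes \<Theta>: "axis_open 4 \<Theta>" "\<Theta> \<subseteq> topspace (Euclidean_space 4)" and \<delta>: "\<delta> > 0"
    and y: "y \<in> \<Theta>" and i: "i < 4" and r: "r < u" "u < r + 2 * pi * \<delta>"
    and F: "has_cderiv (product_mfd (euclid_mfd 4 \<Theta>) (circle_mfd \<delta>)) ((), r) i F (y, circle_pt \<delta> u) D"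
  shows "has_pd i (\<lambda>y. F (y, circle_pt \<delta> u)) y D"
proof -
  let ?P = "product_mfd (euclid_mfd 4 \<Theta>) (circle_mfd \<delta>)" and ?s = "circle_pt \<delta> u"
  let ?ext = "\<lambda>z. chart ?P ((), r) (z, ?s)"
  have ok: "chart_ok ?P ((), r)" by (intro chart_ok_product chart_ok_euclid chart_ok_circle \<Theta> \<delta>)
  have par: "param ?P ((), r) (?ext z) = (z, ?s)" if "z \<in> \<Theta>" for z
    by (rule param_chart[OF ok]) (use that r in auto)
  have "has_pd i (\<lambda>z. F (param ?P ((), r) (?ext z))) y D"
  proof -
    have "?ext (y(i := t)) = (?ext y)(i := t)" for t using i by (auto simp: fun_eq_iff)
    moreover have "?ext y i = y i" using i by simp
    ultimately show ?thesis using F by (simp only: has_cderiv_def has_pd_def)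
  qed
  then show ?thesis by (rule has_pd_cong[OF _ \<Theta>(1) y i]) (simp add: par del: product_mfd_simps)
qed

text \<open>Supplies the regularity of the Fourier coefficients, which are values of \<phi> at fixed
  points of the circle.\<close>

lemma smooth_function_slice:
  assumes \<Theta>: "axis_open 4 \<Theta>" "\<Theta> \<subseteq> topspace (Euclidean_space 4)" and \<delta>: "\<delta> > 0"
    and F: "smooth_function (product_mfd (euclid_mfd 4 \<Theta>) (circle_mfd \<delta>)) F"
    and A: "A = (\<lambda>y. F (y, circle_pt \<delta> u))"
    and y: "y \<in> \<Theta>" and i: "i < 4" and j: "j < 4"
  shows "has_pd i A y (pd i A y)" and "has_pd i (pd j A) y (pd i (pd j A) y)"
proof -
  let ?P = "product_mfd (euclid_mfd 4 \<Theta>) (circle_mfd \<delta>)" and ?s = "circle_pt \<delta> u"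
  define r where "r = u - pi * \<delta>"
  have r: "r < u" "u < r + 2 * pi * \<delta>" using \<delta> by (auto simp: r_def)
  have ok: "chart_ok ?P ((), r)" by (intro chart_ok_product chart_ok_euclid chart_ok_circle \<Theta> \<delta>)
  have sm: "smooth_in_chart ?P ((), r) F" using F by (simp add: smooth_function_def)
  have dom: "(z, ?s) \<in> chart_dom ?P ((), r)" if "z \<in> \<Theta>" for z using that r by auto
  have 1: "has_pd k A z (cderiv ?P ((), r) k F (z, ?s))" if "z \<in> \<Theta>" "k < 4" for z k
    unfolding A by (rule has_pd_slice[OF \<Theta> \<delta> that r smooth_in_chart_has_cderiv[OF sm dom]]) (use that in auto)
  then show "has_pd i A y (pd i A y)" using y i has_pd_imp_pd by metis
  have "has_pd i (\<lambda>z. cderiv ?P ((), r) j F (z, ?s)) y (cderiv ?P ((), r) i (cderiv ?P ((), r) j F) (y, ?s))"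
    by (rule has_pd_slice[OF \<Theta> \<delta> y i r smooth_in_chart_has_cderiv2[OF sm dom _ _ ok]]) (use y i j in auto)
  then have "has_pd i (pd j A) y (cderiv ?P ((), r) i (cderiv ?P ((), r) j F) (y, ?s))"
    by (rule has_pd_cong[OF _ \<Theta>(1) y i]) (use has_pd_imp_pd[OF 1] j in auto)
  then show "has_pd i (pd j A) y (pd i (pd j A) y)" using has_pd_imp_pd by metis
qed

text \<open>\<open>w\<close> is a point where \<beta> can be divided out. \<open>B_0\<close>
  normalises the sine coefficient, which \<phi> does not determine when \<open>lam = 0\<close>; in
  that case comparing coefficients would say nothing about \<open>B\<close>.\<close>

locale oscillating = spacetime_factors \<Theta> \<delta> W gW
  for \<Theta> \<delta> and W :: "('w, 'c) mfd" and gW +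
  fixes gP :: "('w pt, 'c lab) bilin_field" and \<mu> lam M :: real
    and \<phi> :: "(nat \<Rightarrow> real) \<times> real set \<Rightarrow> real" and \<beta> :: "'w \<Rightarrow> real" and w :: 'w
    and A B :: "(nat \<Rightarrow> real) \<Rightarrow> real" and A1 B1 :: "nat \<Rightarrow> (nat \<Rightarrow> real) \<Rightarrow> real"
    and A2 B2 :: "nat \<Rightarrow> nat \<Rightarrow> (nat \<Rightarrow> real) \<Rightarrow> real"
  assumes osc: "elementary_oscillating \<Theta> \<delta> W gW gP \<mu> lam \<phi> \<beta>"
    and w: "w \<in> pts W" "\<beta> w \<noteq> 0"
    and mass: "mass_frequency \<Theta> \<delta> W gW \<mu> lam M"
    and \<phi>: "\<And>y u. y \<in> \<Theta> \<Longrightarrow> \<phi> (y, circle_pt \<delta> u) = A y * cos (sqrt lam * u) + B y * sin (sqrt lam * u)"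
    and A1: "\<And>y i. y \<in> \<Theta> \<Longrightarrow> i < 4 \<Longrightarrow> has_pd i A y (A1 i y)"
    and B1: "\<And>y i. y \<in> \<Theta> \<Longrightarrow> i < 4 \<Longrightarrow> has_pd i B y (B1 i y)"
    and A2: "\<And>y i j. y \<in> \<Theta> \<Longrightarrow> i < 4 \<Longrightarrow> j < 4 \<Longrightarrow> has_pd i (A1 j) y (A2 i j y)"
    and B2: "\<And>y i j. y \<in> \<Theta> \<Longrightarrow> i < 4 \<Longrightarrow> j < 4 \<Longrightarrow> has_pd i (B1 j) y (B2 i j y)"
    and B_0: "\<And>y i j. lam = 0 \<Longrightarrow> B y = 0 \<and> B1 i y = 0 \<and> B2 i j y = 0"
begin

lemma lam_nonneg: "lam \<ge> 0"
  using osc by (simp add: elementary_oscillating_def)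

text \<open>The mass condition enters in the form that \<open>S_term\<close> plus \<mu> equals
  \<open>M\<^sup>2 + lam\<close>.\<close>

lemma wave_equation:
  assumes x: "x \<in> \<Theta>"
  shows "box_op C gP (on_base_circle \<phi>) (x, circle_pt \<delta> u, w) + (M\<^sup>2 + lam) * \<phi> (x, circle_pt \<delta> u) = 0"
proof -
  let ?p = "(x, circle_pt \<delta> u, w)"
  have p: "?p \<in> pts C" using x w(1) by (simp add: pts_C)
  have "box_op C gP (\<lambda>q. on_base_circle \<phi> q * on_W \<beta> q) ?p = (box_op C gP (on_base_circle \<phi>) ?p + \<mu> * on_base_circle \<phi> ?p) * on_W \<beta> ?p"
    using osc p unfolding elementary_oscillating_def neutral_on_eigenspace_def by blast
  moreover have "box_op C gP (\<lambda>q. on_base_circle \<phi> q * on_W \<beta> q) ?p + S_term C g0 ?p * (on_base_circle \<phi> ?p * on_W \<beta> ?p) = 0"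
    using osc p unfolding elementary_oscillating_def by blast
  ultimately have "(box_op C gP (on_base_circle \<phi>) ?p + (S_term C g0 ?p + \<mu>) * \<phi> (x, circle_pt \<delta> u)) * \<beta> w = 0"
    by (simp add: on_base_circle_def on_W_def algebra_simps)
  moreover have "S_term C g0 ?p + \<mu> = M\<^sup>2 + lam"
    using mass p unfolding mass_frequency_def by fastforce
  ultimately show ?thesis using w(2) by simp
qed

text \<open>The chart is dictated by \<open>box_op\<close>, so its circle coordinate need not be
  \<open>u\<close>. It differs from \<open>u\<close> by periods, and the trigonometric values are
  the same.\<close>

lemma mode_point_exists:
  assumes x: "x \<in> \<Theta>"
  obtains r d H where "mode_point \<Theta> \<delta> W gW x (circle_pt \<delta> u) w r d H \<phi> (sqrt lam) A B A1 B1 A2 B2"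
    and "cos (sqrt lam * chart C ((), r, d) (x, circle_pt \<delta> u, w) 4) = cos (sqrt lam * u)"
    and "sin (sqrt lam * chart C ((), r, d) (x, circle_pt \<delta> u, w) 4) = sin (sqrt lam * u)"
proof -
  let ?p = "(x, circle_pt \<delta> u, w)"
  obtain d0 where d0: "d0 \<in> charts W" "w \<in> chart_dom W d0"
    using W w(1) unfolding smooth_manifold_def by blast
  have "?p \<in> chart_dom C ((), u - pi * \<delta>, d0)"
    using x d0 \<delta> by (auto simp: chart_dom_C)
  then have ex: "\<exists>c\<in>charts C. ?p \<in> chart_dom C c" using d0 by (auto simp: charts_C)
  obtain r d where c: "((), r, d) = chart_at C ?p" by (metis surj_pair unit.exhaust)
  have d: "d \<in> charts W" and p: "?p \<in> chart_dom C ((), r, d)"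
    using chart_at_in[OF ex] unfolding c[symmetric] by (auto simp: charts_C)
  obtain H where H: "\<And>i j. i < mdim C \<Longrightarrow> j < mdim C \<Longrightarrow> (\<Sum>k<mdim C. g0 ((), r, d) ?p i k * H k j) = (if i = j then 1 else 0)"
    "\<And>i j. i < mdim C \<Longrightarrow> j < mdim C \<Longrightarrow> H i j = H j i"
    using g0_inverse_exists[OF d p] by blast
  have mp: "mode_point \<Theta> \<delta> W gW x (circle_pt \<delta> u) w r d H \<phi> (sqrt lam) A B A1 B1 A2 B2"
    by unfold_locales (use d p H c \<phi> A1 A2 B1 B2 in auto)
  obtain v where v: "r < v" "v < r + 2 * pi * \<delta>" "circle_pt \<delta> u = circle_pt \<delta> v"
    using p by (auto simp: chart_dom_C)
  have "chart C ((), r, d) ?p 4 = v" using chart_C_4[OF _ v(1,2)] p by (simp add: v(3))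
  moreover have "cos (sqrt lam * v) = cos (sqrt lam * u) \<and> sin (sqrt lam * v) = sin (sqrt lam * u)"
    by (rule laplace_eigenvalue_circle_periodic[OF \<delta> lam_nonneg]) (use osc v(3) in \<open>auto simp: elementary_oscillating_def\<close>)
  ultimately show ?thesis using that[OF mp] by simp
qed

text \<open>Tested at \<open>u = 0\<close> and at a quarter turn. For \<open>lam = 0\<close> the
  sine vanishes identically, and the second premise supplies \<open>b = 0\<close>.\<close>

lemma fourier_coefficients_0:
  assumes "\<And>u. a * cos (sqrt lam * u) + b * sin (sqrt lam * u) = 0" and "lam = 0 \<Longrightarrow> b = 0"
  shows "a = 0" "b = 0"
proof -
  show "a = 0" using assms(1)[of 0] by simp
  show "b = 0"
  proof (cases "lam = 0")
    case False
    then have "sqrt lam \<noteq> 0" by simp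
    then obtain u0 where u0: "sqrt lam * u0 = pi / 2" by (metis nonzero_mult_div_cancel_left times_divide_eq_right)
    then show ?thesis using assms(1)[of u0] unfolding u0 by simp
  qed (rule assms(2))
qed

lemma ginner_unit_vec:
  assumes "k < 5" "d \<in> charts W"
  shows "ginner (mdim C) (g0 ((), r, d) (x, s, w')) Z (unit_vec_field k) = eps5 k * Z k"
proof -
  have "(\<Sum>j<mdim C. g0 ((), r, d) (x, s, w') i j * Z i * unit_vec_field k j) = (if i = k then 1 else 0) * (eps5 k * Z k)" for i
  proof -
    have "(\<Sum>j<mdim C. g0 ((), r, d) (x, s, w') i j * Z i * unit_vec_field k j) =
        (\<Sum>j<mdim C. g0 ((), r, d) (x, s, w') i j * Z i * (if j = k then 1 else 0))"
      by (simp add: unit_vec_field_def)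
    also have "\<dots> = g0 ((), r, d) (x, s, w') i k * Z i" using assms(1) by (simp add: sum_delta_mult mdim_C)
    finally show ?thesis using assms(1) by (simp add: g0_low)
  qed
  then show ?thesis using assms(1) by (simp add: ginner_def sum_delta_mult mdim_C)
qed

lemma neutral_wave:
  assumes x: "x \<in> \<Theta>" and gP: "gP = g0"
  shows "A2 0 0 x - A2 1 1 x - A2 2 2 x - A2 3 3 x + M\<^sup>2 * A x = 0"
    and "B2 0 0 x - B2 1 1 x - B2 2 2 x - B2 3 3 x + M\<^sup>2 * B x = 0"
proof -
  have "(A2 0 0 x - A2 1 1 x - A2 2 2 x - A2 3 3 x + M\<^sup>2 * A x) * cos (sqrt lam * u) +
    (B2 0 0 x - B2 1 1 x - B2 2 2 x - B2 3 3 x + M\<^sup>2 * B x) * sin (sqrt lam * u) = 0" for u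
  proof -
    obtain r d H where mp: "mode_point \<Theta> \<delta> W gW x (circle_pt \<delta> u) w r d H \<phi> (sqrt lam) A B A1 B1 A2 B2"
      and cs: "cos (sqrt lam * chart C ((), r, d) (x, circle_pt \<delta> u, w) 4) = cos (sqrt lam * u)"
        "sin (sqrt lam * chart C ((), r, d) (x, circle_pt \<delta> u, w) 4) = sin (sqrt lam * u)"
      using mode_point_exists[OF x] by blast
    interpret mp: mode_point \<Theta> \<delta> W gW x "circle_pt \<delta> u" w r d H \<phi> "sqrt lam" A B A1 B1 A2 B2 by (rule mp)
    show ?thesis
      using wave_equation[OF x, of u] lam_nonneg unfolding gP mp.box_neutral cs \<phi>[OF x] by (simp add: algebra_simps)
  qed
  note fourier_coefficients_0[OF this]
  then show "A2 0 0 x - A2 1 1 x - A2 2 2 x - A2 3 3 x + M\<^sup>2 * A x = 0"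
    "B2 0 0 x - B2 1 1 x - B2 2 2 x - B2 3 3 x + M\<^sup>2 * B x = 0"
    using B_0 by auto
qed

lemma gravity_wave:
  assumes x: "x \<in> \<Theta>"
    and I: "\<Theta> = {x \<in> topspace (Euclidean_space 4). x 0 \<in> I \<and> (\<lambda>k. x (Suc k)) \<in> U}"
    and gP: "gP = gravity_potential C g0 (on_space v) (lift_time_W X1)"
    and X0: "inner_coord_eq C g0 (lift_time_W X1) 0 1"
    and XX: "inner_eq C g0 (lift_time_W X1) (lift_time_W X1) 0"
    and v: "smooth_fun 3 U v" and X1: "vector_field (time_W_mfd I W) X1"
    and par: "parallel C g0 (lift_time_W X1)"
  defines "V \<equiv> v (\<lambda>k. x (Suc k))"
  shows "(1 - 2 * V) * A2 0 0 x - A2 1 1 x - A2 2 2 x - A2 3 3 x + M\<^sup>2 * A x = 0"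
    and "(1 - 2 * V) * B2 0 0 x - B2 1 1 x - B2 2 2 x - B2 3 3 x + M\<^sup>2 * B x = 0"
proof -
  let ?N = "time_W_mfd I W"
  \<comment> \<open>Openness of \<open>I\<close> is read off from \<Theta> by freezing the spatial
    coordinates of \<open>x\<close>.\<close>
  have T: "axis_open 1 (time_pt ` I)" "time_pt ` I \<subseteq> topspace (Euclidean_space 1)"
  proof -
    show "time_pt ` I \<subseteq> topspace (Euclidean_space 1)" by (auto simp: topspace_Euclidean_space time_pt_def)
    have "\<forall>\<^sub>F t' in nhds t. (time_pt t)(0 := t') \<in> time_pt ` I" if t: "t \<in> I" for t
    proof -
      have y: "x(0 := t) \<in> \<Theta>" using x t unfolding I by (auto simp: topspace_Euclidean_space)
      have "\<forall>\<^sub>F t' in nhds t. (x(0 := t))(0 := t') \<in> \<Theta>"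
        using axis_openD[OF \<Theta>(1) y, of 0] by simp
      then have "\<forall>\<^sub>F t' in nhds t. t' \<in> I" by (rule eventually_mono) (auto simp: I)
      then show ?thesis
      proof (rule eventually_mono)
        fix t' assume "t' \<in> I"
        moreover have "(time_pt t)(0 := t') = time_pt t'" by (auto simp: time_pt_def fun_eq_iff)
        ultimately show "(time_pt t)(0 := t') \<in> time_pt ` I" by simp
      qed
    qed
    then show "axis_open 1 (time_pt ` I)" by (auto simp: axis_open_def time_pt_def[of _ 0])
  qed
  have "((1 - 2 * V) * A2 0 0 x - A2 1 1 x - A2 2 2 x - A2 3 3 x + M\<^sup>2 * A x) * cos (sqrt lam * u) +
    ((1 - 2 * V) * B2 0 0 x - B2 1 1 x - B2 2 2 x - B2 3 3 x + M\<^sup>2 * B x) * sin (sqrt lam * u) = 0" for u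
  proof -
    obtain r d H where mp: "mode_point \<Theta> \<delta> W gW x (circle_pt \<delta> u) w r d H \<phi> (sqrt lam) A B A1 B1 A2 B2"
      and cs: "cos (sqrt lam * chart C ((), r, d) (x, circle_pt \<delta> u, w) 4) = cos (sqrt lam * u)"
        "sin (sqrt lam * chart C ((), r, d) (x, circle_pt \<delta> u, w) 4) = sin (sqrt lam * u)"
      using mode_point_exists[OF x] by blast
    interpret mp: mode_point \<Theta> \<delta> W gW x "circle_pt \<delta> u" w r d H \<phi> "sqrt lam" A B A1 B1 A2 B2 by (rule mp)
    let ?p = "(x, circle_pt \<delta> u, w)" and ?c = "((), r, d)"
    have okN: "chart_ok ?N ((), d)"
      unfolding time_W_mfd_def by (intro chart_ok_product chart_ok_euclid T chart_ok_smooth_manifold W mp.d)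
    \<comment> \<open>\<open>h\<close> is the projection to time and \<open>W\<close>, and
      \<open>L\<close> is its coordinate form: a coordinate of \<open>W\<close> with index
      \<open>k\<close> on \<open>?N\<close> has index \<open>k + 4\<close> on the
      space-time.\<close>
    define h where "h q = (time_pt (fst q 0), snd (snd q))" for q :: "'w pt"
    define L where "L y k = (if k = 0 then y 0 else y (k + 4))" for y :: "nat \<Rightarrow> real" and k :: nat
    have hdom: "h q \<in> chart_dom ?N ((), d)" if "q \<in> chart_dom C ?c" for q
    proof -
      have "fst q \<in> \<Theta>" "snd (snd q) \<in> chart_dom W d" using that by (auto simp: chart_dom_C)
      moreover have "fst q 0 \<in> I" using \<open>fst q \<in> \<Theta>\<close> I by blast
      ultimately show ?thesis by (simp add: h_def time_W_mfd_def)
    qed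
    have hL: "chart ?N ((), d) (h q) = L (chart C ?c q)" if "q \<in> chart_dom C ?c" for q
    proof -
      obtain y t w' where q: "q = (y, t, w')" by (metis surj_pair)
      show ?thesis
        by (simp add: q h_def L_def time_W_mfd_def spacetime_def fibre_mfd_def time_pt_def fun_eq_iff)
    qed
    define k' where "k' k = (if k = 0 then 0 else k - 4)" for k :: nat
    \<comment> \<open>The existence of these derivatives suffices: parallelism expresses their
      values through Christoffel symbols.\<close>
    have "\<exists>D. has_cderiv C ?c i (\<lambda>q. lift_time_W X1 ?c q k) ?p D" if i: "i < mdim C" and k: "k < mdim C" for i k
    proof (cases "1 \<le> k \<and> k < 5")
      case True
      then have "(\<lambda>q. lift_time_W X1 ?c q k) = (\<lambda>_. 0)" by (auto simp: lift_time_W_def fun_eq_iff)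
      then show ?thesis using has_cderiv_const by metis
    next
      case False
      then have Xh: "(\<lambda>q. lift_time_W X1 ?c q k) = (\<lambda>q. X1 ((), d) (h q) (k' k))"
        by (auto simp: lift_time_W_def h_def k'_def fun_eq_iff)
      have "k' k < mdim ?N" using False k by (auto simp: k'_def mdim_C time_W_mfd_def)
      then have sm: "smooth_in_chart ?N ((), d) (\<lambda>z. X1 ((), d) z (k' k))"
        using X1 mp.d unfolding vector_field_def by (auto simp: time_W_mfd_def)
      show ?thesis
      proof (cases "1 \<le> i \<and> i < 5")
        case True
        have "has_cderiv C ?c i (\<lambda>q. X1 ((), d) (h q) (k' k)) ?p 0"
          by (rule has_cderiv_pullback_0[where L = L and h = h and N = ?N and d = "((), d)" and f = "\<lambda>z. X1 ((), d) z (k' k)",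
                OF mp.ok mp.p i okN hdom hL])
            (use True in \<open>auto simp: L_def fun_eq_iff\<close>)
        then show ?thesis unfolding Xh by blast
      next
        case False
        have i': "k' i < mdim ?N" using False i by (auto simp: k'_def mdim_C time_W_mfd_def)
        have "has_cderiv C ?c i (\<lambda>q. X1 ((), d) (h q) (k' k)) ?p (cderiv ?N ((), d) (k' i) (\<lambda>z. X1 ((), d) z (k' k)) (h ?p))"
          by (rule has_cderiv_pullback[where L = L and h = h and N = ?N and d = "((), d)" and i' = "k' i"
                and f = "\<lambda>z. X1 ((), d) z (k' k)", OF mp.ok mp.p i okN hdom hL _ _ smooth_in_chart_has_cderiv[OF sm hdom[OF mp.p] i']])
            (use False in \<open>auto simp: L_def k'_def fun_eq_iff\<close>)
        then show ?thesis unfolding Xh by blast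
      qed
    qed
    then obtain dX where dX: "\<And>i k. i < mdim C \<Longrightarrow> k < mdim C \<Longrightarrow> has_cderiv C ?c i (\<lambda>q. lift_time_W X1 ?c q k) ?p (dX i k)"
      by metis
    have cin: "?c \<in> charts C" using mp.d by (simp add: charts_C)
    have "ginner (mdim C) (g0 ?c ?p) (lift_time_W X1 ?c ?p) (unit_vec_field 0) = 1"
      using X0 cin mp.p unfolding inner_coord_eq_def by blast
    then have X_0: "lift_time_W X1 ?c ?p 0 = - 1"
      using ginner_unit_vec[of 0 d r x "circle_pt \<delta> u" w "lift_time_W X1 ?c ?p"] mp.d by (simp add: eps5_def)
    have X_k: "lift_time_W X1 ?c ?p k = 0" if "1 \<le> k" "k < 5" for k
      using that by (simp add: lift_time_W_def)
    have XX': "ginner (mdim C) (g0 ?c ?p) (lift_time_W X1 ?c ?p) (lift_time_W X1 ?c ?p) = 0"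
      using XX cin mp.p unfolding inner_eq_def by blast
    \<comment> \<open>Coordinate \<open>i\<close> of the space-time is coordinate
      \<open>i - 1\<close> of the space on which \<open>v\<close> is defined.\<close>
    define dv where "dv i = (if i = 0 \<or> 4 \<le> i then 0 else pd (i - 1) v (\<lambda>k. x (Suc k)))" for i
    have dv: "has_cderiv C ?c i (on_space v) ?p (dv i)" if i: "i < mdim C" for i
    proof -
      have "has_pd i (\<lambda>y. v (\<lambda>k. y (Suc k))) x (dv i)" if i4: "i < 4"
      proof (cases i)
        case 0
        then show ?thesis by (simp add: has_pd_def dv_def)
      next
        case (Suc j)
        have U: "(\<lambda>k. x (Suc k)) \<in> U" using x I by blast
        have "\<forall>y\<in>U. \<forall>i<3. (\<lambda>s. v (y(i := s))) differentiable (at (y i))"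
          using v[unfolded smooth_fun_def, THEN spec, of "[]"] by simp
        from bspec[OF this U] have "(\<lambda>t. v ((\<lambda>k. x (Suc k))(j := t))) differentiable (at (x (Suc j)))"
          using Suc i4 by simp
        then have "has_pd j v (\<lambda>k. x (Suc k)) (dv i)"
          using has_pd_pd[of v "\<lambda>k. x (Suc k)" j] Suc i4 by (simp add: dv_def)
        moreover have "(\<lambda>k. (x(Suc j := t)) (Suc k)) = (\<lambda>k. x (Suc k))(j := t)" for t by (auto simp: fun_eq_iff)
        ultimately show ?thesis unfolding Suc has_pd_def by simp
      qed
      from has_cderiv_base[OF mp.d mp.p i this]
      have "has_cderiv C ?c i (\<lambda>q. v (\<lambda>k. fst q (Suc k))) ?p (if i < 4 then dv i else 0)" .
      moreover have "(\<lambda>q. v (\<lambda>k. fst q (Suc k))) = (on_space v :: 'w pt \<Rightarrow> real)" by (auto simp: on_space_def fun_eq_iff)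
      moreover have "(if i < 4 then dv i else 0) = dv i" by (simp add: dv_def)
      ultimately show ?thesis by (simp only:)
    qed
    have vV: "on_space v ?p = V" by (simp add: on_space_def V_def)
    have dv0: "dv i = 0" if "i = 0 \<or> 4 \<le> i" for i using that by (auto simp: dv_def)
    note box = mp.box_gravity[OF dX par XX' X_0 X_k dv dv0, unfolded vV cs]
    show ?thesis
      using box wave_equation[OF x, of u] lam_nonneg unfolding gP \<phi>[OF x] by (simp add: algebra_simps)
  qed
  note fourier_coefficients_0[OF this]
  then show "(1 - 2 * V) * A2 0 0 x - A2 1 1 x - A2 2 2 x - A2 3 3 x + M\<^sup>2 * A x = 0"
    "(1 - 2 * V) * B2 0 0 x - B2 1 1 x - B2 2 2 x - B2 3 3 x + M\<^sup>2 * B x = 0"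
    using B_0 by auto
qed

text \<open>Here \<open>\<kappa>\<^sup>2 * (N - 1)\<close> and \<open>lam\<close> combine to
  \<open>lam * N\<close>. Unlike in the other cases the equations for \<open>A\<close> and
  \<open>B\<close> are coupled, through the terms linear in \<open>Y\<close>.\<close>

lemma electromagnetic_wave:
  assumes x: "x \<in> \<Theta>"
    and gP: "gP = em_potential C g0 (lift_base Y) (lift_fibre X2)"
    and X4: "inner_coord_eq C g0 (lift_fibre X2) 4 1"
    and XY: "inner_eq C g0 (lift_fibre X2) (lift_base Y) 0"
    and XX: "inner_eq C g0 (lift_fibre X2) (lift_fibre X2) 0"
    and Y: "\<And>i k. i < 4 \<Longrightarrow> k < 4 \<Longrightarrow> has_pd i (\<lambda>y. Y y k) x (Y1 i k)"
    and X2: "vector_field (fibre_mfd \<delta> W) X2"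
    and par: "parallel C g0 (lift_fibre X2)"
  defines "N \<equiv> - (Y x 0)\<^sup>2 + (Y x 1)\<^sup>2 + (Y x 2)\<^sup>2 + (Y x 3)\<^sup>2" and "dvg \<equiv> (\<Sum>i<4. Y1 i i)"
  shows "A2 0 0 x - A2 1 1 x - A2 2 2 x - A2 3 3 x - 2 * sqrt lam * (\<Sum>j<4. Y x j * B1 j x) + lam * N * A x
      - sqrt lam * dvg * B x + M\<^sup>2 * A x = 0"
    and "B2 0 0 x - B2 1 1 x - B2 2 2 x - B2 3 3 x + 2 * sqrt lam * (\<Sum>j<4. Y x j * A1 j x) + lam * N * B x
      + sqrt lam * dvg * A x + M\<^sup>2 * B x = 0"
proof -
  have "(A2 0 0 x - A2 1 1 x - A2 2 2 x - A2 3 3 x - 2 * sqrt lam * (\<Sum>j<4. Y x j * B1 j x) + lam * N * A x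
      - sqrt lam * dvg * B x + M\<^sup>2 * A x) * cos (sqrt lam * u) +
    (B2 0 0 x - B2 1 1 x - B2 2 2 x - B2 3 3 x + 2 * sqrt lam * (\<Sum>j<4. Y x j * A1 j x) + lam * N * B x
      + sqrt lam * dvg * A x + M\<^sup>2 * B x) * sin (sqrt lam * u) = 0" for u
  proof -
    obtain r d H where mp: "mode_point \<Theta> \<delta> W gW x (circle_pt \<delta> u) w r d H \<phi> (sqrt lam) A B A1 B1 A2 B2"
      and cs: "cos (sqrt lam * chart C ((), r, d) (x, circle_pt \<delta> u, w) 4) = cos (sqrt lam * u)"
        "sin (sqrt lam * chart C ((), r, d) (x, circle_pt \<delta> u, w) 4) = sin (sqrt lam * u)"
      using mode_point_exists[OF x] by blast
    interpret mp: mode_point \<Theta> \<delta> W gW x "circle_pt \<delta> u" w r d H \<phi> "sqrt lam" A B A1 B1 A2 B2 by (rule mp)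
    let ?p = "(x, circle_pt \<delta> u, w)" and ?c = "((), r, d)"
    have "\<exists>D. has_cderiv C ?c i (\<lambda>q. lift_fibre X2 ?c q k) ?p D" if i: "i < mdim C" and k: "k < mdim C" for i k
    proof (cases "k < 4")
      case True
      then have "(\<lambda>q. lift_fibre X2 ?c q k) = (\<lambda>_. 0)" by (auto simp: lift_fibre_def fun_eq_iff)
      then show ?thesis using has_cderiv_const by metis
    next
      case False
      then have Xh: "(\<lambda>q. lift_fibre X2 ?c q k) = (\<lambda>q. X2 (r, d) (snd q) (k - 4))"
        by (auto simp: lift_fibre_def fun_eq_iff)
      have sm: "smooth_in_chart (fibre_mfd \<delta> W) (r, d) (\<lambda>z. X2 (r, d) z (k - 4))"
        using X2 mp.d False k unfolding vector_field_def by (auto simp: mdim_C fibre_mfd_def)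
      have "has_cderiv C ?c i (\<lambda>q. X2 (r, d) (snd q) (k - 4)) ?p
          (if i < 4 then 0 else cderiv (fibre_mfd \<delta> W) (r, d) (i - 4) (\<lambda>z. X2 (r, d) z (k - 4)) (circle_pt \<delta> u, w))"
        by (rule has_cderiv_fibre[OF mp.d mp.p i, where f = "\<lambda>z. X2 (r, d) z (k - 4)"], rule smooth_in_chart_has_cderiv[OF sm])
          (use mp.p i in \<open>auto simp: chart_dom_C fibre_mfd_def mdim_C\<close>)
      then show ?thesis unfolding Xh by blast
    qed
    then obtain dX where dX: "\<And>i k. i < mdim C \<Longrightarrow> k < mdim C \<Longrightarrow> has_cderiv C ?c i (\<lambda>q. lift_fibre X2 ?c q k) ?p (dX i k)"
      by metis
    have cin: "?c \<in> charts C" using mp.d by (simp add: charts_C)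
    have "ginner (mdim C) (g0 ?c ?p) (lift_fibre X2 ?c ?p) (unit_vec_field 4) = 1"
      using X4 cin mp.p unfolding inner_coord_eq_def by blast
    then have X_4: "lift_fibre X2 ?c ?p 4 = - 1"
      using ginner_unit_vec[of 4 d r x "circle_pt \<delta> u" w "lift_fibre X2 ?c ?p"] mp.d by (simp add: eps5_def)
    have X_k: "lift_fibre X2 ?c ?p k = 0" if "k < 4" for k
      using that by (simp add: lift_fibre_def)
    have XX': "ginner (mdim C) (g0 ?c ?p) (lift_fibre X2 ?c ?p) (lift_fibre X2 ?c ?p) = 0"
      and XY': "ginner (mdim C) (g0 ?c ?p) (lift_fibre X2 ?c ?p) (lift_base Y ?c ?p) = 0"
      using XX XY cin mp.p unfolding inner_eq_def by blast+
    show ?thesis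
      using wave_equation[OF x, of u] lam_nonneg
        mp.box_electromagnetic[OF dX par XX' XY' X_4 X_k Y, folded N_def dvg_def] unfolding gP cs \<phi>[OF x]
      by (simp add: algebra_simps)
  qed
  note fourier_coefficients_0[OF this]
  then show "A2 0 0 x - A2 1 1 x - A2 2 2 x - A2 3 3 x - 2 * sqrt lam * (\<Sum>j<4. Y x j * B1 j x) + lam * N * A x
      - sqrt lam * dvg * B x + M\<^sup>2 * A x = 0"
    "B2 0 0 x - B2 1 1 x - B2 2 2 x - B2 3 3 x + 2 * sqrt lam * (\<Sum>j<4. Y x j * A1 j x) + lam * N * B x
      + sqrt lam * dvg * A x + M\<^sup>2 * B x = 0"
    using B_0 by auto
qed

end

section \<open>The state function\<close>

locale phase_shift =
  fixes \<Theta> :: "(nat \<Rightarrow> real) set" and M :: real and \<Psi> \<psi> :: "(nat \<Rightarrow> real) \<Rightarrow> complex"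
    and \<psi>1 :: "nat \<Rightarrow> (nat \<Rightarrow> real) \<Rightarrow> complex" and \<psi>2 :: "nat \<Rightarrow> nat \<Rightarrow> (nat \<Rightarrow> real) \<Rightarrow> complex"
  assumes \<Theta>: "axis_open 4 \<Theta>"
    and \<Psi>: "\<And>y. y \<in> \<Theta> \<Longrightarrow> \<Psi> y = exp (\<i> * of_real (M * y 0)) * \<psi> y"
    and \<psi>1: "\<And>y i. y \<in> \<Theta> \<Longrightarrow> i < 4 \<Longrightarrow> has_pd i \<psi> y (\<psi>1 i y)"
    and \<psi>2: "\<And>y i j. y \<in> \<Theta> \<Longrightarrow> i < 4 \<Longrightarrow> j < 4 \<Longrightarrow> has_pd i (\<psi>1 j) y (\<psi>2 i j y)"
begin

definition phase :: "(nat \<Rightarrow> real) \<Rightarrow> complex" where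
  "phase y = exp (\<i> * of_real (M * y 0))"

text \<open>The logarithmic derivative of \<open>phase\<close>: a derivative of \<Psi> acts on
  \<psi> as that derivative plus multiplication by \<open>\<tau> i\<close>.\<close>

definition \<tau> :: "nat \<Rightarrow> complex" where
  "\<tau> i = (if i = 0 then \<i> * of_real M else 0)"

lemma state_phase: "y \<in> \<Theta> \<Longrightarrow> \<Psi> y = phase y * \<psi> y"
  by (simp add: \<Psi> phase_def)

lemma has_pd_phase: "has_pd i phase y (\<tau> i * phase y)"
proof -
  have "((\<lambda>t. exp (\<i> * of_real (M * t))) has_vector_derivative \<i> * of_real M * exp (\<i> * of_real (M * t))) (at t)" for t
  proof -
    have "((\<lambda>z. exp (\<i> * of_real M * z)) has_field_derivative \<i> * of_real M * exp (\<i> * of_real M * of_real t)) (at (of_real t))"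
      by (auto intro!: derivative_eq_intros)
    from has_vector_derivative_real_field[OF this] show ?thesis by (simp add: mult.assoc)
  qed
  from has_pd_chain[OF has_pd_coordinate this, of i 0 y] show ?thesis
    by (cases "i = 0") (simp_all add: phase_def[abs_def] \<tau>_def)
qed

lemma has_pd_state: "y \<in> \<Theta> \<Longrightarrow> i < 4 \<Longrightarrow> has_pd i \<Psi> y (phase y * (\<tau> i * \<psi> y + \<psi>1 i y))"
  using has_pd_cong[OF has_pd_mult[OF has_pd_phase \<psi>1] \<Theta>, of y i \<Psi>]
  by (simp add: \<Psi> phase_def algebra_simps)

lemma has_pd2_state:
  assumes "y \<in> \<Theta>" "i < 4" "j < 4"
  shows "has_pd i (pd j \<Psi>) y (phase y * (\<tau> i * (\<tau> j * \<psi> y + \<psi>1 j y) + (\<tau> j * \<psi>1 i y + \<psi>2 i j y)))"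
proof -
  have "has_pd i (\<lambda>y. phase y * (\<tau> j * \<psi> y + \<psi>1 j y)) y
     (phase y * ((\<tau> j * \<psi>1 i y + 0 * \<psi> y) + \<psi>2 i j y) + \<tau> i * phase y * (\<tau> j * \<psi> y + \<psi>1 j y))"
    by (intro has_pd_mult has_pd_add has_pd_const has_pd_phase \<psi>1 \<psi>2 assms)
  then have "has_pd i (pd j \<Psi>) y
     (phase y * ((\<tau> j * \<psi>1 i y + 0 * \<psi> y) + \<psi>2 i j y) + \<tau> i * phase y * (\<tau> j * \<psi> y + \<psi>1 j y))"
    by (rule has_pd_cong[OF _ \<Theta>]) (use assms has_pd_imp_pd[OF has_pd_state] in auto)
  then show ?thesis by (simp add: algebra_simps)
qed

lemmas pd_state = has_pd_imp_pd[OF has_pd_state] and pd2_state = has_pd_imp_pd[OF has_pd2_state]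

lemma sum_1_3: "(\<Sum>k=1..3. h k) = h 1 + h 2 + h (3::nat)" for h :: "nat \<Rightarrow> complex"
  by (simp add: numeral_eq_Suc)

text \<open>After the phase is factored out, the first derivatives of \<psi> cancel and the
  coefficients of \<open>\<psi> x\<close> add up to \<open>M\<^sup>2\<close>.\<close>

lemma free_equation:
  assumes x: "x \<in> \<Theta>"
    and wave: "(1 - 2 * V) * \<psi>2 0 0 x - \<psi>2 1 1 x - \<psi>2 2 2 x - \<psi>2 3 3 x + of_real (M\<^sup>2) * \<psi> x = 0"
  shows "2 * \<i> * of_real M * pd 0 \<Psi> x =
    space_laplacian \<Psi> x + 2 * V * of_real (M\<^sup>2) * \<Psi> x + (1 - 2 * V) * pd 0 (pd 0 \<Psi>) x + 4 * \<i> * of_real M * V * pd 0 \<Psi> x"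
proof -
  have "space_laplacian \<Psi> x + 2 * V * of_real (M\<^sup>2) * \<Psi> x + (1 - 2 * V) * pd 0 (pd 0 \<Psi>) x + 4 * \<i> * of_real M * V * pd 0 \<Psi> x
     - 2 * \<i> * of_real M * pd 0 \<Psi> x =
     phase x * ((1 - 2 * V) * \<psi>2 0 0 x - \<psi>2 1 1 x - \<psi>2 2 2 x - \<psi>2 3 3 x + of_real (M\<^sup>2) * \<psi> x)"
    unfolding space_laplacian_def sum_1_3 using x by (simp add: pd_state pd2_state \<tau>_def state_phase)
      (simp add: algebra_simps power2_eq_square)
  then show ?thesis unfolding wave by simp
qed

text \<open>A lowered component carries the sign \<open>eps j\<close>, which the outer
  \<open>eps j\<close> squares away; so the first-order terms form a derivative along
  \<open>Y\<close>, and the derivatives of the coefficients form its divergence. Differentiating the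
  phase along \<open>Y\<close> contributes \<open>- 2 * M * Q * Y x 0\<close>. The last term of the
  equation cancels this, since \<open>lowered Y x 0\<close> is \<open>- Y x 0\<close>.\<close>

lemma minimal_coupling_equation:
  assumes x: "x \<in> \<Theta>"
    and Y: "\<And>i k. i < 4 \<Longrightarrow> k < 4 \<Longrightarrow> has_pd i (\<lambda>y. Y y k) x (Y1 i k)"
    and wave: "\<psi>2 0 0 x - \<psi>2 1 1 x - \<psi>2 2 2 x - \<psi>2 3 3 x
      + 2 * \<i> * of_real Q * (\<Sum>j<4. of_real (Y x j) * \<psi>1 j x) + \<i> * of_real Q * of_real (\<Sum>i<4. Y1 i i) * \<psi> x
      + of_real (Q\<^sup>2 * (- (Y x 0)\<^sup>2 + (Y x 1)\<^sup>2 + (Y x 2)\<^sup>2 + (Y x 3)\<^sup>2)) * \<psi> x + of_real (M\<^sup>2) * \<psi> x = 0"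
  shows "2 * \<i> * of_real M * pd 0 \<Psi> x =
    (\<Sum>j=0..3. of_real (eps j) * (coupled_deriv Q (lowered Y) j \<circ> coupled_deriv Q (lowered Y) j) \<Psi> x)
    - 2 * of_real (M * Q * lowered Y x 0) * \<Psi> x"
proof -
  \<comment> \<open>The outer derivative also acts on the coefficient
    \<open>Q * eps j * Y y j\<close>, which gives the term with \<open>Y1 j j\<close>.\<close>
  have cd: "coupled_deriv Q (lowered Y) j (coupled_deriv Q (lowered Y) j \<Psi>) x =
      - pd j (pd j \<Psi>) x + \<i> * of_real (Q * eps j * Y1 j j) * \<Psi> x
      + 2 * \<i> * of_real (Q * eps j * Y x j) * pd j \<Psi> x + of_real (Q * eps j * Y x j)^2 * \<Psi> x" if j: "j < 4" for j
  proof -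
    have "has_pd j (\<lambda>y. Q * eps j * Y y j) x (Q * eps j * Y1 j j + 0 * Y x j)"
      by (intro has_pd_mult has_pd_const Y j)
    then have A: "has_pd j (\<lambda>y. complex_of_real (Q * eps j * Y y j)) x (of_real (Q * eps j * Y1 j j))"
      using has_pd_linear[OF bounded_linear_of_real] by fastforce
    have "has_pd j (coupled_deriv Q (lowered Y) j \<Psi>) x
      ((\<i> * pd j (pd j \<Psi>) x + 0 * pd j \<Psi> x) + (of_real (Q * eps j * Y x j) * pd j \<Psi> x + of_real (Q * eps j * Y1 j j) * \<Psi> x))"
      unfolding coupled_deriv_def[abs_def] lowered_def mult.assoc[symmetric]
      by (intro has_pd_add has_pd_mult has_pd_const A)
        (use x j has_pd2_state has_pd_state pd_state pd2_state in auto)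
    from has_pd_imp_pd[OF this] show ?thesis
      by (simp add: coupled_deriv_def[of _ _ _ "coupled_deriv Q (lowered Y) j \<Psi>"])
        (simp add: coupled_deriv_def lowered_def algebra_simps power2_eq_square)
  qed
  have less: "1 < (4 :: nat)" by simp
  have s: "(\<Sum>j=0..3. h j) = h 0 + h 1 + h 2 + h (3::nat)" for h :: "nat \<Rightarrow> complex"
    by (simp add: numeral_eq_Suc)
  have "(\<Sum>j=0..3. of_real (eps j) * (coupled_deriv Q (lowered Y) j \<circ> coupled_deriv Q (lowered Y) j) \<Psi> x)
    - 2 * of_real (M * Q * lowered Y x 0) * \<Psi> x - 2 * \<i> * of_real M * pd 0 \<Psi> x =
    phase x * (\<psi>2 0 0 x - \<psi>2 1 1 x - \<psi>2 2 2 x - \<psi>2 3 3 x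
      + 2 * \<i> * of_real Q * (\<Sum>j<4. of_real (Y x j) * \<psi>1 j x) + \<i> * of_real Q * of_real (\<Sum>i<4. Y1 i i) * \<psi> x
      + of_real (Q\<^sup>2 * (- (Y x 0)\<^sup>2 + (Y x 1)\<^sup>2 + (Y x 2)\<^sup>2 + (Y x 3)\<^sup>2)) * \<psi> x + of_real (M\<^sup>2) * \<psi> x)"
    unfolding s comp_apply cd[of 0, simplified] cd[of 1, OF less] cd[of 2, simplified] cd[of 3, simplified] sum_lessThan_4
    using x by (simp add: eps_def minkowski_def lowered_def pd_state pd2_state \<tau>_def state_phase)
      (simp add: algebra_simps power2_eq_square)
  then show ?thesis unfolding wave by simp
qed

end

text \<open>\<sigma> chooses between the canonical function and its conjugate. The second equation
  is multiplied by \<open>\<i> * \<sigma>\<close>; since \<open>\<sigma> * \<sigma> = 1\<close>, the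
  terms linear in \<open>Q\<close> get the right sign for both choices.\<close>

lemma complex_coupled_wave:
  fixes LA LB SA SB a b N v m \<kappa> \<sigma> :: real
  assumes re: "LA - 2 * \<kappa> * SB + \<kappa>\<^sup>2 * N * a - \<kappa> * v * b + m * a = 0"
    and im: "LB + 2 * \<kappa> * SA + \<kappa>\<^sup>2 * N * b + \<kappa> * v * a + m * b = 0"
    and \<sigma>: "\<sigma> = 1 \<or> \<sigma> = - 1" and Q: "Q = \<sigma> * \<kappa>"
  shows "complex_of_real LA + \<i> * of_real (\<sigma> * LB) + 2 * \<i> * of_real Q * (of_real SA + \<i> * of_real (\<sigma> * SB))
    + \<i> * of_real Q * of_real v * (of_real a + \<i> * of_real (\<sigma> * b))
    + of_real (Q\<^sup>2 * N) * (of_real a + \<i> * of_real (\<sigma> * b)) + of_real m * (of_real a + \<i> * of_real (\<sigma> * b)) = 0"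
  using \<sigma>
proof
  assume \<sigma>1: "\<sigma> = 1"
  show ?thesis using re im unfolding Q \<sigma>1 by (simp add: complex_eq_iff algebra_simps)
next
  assume \<sigma>1: "\<sigma> = - 1"
  show ?thesis using re im unfolding Q \<sigma>1 by (simp add: complex_eq_iff algebra_simps)
qed

theorem theorem4:
  fixes \<Theta> :: "(nat \<Rightarrow> real) set" and \<delta> :: real
    and W :: "('w, 'c) mfd" and gW :: "('w, 'c) bilin_field"
    and gP :: "('w pt, 'c lab) bilin_field"
    and \<mu> lam M Q :: real
    and \<phi> :: "(nat \<Rightarrow> real) \<times> real set \<Rightarrow> real" and \<beta> :: "'w \<Rightarrow> real"
    and C :: "('w pt, 'c lab) mfd" and g0 :: "('w pt, 'c lab) bilin_field"
    and \<Psi> :: "(nat \<Rightarrow> real) \<Rightarrow> complex"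
  assumes "openin (Euclidean_space 4) \<Theta>" and "\<delta> > 0"
    and "smooth_manifold W" and "compact_space (mfd_topology W)"
    and "riemannian_metric W gW" and "\<exists>s. \<forall>w\<in>pts W. scal W gW w = s"
    and C: "C = spacetime \<Theta> \<delta> W" and g0: "g0 = neutral_metric gW"
    and "elementary_oscillating \<Theta> \<delta> W gW gP \<mu> lam \<phi> \<beta>"
    and "\<exists>w\<in>pts W. \<beta> w \<noteq> 0"
    and "mass_frequency \<Theta> \<delta> W gW \<mu> lam M" and "M > 0"
    and "electric_charge \<Theta> \<delta> W gW lam (\<lambda>p. on_base_circle \<phi> p * on_W \<beta> p) Q"
    and \<Psi>: "\<Psi> = state_function \<Theta> \<delta> lam \<phi> M Q"
  shows
    "(gP = g0 \<longrightarrow>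
       (\<forall>x\<in>\<Theta>. 2 * \<i> * of_real M * pd 0 \<Psi> x = space_laplacian \<Psi> x + pd 0 (pd 0 \<Psi>) x))
     \<and>
     (\<forall>(I :: real set) (U :: (nat \<Rightarrow> real) set) v X1.
       U \<subseteq> topspace (Euclidean_space 3) \<longrightarrow>
       \<Theta> = {x \<in> topspace (Euclidean_space 4). x 0 \<in> I \<and> (\<lambda>k. x (Suc k)) \<in> U} \<longrightarrow>
       gP = gravity_potential C g0 (on_space v) (lift_time_W X1) \<longrightarrow>
       inner_coord_eq C g0 (lift_time_W X1) 0 1 \<longrightarrow>
       inner_coord_eq C g0 (lift_time_W X1) 4 0 \<longrightarrow>
       inner_eq C g0 (lift_time_W X1) (lift_time_W X1) 0 \<longrightarrow>
       (\<forall>p\<in>pts C. scal C gP p = scal C g0 p) \<longrightarrow>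
       smooth_fun 3 U v \<longrightarrow>
       vector_field (time_W_mfd I W) X1 \<longrightarrow>
       parallel C g0 (lift_time_W X1) \<longrightarrow>
       annihilates_eigenspace \<Theta> \<delta> W gW \<mu> (lift_time_W X1) \<longrightarrow>
       (\<forall>x\<in>\<Theta>. let V = of_real (v (\<lambda>k. x (Suc k))) in
          2 * \<i> * of_real M * pd 0 \<Psi> x =
            space_laplacian \<Psi> x + 2 * V * of_real (M\<^sup>2) * \<Psi> x
            + (1 - 2 * V) * pd 0 (pd 0 \<Psi>) x + 4 * \<i> * of_real M * V * pd 0 \<Psi> x))
     \<and>
     (\<forall>(Y :: (nat \<Rightarrow> real) \<Rightarrow> nat \<Rightarrow> real) X2.
       gP = em_potential C g0 (lift_base Y) (lift_fibre X2) \<longrightarrow>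
       inner_coord_eq C g0 (lift_fibre X2) 4 1 \<longrightarrow>
       inner_eq C g0 (lift_fibre X2) (lift_base Y) 0 \<longrightarrow>
       inner_eq C g0 (lift_fibre X2) (lift_fibre X2) 0 \<longrightarrow>
       (\<forall>p\<in>pts C. scal C gP p = scal C g0 p) \<longrightarrow>
       vector_field (euclid_mfd 4 \<Theta>) (\<lambda>_. Y) \<longrightarrow>
       vector_field (fibre_mfd \<delta> W) X2 \<longrightarrow>
       parallel C g0 (lift_fibre X2) \<longrightarrow>
       annihilates_eigenspace \<Theta> \<delta> W gW \<mu> (lift_fibre X2) \<longrightarrow>
       (\<forall>x\<in>\<Theta>. 2 * \<i> * of_real M * pd 0 \<Psi> x =
          (\<Sum>j=0..3. of_real (eps j) *
             (coupled_deriv Q (lowered Y) j \<circ> coupled_deriv Q (lowered Y) j) \<Psi> x)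
          - 2 * of_real (M * Q * lowered Y x 0) * \<Psi> x))"
proof -
  let ?\<kappa> = "sqrt lam"
  have ax: "axis_open 4 \<Theta>" and sub: "\<Theta> \<subseteq> topspace (Euclidean_space 4)"
    using openin_Euclidean_imp_axis_open[OF assms(1)] openin_subset[OF assms(1)] by blast+
  have lam: "lam \<ge> 0" and sm: "smooth_function (product_mfd (euclid_mfd 4 \<Theta>) (circle_mfd \<delta>)) \<phi>"
    and ev: "\<And>x. x \<in> \<Theta> \<Longrightarrow> (\<lambda>s. \<phi> (x, s)) \<in> eigenspace (circle_mfd \<delta>) circle_metric lam"
    using assms(9) by (auto simp: elementary_oscillating_def)
  obtain w where w: "w \<in> pts W" "\<beta> w \<noteq> 0" using assms(10) by blast
  \<comment> \<open>Values of \<phi> at phase 0 and at a quarter turn inherit its smoothness. For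
    \<open>lam = 0\<close> there is no quarter turn, and the sine coefficient is set to 0.\<close>
  define A where "A = (\<lambda>y. \<phi> (y, circle_pt \<delta> 0))"
  define B where "B = (if lam = 0 then (\<lambda>_. 0) else (\<lambda>y. \<phi> (y, circle_pt \<delta> (pi / (2 * ?\<kappa>)))))"
  have quarter: "?\<kappa> * (pi / (2 * ?\<kappa>)) = pi / 2" if "lam \<noteq> 0" using that by simp
  have \<phi>: "\<phi> (y, circle_pt \<delta> u) = A y * cos (?\<kappa> * u) + B y * sin (?\<kappa> * u)" if y: "y \<in> \<Theta>" for y u
  proof -
    obtain a b where ab: "\<And>u. \<phi> (y, circle_pt \<delta> u) = a * cos (?\<kappa> * u) + b * sin (?\<kappa> * u)"
      using eigenspace_circle_fourier[OF \<open>\<delta> > 0\<close> lam ev[OF y]] by blast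
    show ?thesis
    proof (cases "lam = 0")
      case False
      then show ?thesis unfolding A_def B_def ab quarter[OF False] by (simp add: ab quarter[OF False])
    qed (simp add: A_def B_def ab)
  qed
  have has_A: "has_pd i A y (pd i A y)" "has_pd i (pd j A) y (pd i (pd j A) y)"
    if "y \<in> \<Theta>" "i < 4" "j < 4" for y i j
    using smooth_function_slice[OF ax sub \<open>\<delta> > 0\<close> sm A_def that] .
  have pd_0: "pd i (\<lambda>_. 0 :: real) = (\<lambda>_. 0)" for i
    by (rule ext) (rule has_pd_imp_pd[OF has_pd_const])
  have has_B: "has_pd i B y (pd i B y) \<and> has_pd i (pd j B) y (pd i (pd j B) y)"
    if "y \<in> \<Theta>" "i < 4" "j < 4" for y i j
  proof (cases "lam = 0")
    case True
    then show ?thesis by (simp add: B_def pd_0 has_pd_const)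
  next
    case False
    then have "B = (\<lambda>y. \<phi> (y, circle_pt \<delta> (pi / (2 * ?\<kappa>))))" by (simp add: B_def)
    from smooth_function_slice[OF ax sub \<open>\<delta> > 0\<close> sm this that] show ?thesis by simp
  qed
  interpret osc: oscillating \<Theta> \<delta> W gW gP \<mu> lam M \<phi> \<beta> w A B "\<lambda>i. pd i A" "\<lambda>i. pd i B" "\<lambda>i j. pd i (pd j A)" "\<lambda>i j. pd i (pd j B)"
  proof unfold_locales
    show "B y = 0 \<and> pd i B y = 0 \<and> pd i (pd j B) y = 0" if "lam = 0" for y i j
      using that by (simp add: B_def pd_0)
  qed (use ax sub assms w \<phi> has_A has_B in auto)
  \<comment> \<open>\<open>state_function\<close> conjugates exactly when \<open>Q < 0\<close>. If
    \<open>Q = 0\<close>, then \<open>?\<kappa>\<close> is 0 as well, so the value 1 is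
    consistent.\<close>
  define \<sigma> :: real where "\<sigma> = (if Q \<ge> 0 then 1 else - 1)"
  have "Q = ?\<kappa> \<or> Q = - ?\<kappa>" using assms(13) by (auto simp: electric_charge_def Let_def)
  then have Q: "Q = \<sigma> * ?\<kappa>" using lam by (auto simp: \<sigma>_def)
  define \<psi> where "\<psi> y = complex_of_real (A y) + \<i> * of_real (\<sigma> * B y)" for y
  define \<psi>1 where "\<psi>1 i y = complex_of_real (pd i A y) + \<i> * of_real (\<sigma> * pd i B y)" for i y
  define \<psi>2 where "\<psi>2 i j y = complex_of_real (pd i (pd j A) y) + \<i> * of_real (\<sigma> * pd i (pd j B) y)" for i j y
  \<comment> \<open>\<open>fourier_parts\<close> is an arbitrary choice of coefficients. On \<Theta>
    phase 0 forces the first and, if \<open>lam \<noteq> 0\<close>, the quarter turn forces the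
    second; if \<open>lam = 0\<close>, the canonical function contains only the first.\<close>
  have canonical: "canonical_function \<Theta> \<delta> lam \<phi> y = complex_of_real (A y) + \<i> * of_real (B y)" if y: "y \<in> \<Theta>" for y
  proof -
    obtain f1 f2 where f: "fourier_parts \<Theta> \<delta> lam \<phi> = (f1, f2)" by (metis surj_pair)
    have "\<exists>p. case p of (f1, f2) \<Rightarrow> \<forall>x\<in>\<Theta>. \<forall>u. \<phi> (x, circle_pt \<delta> u) = f1 x * cos (?\<kappa> * u) + f2 x * sin (?\<kappa> * u)"
      by (rule exI[of _ "(A, B)"]) (simp add: \<phi>)
    from someI_ex[OF this] have "\<forall>x\<in>\<Theta>. \<forall>u. \<phi> (x, circle_pt \<delta> u) = f1 x * cos (?\<kappa> * u) + f2 x * sin (?\<kappa> * u)"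
      using f unfolding fourier_parts_def by simp
    then have f12: "\<phi> (y, circle_pt \<delta> u) = f1 y * cos (?\<kappa> * u) + f2 y * sin (?\<kappa> * u)" for u using y by blast
    have "f1 y = A y" using f12[of 0] by (simp add: A_def)
    moreover have "f2 y = B y" if "lam \<noteq> 0"
      using f12[of "pi / (2 * ?\<kappa>)"] that unfolding quarter[OF that] by (simp add: B_def)
    moreover have "B y = 0" if "lam = 0" using that by (simp add: B_def)
    ultimately show ?thesis by (auto simp: canonical_function_def f)
  qed
  interpret ps: phase_shift \<Theta> M \<Psi> \<psi> \<psi>1 \<psi>2
  proof
    have lin: "bounded_linear (\<lambda>b. \<i> * complex_of_real (\<sigma> * b))"
      by (intro bounded_linear_const_mult bounded_linear_of_real[THEN bounded_linear_compose] bounded_linear_mult_right)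
    show "\<Psi> y = exp (\<i> * complex_of_real (M * y 0)) * \<psi> y" if "y \<in> \<Theta>" for y
      by (simp add: \<Psi> state_function_def canonical[OF that] \<psi>_def \<sigma>_def)
    show "has_pd i \<psi> y (\<psi>1 i y)" if "y \<in> \<Theta>" "i < 4" for y i
      unfolding \<psi>_def[abs_def] \<psi>1_def
      by (intro has_pd_add has_pd_linear[OF bounded_linear_of_real] has_pd_linear[OF lin])
        (use that has_A has_B in auto)
    show "has_pd i (\<psi>1 j) y (\<psi>2 i j y)" if "y \<in> \<Theta>" "i < 4" "j < 4" for y i j
      unfolding \<psi>1_def[abs_def] \<psi>2_def
      by (intro has_pd_add has_pd_linear[OF bounded_linear_of_real] has_pd_linear[OF lin])
        (use that has_A has_B in auto)
  qed (rule ax)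
  have combine: "complex_of_real a + \<i> * of_real (\<sigma> * b) = 0" if "a = 0" "b = 0" for a b
    using that by simp
  show ?thesis
  proof (intro conjI impI allI ballI)
    fix x assume "gP = g0" and x: "x \<in> \<Theta>"
    then have gP: "gP = neutral_metric gW" by (simp add: g0)
    \<comment> \<open>The neutral equation is written as the case \<open>V = 0\<close> of the
      gravitational one.\<close>
    have "(1 - 2 * 0) * \<psi>2 0 0 x - \<psi>2 1 1 x - \<psi>2 2 2 x - \<psi>2 3 3 x + of_real (M\<^sup>2) * \<psi> x = 0"
      using combine[OF osc.neutral_wave[OF x gP]] by (simp add: \<psi>_def \<psi>2_def algebra_simps)
    from ps.free_equation[OF x this]
    show "2 * \<i> * of_real M * pd 0 \<Psi> x = space_laplacian \<Psi> x + pd 0 (pd 0 \<Psi>) x" by simp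
  next
    fix I :: "real set" and U :: "(nat \<Rightarrow> real) set" and v X1 x
    assume I: "\<Theta> = {x \<in> topspace (Euclidean_space 4). x 0 \<in> I \<and> (\<lambda>k. x (Suc k)) \<in> U}"
      and gP: "gP = gravity_potential C g0 (on_space v) (lift_time_W X1)"
      and X0: "inner_coord_eq C g0 (lift_time_W X1) 0 1"
      and XX: "inner_eq C g0 (lift_time_W X1) (lift_time_W X1) 0"
      and v: "smooth_fun 3 U v" and X1: "vector_field (time_W_mfd I W) X1"
      and par: "parallel C g0 (lift_time_W X1)" and x: "x \<in> \<Theta>"
    let ?V = "v (\<lambda>k. x (Suc k))"
    have "(1 - 2 * of_real ?V) * \<psi>2 0 0 x - \<psi>2 1 1 x - \<psi>2 2 2 x - \<psi>2 3 3 x + of_real (M\<^sup>2) * \<psi> x = 0"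
      using combine[OF osc.gravity_wave[OF x I gP[unfolded C g0] X0[unfolded C g0] XX[unfolded C g0] v X1 par[unfolded C g0]]]
      by (simp add: \<psi>_def \<psi>2_def algebra_simps)
    from ps.free_equation[OF x this]
    show "let V = of_real ?V in 2 * \<i> * of_real M * pd 0 \<Psi> x =
        space_laplacian \<Psi> x + 2 * V * of_real (M\<^sup>2) * \<Psi> x + (1 - 2 * V) * pd 0 (pd 0 \<Psi>) x + 4 * \<i> * of_real M * V * pd 0 \<Psi> x"
      by (simp only: Let_def)
  next
    fix Y :: "(nat \<Rightarrow> real) \<Rightarrow> nat \<Rightarrow> real" and X2 x
    assume gP: "gP = em_potential C g0 (lift_base Y) (lift_fibre X2)"
      and X4: "inner_coord_eq C g0 (lift_fibre X2) 4 1"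
      and XY: "inner_eq C g0 (lift_fibre X2) (lift_base Y) 0"
      and XX: "inner_eq C g0 (lift_fibre X2) (lift_fibre X2) 0"
      and Yv: "vector_field (euclid_mfd 4 \<Theta>) (\<lambda>_. Y)" and X2: "vector_field (fibre_mfd \<delta> W) X2"
      and par: "parallel C g0 (lift_fibre X2)" and x: "x \<in> \<Theta>"
    define Y1 where "Y1 i k = pd i (\<lambda>y. Y y k) x" for i k
    have Y: "has_pd i (\<lambda>y. Y y k) x (Y1 i k)" if "i < 4" "k < 4" for i k
    proof -
      have "smooth_in_chart (euclid_mfd 4 \<Theta>) () (\<lambda>y. Y y k)" using Yv that unfolding vector_field_def by simp
      then have "has_cderiv (euclid_mfd 4 \<Theta>) () i (\<lambda>y. Y y k) x (cderiv (euclid_mfd 4 \<Theta>) () i (\<lambda>y. Y y k) x)"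
        by (rule smooth_in_chart_has_cderiv) (use x that in auto)
      then have "has_pd i (\<lambda>y. Y y k) x (cderiv (euclid_mfd 4 \<Theta>) () i (\<lambda>y. Y y k) x)"
        unfolding has_cderiv_def euclid_mfd_simps by (rule has_pd_cong[OF _ ax]) (use x that in auto)
      then show ?thesis unfolding Y1_def using has_pd_imp_pd by metis
    qed
    have "\<psi>2 0 0 x - \<psi>2 1 1 x - \<psi>2 2 2 x - \<psi>2 3 3 x
      + 2 * \<i> * of_real Q * (\<Sum>j<4. of_real (Y x j) * \<psi>1 j x) + \<i> * of_real Q * of_real (\<Sum>i<4. Y1 i i) * \<psi> x
      + of_real (Q\<^sup>2 * (- (Y x 0)\<^sup>2 + (Y x 1)\<^sup>2 + (Y x 2)\<^sup>2 + (Y x 3)\<^sup>2)) * \<psi> x + of_real (M\<^sup>2) * \<psi> x = 0"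
    proof -
      note eqs = osc.electromagnetic_wave[OF x gP[unfolded C g0] X4[unfolded C g0] XY[unfolded C g0] XX[unfolded C g0] Y
        X2 par[unfolded C g0]]
      have lam': "lam = ?\<kappa>\<^sup>2" using lam by simp
      have "\<sigma> = 1 \<or> \<sigma> = - 1" by (simp add: \<sigma>_def)
      from complex_coupled_wave[OF _ _ this Q, where a = "A x" and b = "B x" and m = "M\<^sup>2"
        and N = "- (Y x 0)\<^sup>2 + (Y x 1)\<^sup>2 + (Y x 2)\<^sup>2 + (Y x 3)\<^sup>2" and v = "\<Sum>i<4. Y1 i i"
        and SA = "\<Sum>j<4. Y x j * pd j A x" and SB = "\<Sum>j<4. Y x j * pd j B x"
        and LA = "pd 0 (pd 0 A) x - pd 1 (pd 1 A) x - pd 2 (pd 2 A) x - pd 3 (pd 3 A) x"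
        and LB = "pd 0 (pd 0 B) x - pd 1 (pd 1 B) x - pd 2 (pd 2 B) x - pd 3 (pd 3 B) x", folded lam', OF eqs]
      show ?thesis
        unfolding \<psi>_def \<psi>1_def \<psi>2_def
        by (simp add: sum_lessThan_4) (simp add: algebra_simps)
    qed
    from ps.minimal_coupling_equation[OF x Y this]
    show "2 * \<i> * of_real M * pd 0 \<Psi> x =
      (\<Sum>j=0..3. of_real (eps j) * (coupled_deriv Q (lowered Y) j \<circ> coupled_deriv Q (lowered Y) j) \<Psi> x)
      - 2 * of_real (M * Q * lowered Y x 0) * \<Psi> x" .
  qed
qed

end
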